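(* Let $r,s\in\mathbb N_0$. For any $v\in\mathcal D'^r_s(M)$ the function $$\iota^r_s(v):\hat{\mathcal A}_0(M)\times M\times\hat{\mathcal B}(M)\to\mathrm T^r_sM,\qquad \iota^r_s(v)(\omega,p,A)\cdot\tilde t(p):=\langle v(\cdot),\big(A^s_r(p,\cdot)\,\tilde t(p)\big)\otimes\omega(\cdot)\rangle\quad(\tilde t\in\mathcal T^s_r(M)),$$ is smooth, hence a member of $\hat{\mathcal E}^r_s(M)$.
   Context: $M$ is an orientable (with fixed orientation), paracompact, smooth Hausdorff manifold of finite dimension $n$. $\Omega^n_{\mathrm c}(M)$: compactly supported smooth $n$-forms; $\mathcal T^r_s(M)$: smooth sections of the bundle $\mathrm T^r_sM$ of tensors with $r$ contravariant and $s$ covariant slots. Section spaces $\Gamma(M,E)$ carry the (F)-topology (uniform convergence of all derivatives on compact sets in vector bundle charts), and $\Gamma_{\mathrm c}(M,E)$ the usual (LF) inductive limit topology. $\mathcal D'^r_s(M):=(\mathcal T^s_r(M)\otimes_{C^\infty(M)}\Omega^n_{\mathrm c}(M))'$ (topological dual for the (LF)-topology). Smoothness is in the sense of convenient calculus (Kriegl–Michor): a map between locally convex spaces (or manifolds modelled on them) is smooth iff it maps smooth curves to smooth curves. $\hat{\mathcal A}_0(M):=\{\omega\in\Omega^n_{\mathrm c}(M):\int_M\omega=1\}$. $\mathrm{TO}(M,M)$ is the vector bundle over $M\times M$ with fiber $\mathrm L(\mathrm T_pM,\mathrm T_qM)$ at $(p,q)$, and $\hat{\mathcal B}(M):=\Gamma_{\mathrm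 c}(\mathrm{TO}(M,M))$. Both $\hat{\mathcal A}_0(M)$ and $\hat{\mathcal B}(M)$ carry their (LF)-topologies. The basic space is $\hat{\mathcal E}^r_s(M):=\{u\in C^\infty(\hat{\mathcal A}_0(M)\times M\times\hat{\mathcal B}(M),\mathrm T^r_sM): u(\omega,p,A)\in(\mathrm T^r_s)_pM\}$. For $A\in\hat{\mathcal B}(M)$, $A^s_r(p,q):(\mathrm T^s_r)_pM\to(\mathrm T^s_r)_qM$ is the linear map $w_1\otimes\dots\otimes w_s\otimes\beta^1\otimes\dots\otimes\beta^r\mapsto A(p,q)w_1\otimes\dots\otimes A(p,q)w_s\otimes A(q,p)^{\mathrm{ad}}\beta^1\otimes\dots\otimes A(q,p)^{\mathrm{ad}}\beta^r$ ($w_i\in\mathrm T_pM$, $\beta^j\in\mathrm T^*_pM$, $^{\mathrm{ad}}$ = adjoint). The right-hand side of the defining formula of $\iota^r_s(v)$ depends linearly on $\tilde t(p)$, so that $\iota^r_s(v)(\omega,p,A)\in(\mathrm T^r_s)_pM$. *)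

theory Defs
  imports "HOL-Analysis.Analysis" "HOL-Combinatorics.Permutations" "HOL-Library.Function_Algebras"
begin

section \<open>Function spaces as real vector spaces\<close>

instantiation "fun" :: (type, real_vector) real_vector
begin

definition scaleR_fun_def: "scaleR a f = (\<lambda>x. a *\<^sub>R f x)"

instance
  by standard
    (auto simp: scaleR_fun_def plus_fun_def algebra_simps)

end

definition linear_on_subspace :: "'v::real_vector set \<Rightarrow> ('v \<Rightarrow> 'w::real_vector) \<Rightarrow> bool" where
  "linear_on_subspace V f \<longleftrightarrow>
     (\<forall>x\<in>V. \<forall>y\<in>V. \<forall>a b. f (a *\<^sub>R x + b *\<^sub>R y) = a *\<^sub>R f x + b *\<^sub>R f y)"


section \<open>Smooth functions on open subsets of Euclidean space\<close>

fun iter_deriv :: "'a list \<Rightarrow> ('a::real_normed_vector \<Rightarrow> 'b::real_normed_vector) \<Rightarrow> 'a \<Rightarrow> 'b" where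
  "iter_deriv [] f = f"
| "iter_deriv (d # ds) f = iter_deriv ds (\<lambda>z. frechet_derivative f (at z) d)"

text \<open>Only used for open \<open>S\<close> in finite-dimensional spaces, where it is \<open>C\<^sup>\<infinity>\<close>: all iterated
  directional derivatives exist and are differentiable, hence continuous.\<close>

definition smooth_on :: "'a::real_normed_vector set \<Rightarrow> ('a \<Rightarrow> 'b::real_normed_vector) \<Rightarrow> bool" where
  "smooth_on S f \<longleftrightarrow> (\<forall>ds. \<forall>z\<in>S. iter_deriv ds f differentiable (at z))"


section \<open>Locally convex spaces and convenient smoothness\<close>

definition seminorm_on :: "'v::real_vector set \<Rightarrow> ('v \<Rightarrow> real) \<Rightarrow> bool" where
  "seminorm_on V p \<longleftrightarrow>
     (\<forall>x\<in>V. 0 \<le> p x) \<and>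
     (\<forall>x\<in>V. \<forall>a. p (a *\<^sub>R x) = \<bar>a\<bar> * p x) \<and>
     (\<forall>x\<in>V. \<forall>y\<in>V. p (x + y) \<le> p x + p y)"

text \<open>The locally convex topology on the vector subspace \<open>V\<close> generated by the family \<open>P\<close>
  of seminorms on \<open>V\<close>.\<close>

definition lc_open :: "'v::real_vector set \<Rightarrow> ('v \<Rightarrow> real) set \<Rightarrow> 'v set \<Rightarrow> bool" where
  "lc_open V P U \<longleftrightarrow>
     U \<subseteq> V \<and>
     (\<forall>x\<in>U. \<exists>Q \<epsilon>. finite Q \<and> Q \<subseteq> P \<and> 0 < \<epsilon> \<and> {y\<in>V. \<forall>q\<in>Q. q (y - x) < \<epsilon>} \<subseteq> U)"

definition lc_topology :: "'v::real_vector set \<Rightarrow> ('v \<Rightarrow> real) set \<Rightarrow> 'v topology" where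
  "lc_topology V P = topology (lc_open V P)"

lemma istopology_lc_open: "istopology (lc_open V P)"
  unfolding istopology_def
proof (intro conjI allI impI)
  fix S T assume S: "lc_open V P S" and T: "lc_open V P T"
  show "lc_open V P (S \<inter> T)"
    unfolding lc_open_def
  proof (intro conjI ballI)
    show "S \<inter> T \<subseteq> V" using S by (auto simp: lc_open_def)
    fix x assume x: "x \<in> S \<inter> T"
    obtain Q1 e1 where 1: "finite Q1" "Q1 \<subseteq> P" "0 < e1" "{y\<in>V. \<forall>q\<in>Q1. q (y - x) < e1} \<subseteq> S"
      using S x unfolding lc_open_def by blast
    obtain Q2 e2 where 2: "finite Q2" "Q2 \<subseteq> P" "0 < e2" "{y\<in>V. \<forall>q\<in>Q2. q (y - x) < e2} \<subseteq> T"
      using T x unfolding lc_open_def by blast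
    have "{y\<in>V. \<forall>q\<in>Q1 \<union> Q2. q (y - x) < min e1 e2} \<subseteq>
        {y\<in>V. \<forall>q\<in>Q1. q (y - x) < e1} \<inter> {y\<in>V. \<forall>q\<in>Q2. q (y - x) < e2}"
      by simp blast
    also have "\<dots> \<subseteq> S \<inter> T"
      using 1(4) 2(4) by blast
    finally have "{y\<in>V. \<forall>q\<in>Q1 \<union> Q2. q (y - x) < min e1 e2} \<subseteq> S \<inter> T" .
    moreover have "finite (Q1 \<union> Q2)" "Q1 \<union> Q2 \<subseteq> P" "0 < min e1 e2"
      using 1(1-3) 2(1-3) by simp_all
    ultimately show "\<exists>Q \<epsilon>. finite Q \<and> Q \<subseteq> P \<and> 0 < \<epsilon> \<and> {y\<in>V. \<forall>q\<in>Q. q (y - x) < \<epsilon>} \<subseteq> S \<inter> T"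
      by blast
  qed
next
  fix \<K> assume K: "\<forall>K\<in>\<K>. lc_open V P K"
  show "lc_open V P (\<Union>\<K>)"
    unfolding lc_open_def
  proof (intro conjI ballI)
    show "\<Union>\<K> \<subseteq> V" using K by (auto simp: lc_open_def)
    fix x assume "x \<in> \<Union>\<K>"
    then obtain U where U: "U \<in> \<K>" "x \<in> U" by blast
    have "lc_open V P U"
      using K U(1) by blast
    then obtain Q e where "finite Q" "Q \<subseteq> P" "0 < e" "{y\<in>V. \<forall>q\<in>Q. q (y - x) < e} \<subseteq> U"
      using U(2) unfolding lc_open_def by blast
    moreover from this U have "{y\<in>V. \<forall>q\<in>Q. q (y - x) < e} \<subseteq> \<Union>\<K>"
      by blast
    ultimately show "\<exists>Q \<epsilon>. finite Q \<and> Q \<subseteq> P \<and> 0 < \<epsilon> \<and> {y\<in>V. \<forall>q\<in>Q. q (y - x) < \<epsilon>} \<subseteq> \<Union>\<K>"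
      by iprover
  qed
qed

lemma openin_lc_topology: "openin (lc_topology V P) U \<longleftrightarrow> lc_open V P U"
  by (simp add: lc_topology_def istopology_lc_open)

lemma topspace_lc_topology: "topspace (lc_topology V P) = V"
proof -
  have "lc_open V P V"
    unfolding lc_open_def
    by (intro conjI ballI subset_refl exI[of _ "{}"] exI[of _ "1::real"]) auto
  then show ?thesis
    unfolding topspace_def openin_lc_topology by (auto simp: lc_open_def)
qed

text \<open>A curve into a locally convex space with topology \<open>T\<close> is smooth if all its iterated
  derivatives (the functions \<open>d k\<close>) exist as limits of difference quotients.\<close>

definition smooth_curves_lc :: "'v::real_vector topology \<Rightarrow> (real \<Rightarrow> 'v) set" where
  "smooth_curves_lc T =
     {c. \<exists>d :: nat \<Rightarrow> real \<Rightarrow> 'v. d 0 = c \<and> (\<forall>k t. d k t \<in> topspace T) \<and>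
         (\<forall>k t. limitin T (\<lambda>h. (1 / h) *\<^sub>R (d k (t + h) - d k t)) (d (Suc k) t) (at 0))}"

text \<open>A map is smooth in the sense of convenient calculus if it maps smooth curves in the domain
  to smooth curves in the codomain.\<close>

definition convenient_smooth :: "(real \<Rightarrow> 'x) set \<Rightarrow> (real \<Rightarrow> 'y) set \<Rightarrow> ('x \<Rightarrow> 'y) \<Rightarrow> bool" where
  "convenient_smooth C1 C2 f \<longleftrightarrow> (\<forall>c\<in>C1. (\<lambda>t. f (c t)) \<in> C2)"

definition prod_curves :: "(real \<Rightarrow> 'x) set \<Rightarrow> (real \<Rightarrow> 'y) set \<Rightarrow> (real \<Rightarrow> 'x \<times> 'y) set" where
  "prod_curves C1 C2 = {c. (\<lambda>t. fst (c t)) \<in> C1 \<and> (\<lambda>t. snd (c t)) \<in> C2}"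


section \<open>Oriented smooth manifolds\<close>

text \<open>The underlying topological space is the type \<open>'m\<close>. The model space \<open>\<real>\<^sup>n\<close> is a real inner
  product space \<open>'a\<close> together with an ordered orthonormal basis \<open>frame 0, \<dots>, frame (mdim - 1)\<close>;
  unlike the types of class \<open>euclidean_space\<close> this includes \<open>n = 0\<close>. A chart is a pair of its domain
  and the coordinate map, whose values outside the domain are irrelevant. The orientation is a
  section of the orientation bundle: a locally constant sign for each chart, which changes by the
  sign of the Jacobian determinant (for \<open>n = 0\<close> this is a sign at each point).\<close>

type_synonym ('m, 'a) chart = "'m set \<times> ('m \<Rightarrow> 'a)"

record ('m, 'a) mfd =
  mdim :: nat
  frame :: "nat \<Rightarrow> 'a"
  atlas :: "('m, 'a) chart set"
  orient :: "('m, 'a) chart \<Rightarrow> 'm \<Rightarrow> real"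

definition chart_inv :: "('m, 'a) chart \<Rightarrow> 'a \<Rightarrow> 'm" where
  "chart_inv x = inv_into (fst x) (snd x)"

definition transition_deriv ::
  "('m, 'a::real_inner) chart \<Rightarrow> ('m, 'a) chart \<Rightarrow> 'm \<Rightarrow> 'a \<Rightarrow> 'a" where
  "transition_deriv x y p = frechet_derivative (\<lambda>z. snd y (chart_inv x z)) (at (snd x p))"

definition jacobian_det ::
  "('m, 'a::real_inner) mfd \<Rightarrow> ('m, 'a) chart \<Rightarrow> ('m, 'a) chart \<Rightarrow> 'm \<Rightarrow> real" where
  "jacobian_det M x y p =
     (\<Sum>\<pi> | \<pi> permutes {..<mdim M}. of_int (sign \<pi>) *
        (\<Prod>i<mdim M. transition_deriv x y p (frame M i) \<bullet> frame M (\<pi> i)))"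

definition paracompact_space :: "'m::topological_space itself \<Rightarrow> bool" where
  "paracompact_space _ \<longleftrightarrow>
     (\<forall>\<U>::'m set set. (\<forall>U\<in>\<U>. open U) \<and> \<Union>\<U> = UNIV \<longrightarrow>
        (\<exists>\<V>. (\<forall>V\<in>\<V>. open V \<and> (\<exists>U\<in>\<U>. V \<subseteq> U)) \<and> \<Union>\<V> = UNIV \<and>
             locally_finite_in euclidean \<V>))"

definition oriented_manifold :: "('m::t2_space, 'a::real_inner) mfd \<Rightarrow> bool" where
  "oriented_manifold M \<longleftrightarrow>
     paracompact_space TYPE('m) \<and>
     (\<forall>i<mdim M. \<forall>j<mdim M. frame M i \<bullet> frame M j = (if i = j then 1 else 0)) \<and>
     (\<forall>v. v = (\<Sum>i<mdim M. (v \<bullet> frame M i) *\<^sub>R frame M i)) \<and>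
     (\<Union>x\<in>atlas M. fst x) = UNIV \<and>
     (\<forall>x\<in>atlas M. open (fst x) \<and> open (snd x ` fst x) \<and>
        homeomorphism (fst x) (snd x ` fst x) (snd x) (chart_inv x)) \<and>
     (\<forall>x\<in>atlas M. \<forall>y\<in>atlas M.
        smooth_on (snd x ` (fst x \<inter> fst y)) (\<lambda>z. snd y (chart_inv x z))) \<and>
     (\<forall>x\<in>atlas M. continuous_on (fst x) (orient M x) \<and> (\<forall>p\<in>fst x. orient M x p \<in> {1, -1})) \<and>
     (\<forall>x\<in>atlas M. \<forall>y\<in>atlas M. \<forall>p\<in>fst x \<inter> fst y.
        orient M y p = sgn (jacobian_det M x y p) * orient M x p)"

definition smooth_curves_mfd :: "('m::t2_space, 'a::real_inner) mfd \<Rightarrow> (real \<Rightarrow> 'm) set" where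
  "smooth_curves_mfd M =
     {c. continuous_on UNIV c \<and> (\<forall>x\<in>atlas M. smooth_on {t. c t \<in> fst x} (\<lambda>t. snd x (c t)))}"

definition smooth_functions :: "('m::t2_space, 'a::real_inner) mfd \<Rightarrow> ('m \<Rightarrow> real) set" where
  "smooth_functions M = {f. \<forall>x\<in>atlas M. smooth_on (snd x ` fst x) (\<lambda>z. f (chart_inv x z))}"


section \<open>Tangent vectors and tensors\<close>

text \<open>A tangent vector at \<open>p\<close> is the family of its coordinate vectors with respect to all charts at
  \<open>p\<close>, related by the derivatives of the transition maps. Linear and multilinear functions on
  subspaces are extended by \<open>0\<close>, so that equality of functions is equality on the subspaces.\<close>

type_synonym ('m, 'a) tvec = "('m, 'a) chart \<Rightarrow> 'a"
type_synonym ('m, 'a) covec = "('m, 'a) tvec \<Rightarrow> real"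
type_synonym ('m, 'a) tensor = "('m, 'a) covec list \<Rightarrow> ('m, 'a) tvec list \<Rightarrow> real"

definition charts_at :: "('m, 'a) mfd \<Rightarrow> 'm \<Rightarrow> ('m, 'a) chart set" where
  "charts_at M p = {x\<in>atlas M. p \<in> fst x}"

definition tangent_space :: "('m, 'a::real_inner) mfd \<Rightarrow> 'm \<Rightarrow> ('m, 'a) tvec set" where
  "tangent_space M p =
     {\<xi>. (\<forall>x. x \<notin> charts_at M p \<longrightarrow> \<xi> x = 0) \<and>
         (\<forall>x\<in>charts_at M p. \<forall>y\<in>charts_at M p. \<xi> y = transition_deriv x y p (\<xi> x))}"

definition linear_maps ::
  "('m, 'a::real_inner) mfd \<Rightarrow> 'm \<Rightarrow> 'm \<Rightarrow> (('m, 'a) tvec \<Rightarrow> ('m, 'a) tvec) set" where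
  "linear_maps M p q =
     {L. linear_on_subspace (tangent_space M p) L \<and> L ` tangent_space M p \<subseteq> tangent_space M q \<and>
         (\<forall>\<xi>. \<xi> \<notin> tangent_space M p \<longrightarrow> L \<xi> = 0)}"

definition cotangent_space :: "('m, 'a::real_inner) mfd \<Rightarrow> 'm \<Rightarrow> ('m, 'a) covec set" where
  "cotangent_space M p =
     {\<alpha>. linear_on_subspace (tangent_space M p) \<alpha> \<and> (\<forall>\<xi>. \<xi> \<notin> tangent_space M p \<longrightarrow> \<alpha> \<xi> = 0)}"

definition tensor_args ::
  "('m, 'a::real_inner) mfd \<Rightarrow> nat \<Rightarrow> nat \<Rightarrow> 'm \<Rightarrow> ('m, 'a) covec list \<Rightarrow> ('m, 'a) tvec list \<Rightarrow> bool" where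
  "tensor_args M r s p \<alpha>s \<xi>s \<longleftrightarrow>
     length \<alpha>s = r \<and> length \<xi>s = s \<and> set \<alpha>s \<subseteq> cotangent_space M p \<and> set \<xi>s \<subseteq> tangent_space M p"

text \<open>\<open>(T\<^sup>r\<^sub>s)\<^sub>pM\<close> as the space of multilinear forms in \<open>r\<close> covectors and \<open>s\<close> vectors.\<close>

definition tensor_space :: "('m, 'a::real_inner) mfd \<Rightarrow> nat \<Rightarrow> nat \<Rightarrow> 'm \<Rightarrow> ('m, 'a) tensor set" where
  "tensor_space M r s p =
     {\<tau>. (\<forall>\<alpha>s \<xi>s. \<not> tensor_args M r s p \<alpha>s \<xi>s \<longrightarrow> \<tau> \<alpha>s \<xi>s = 0) \<and>
         (\<forall>\<alpha>s \<xi>s. tensor_args M r s p \<alpha>s \<xi>s \<longrightarrow>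
            (\<forall>i<r. linear_on_subspace (cotangent_space M p) (\<lambda>\<alpha>. \<tau> (\<alpha>s[i := \<alpha>]) \<xi>s)) \<and>
            (\<forall>j<s. linear_on_subspace (tangent_space M p) (\<lambda>\<xi>. \<tau> \<alpha>s (\<xi>s[j := \<xi>]))))}"

text \<open>The coordinate vectors \<open>\<partial>\<^sub>i\<close> and covectors \<open>dx\<^sup>i\<close> at \<open>p\<close> of a chart \<open>x\<close> at \<open>p\<close>.\<close>

definition coord_vec :: "('m, 'a::real_inner) mfd \<Rightarrow> ('m, 'a) chart \<Rightarrow> 'm \<Rightarrow> nat \<Rightarrow> ('m, 'a) tvec" where
  "coord_vec M x p i = (\<lambda>y. if y \<in> charts_at M p then transition_deriv x y p (frame M i) else 0)"

definition coord_covec :: "('m, 'a::real_inner) mfd \<Rightarrow> ('m, 'a) chart \<Rightarrow> 'm \<Rightarrow> nat \<Rightarrow> ('m, 'a) covec" where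
  "coord_covec M x p i = (\<lambda>\<xi>. if \<xi> \<in> tangent_space M p then \<xi> x \<bullet> frame M i else 0)"

definition multi_indices :: "('m, 'a) mfd \<Rightarrow> nat \<Rightarrow> nat list set" where
  "multi_indices M k = {I. length I = k \<and> set I \<subseteq> {..<mdim M}}"

definition tensor_component ::
  "('m, 'a::real_inner) mfd \<Rightarrow> ('m, 'a) chart \<Rightarrow> nat list \<Rightarrow> nat list \<Rightarrow> 'm \<Rightarrow> ('m, 'a) tensor \<Rightarrow> real" where
  "tensor_component M x I J p \<tau> = \<tau> (map (coord_covec M x p) I) (map (coord_vec M x p) J)"

text \<open>The pairing \<open>\<tau> \<cdot> t\<close> of \<open>\<tau> \<in> (T\<^sup>r\<^sub>s)\<^sub>pM\<close> and \<open>t \<in> (T\<^sup>s\<^sub>r)\<^sub>pM\<close>: full contraction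
  \<open>\<tau>\<^sup>I\<^sub>J t\<^sup>J\<^sub>I\<close>, in any chart at \<open>p\<close>.\<close>

definition contraction ::
  "('m, 'a::real_inner) mfd \<Rightarrow> nat \<Rightarrow> nat \<Rightarrow> 'm \<Rightarrow> ('m, 'a) tensor \<Rightarrow> ('m, 'a) tensor \<Rightarrow> real" where
  "contraction M r s p \<tau> t =
     (let x = (SOME x. x \<in> charts_at M p) in
      \<Sum>I\<in>multi_indices M r. \<Sum>J\<in>multi_indices M s.
        tensor_component M x I J p \<tau> * tensor_component M x J I p t)"


section \<open>Vector bundles and their section spaces\<close>

text \<open>A vector bundle over \<open>'b\<close> is given by its fibres and its vector bundle charts. A bundle chart
  is listed by its single coordinate functions: \<open>(W, \<psi>, \<kappa>)\<close> consists of a chart \<open>(W, \<psi>)\<close> of the base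
  and a coordinate \<open>\<kappa> p\<close> of the fibre over \<open>p \<in> W\<close>.\<close>

record ('b, 'c, 'f) vbundle =
  fibre :: "'b \<Rightarrow> 'f set"
  bcoords :: "('b set \<times> ('b \<Rightarrow> 'c) \<times> ('b \<Rightarrow> 'f \<Rightarrow> real)) set"

definition local_rep :: "'b set \<times> ('b \<Rightarrow> 'c) \<times> ('b \<Rightarrow> 'f \<Rightarrow> real) \<Rightarrow> ('b \<Rightarrow> 'f) \<Rightarrow> 'c \<Rightarrow> real" where
  "local_rep = (\<lambda>(W, \<psi>, \<kappa>) \<sigma> z. \<kappa> (inv_into W \<psi> z) (\<sigma> (inv_into W \<psi> z)))"

definition smooth_sections :: "('b, 'c::real_normed_vector, 'f) vbundle \<Rightarrow> ('b \<Rightarrow> 'f) set" where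
  "smooth_sections E =
     {\<sigma>. (\<forall>p. \<sigma> p \<in> fibre E p) \<and>
         (\<forall>(W, \<psi>, \<kappa>)\<in>bcoords E. smooth_on (\<psi> ` W) (local_rep (W, \<psi>, \<kappa>) \<sigma>))}"

definition sections_in ::
  "('b, 'c::real_normed_vector, 'f::zero) vbundle \<Rightarrow> 'b set \<Rightarrow> ('b \<Rightarrow> 'f) set" where
  "sections_in E K = {\<sigma>\<in>smooth_sections E. {p. \<sigma> p \<noteq> 0} \<subseteq> K}"

definition compact_sections ::
  "('b::topological_space, 'c::real_normed_vector, 'f::zero) vbundle \<Rightarrow> ('b \<Rightarrow> 'f) set" where
  "compact_sections E = {\<sigma>\<in>smooth_sections E. compact (closure {p. \<sigma> p \<noteq> 0})}"

definition F_seminorms ::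
  "('b::topological_space, 'c::real_normed_vector, 'f) vbundle \<Rightarrow> (('b \<Rightarrow> 'f) \<Rightarrow> real) set" where
  "F_seminorms E =
     {\<lambda>\<sigma>. SUP p\<in>L. \<bar>iter_deriv ds (local_rep (W, \<psi>, \<kappa>) \<sigma>) (\<psi> p)\<bar> | W \<psi> \<kappa> L ds.
        (W, \<psi>, \<kappa>) \<in> bcoords E \<and> compact L \<and> L \<noteq> {} \<and> L \<subseteq> W}"

definition F_topology ::
  "('b::topological_space, 'c::real_normed_vector, 'f::real_vector) vbundle \<Rightarrow> ('b \<Rightarrow> 'f) topology" where
  "F_topology E = lc_topology (smooth_sections E) (F_seminorms E)"

text \<open>The locally convex inductive limit of the spaces of sections supported in compact sets \<open>K\<close>,
  i.e. the finest locally convex topology for which all inclusions are continuous; it is generated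
  by all seminorms with continuous restrictions.\<close>

definition LF_seminorms ::
  "('b::topological_space, 'c::real_normed_vector, 'f::real_vector) vbundle \<Rightarrow> (('b \<Rightarrow> 'f) \<Rightarrow> real) set" where
  "LF_seminorms E =
     {\<rho>. seminorm_on (compact_sections E) \<rho> \<and>
         (\<forall>K. compact K \<longrightarrow>
            continuous_map (subtopology (F_topology E) (sections_in E K)) euclideanreal \<rho>)}"

definition LF_topology ::
  "('b::topological_space, 'c::real_normed_vector, 'f::real_vector) vbundle \<Rightarrow> ('b \<Rightarrow> 'f) topology" where
  "LF_topology E = lc_topology (compact_sections E) (LF_seminorms E)"

definition LF_dual ::
  "('b::topological_space, 'c::real_normed_vector, 'f::real_vector) vbundle \<Rightarrow> (('b \<Rightarrow> 'f) \<Rightarrow> real) set" where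
  "LF_dual E =
     {v. linear_on_subspace (compact_sections E) v \<and> continuous_map (LF_topology E) euclideanreal v}"


section \<open>The bundles involved\<close>

definition tensor_bcoords ::
  "('m, 'a::real_inner) mfd \<Rightarrow> nat \<Rightarrow> nat \<Rightarrow>
     ('m set \<times> ('m \<Rightarrow> 'a) \<times> ('m \<Rightarrow> ('m, 'a) tensor \<Rightarrow> real)) set" where
  "tensor_bcoords M r s =
     {(fst x, snd x, tensor_component M x I J) | x I J.
        x \<in> atlas M \<and> I \<in> multi_indices M r \<and> J \<in> multi_indices M s}"

definition tensor_bundle ::
  "('m, 'a::real_inner) mfd \<Rightarrow> nat \<Rightarrow> nat \<Rightarrow> ('m, 'a, ('m, 'a) tensor) vbundle" where
  "tensor_bundle M r s = \<lparr>fibre = tensor_space M r s, bcoords = tensor_bcoords M r s\<rparr>"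

text \<open>Alternating in the vector arguments from the position \<open>k\<close> on.\<close>

definition alternating_from :: "nat \<Rightarrow> ('m, 'a) tensor \<Rightarrow> bool" where
  "alternating_from k \<tau> \<longleftrightarrow>
     (\<forall>\<alpha>s \<xi>s i j. k \<le> i \<and> i < j \<and> j < length \<xi>s \<and> \<xi>s ! i = \<xi>s ! j \<longrightarrow> \<tau> \<alpha>s \<xi>s = 0)"

text \<open>\<open>\<Lambda>\<^sup>nT\<^sup>*M\<close>\<close>

definition form_bundle :: "('m, 'a::real_inner) mfd \<Rightarrow> ('m, 'a, ('m, 'a) tensor) vbundle" where
  "form_bundle M =
     \<lparr>fibre = (\<lambda>p. {\<tau>\<in>tensor_space M 0 (mdim M) p. alternating_from 0 \<tau>}),
      bcoords = tensor_bcoords M 0 (mdim M)\<rparr>"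

text \<open>\<open>T\<^sup>s\<^sub>rM \<otimes> \<Lambda>\<^sup>nT\<^sup>*M\<close>: the last \<open>n\<close> vector arguments belong to the second factor. Its compactly
  supported sections are identified with the tensor product over \<open>C\<^sup>\<infinity>(M)\<close> of the module of tensor
  fields and the module of compactly supported \<open>n\<close>-forms; \<open>tensor_form\<close> is the tensor product
  of two elements.\<close>

definition tensor_form_bundle ::
  "('m, 'a::real_inner) mfd \<Rightarrow> nat \<Rightarrow> nat \<Rightarrow> ('m, 'a, ('m, 'a) tensor) vbundle" where
  "tensor_form_bundle M s r =
     \<lparr>fibre = (\<lambda>p. {\<tau>\<in>tensor_space M s (r + mdim M) p. alternating_from r \<tau>}),
      bcoords = tensor_bcoords M s (r + mdim M)\<rparr>"

definition tensor_form :: "nat \<Rightarrow> ('m, 'a) tensor \<Rightarrow> ('m, 'a) tensor \<Rightarrow> ('m, 'a) tensor" where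
  "tensor_form r t \<eta> = (\<lambda>\<alpha>s \<xi>s. t \<alpha>s (take r \<xi>s) * \<eta> [] (drop r \<xi>s))"

text \<open>\<open>TO(M,M)\<close>, with fibre \<open>L(T\<^sub>pM, T\<^sub>qM)\<close> over \<open>(p,q)\<close>\<close>

definition TO_bundle ::
  "('m, 'a::real_inner) mfd \<Rightarrow> ('m \<times> 'm, 'a \<times> 'a, ('m, 'a) tvec \<Rightarrow> ('m, 'a) tvec) vbundle" where
  "TO_bundle M =
     \<lparr>fibre = (\<lambda>(p, q). linear_maps M p q),
      bcoords =
        {(fst x \<times> fst y, map_prod (snd x) (snd y),
          \<lambda>(p, q) L. coord_covec M y q i (L (coord_vec M x p j))) | x y i j.
           x \<in> atlas M \<and> y \<in> atlas M \<and> i < mdim M \<and> j < mdim M}\<rparr>"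


section \<open>Integration of compactly supported n-forms\<close>

text \<open>Lebesgue integration on the model space goes through the coordinates with respect to \<open>frame\<close>;
  the integral over the manifold is computed with smooth cut-off functions \<open>\<theta> k\<close> supported
  in chart domains whose sum is \<open>1\<close> where the form does not vanish.\<close>

definition chart_integral ::
  "('m::t2_space, 'a::real_inner) mfd \<Rightarrow> ('m, 'a) chart \<Rightarrow> ('m \<Rightarrow> ('m, 'a) tensor) \<Rightarrow> real" where
  "chart_integral M x \<eta> =
     (LINT y | Pi\<^sub>M {..<mdim M} (\<lambda>_. lborel).
        (let z = (\<Sum>i<mdim M. y i *\<^sub>R frame M i); p = chart_inv x z in
         if z \<in> snd x ` fst x
         then orient M x p * tensor_component M x [] [0..<mdim M] p (\<eta> p) else 0))"

definition form_integral ::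
  "('m::t2_space, 'a::real_inner) mfd \<Rightarrow> ('m \<Rightarrow> ('m, 'a) tensor) \<Rightarrow> real" where
  "form_integral M \<omega> =
     (THE I. \<exists>(N::nat) x \<theta>.
        (\<forall>k<N. x k \<in> atlas M \<and> \<theta> k \<in> smooth_functions M \<and>
           compact (closure {p. \<theta> k p \<noteq> 0}) \<and> closure {p. \<theta> k p \<noteq> 0} \<subseteq> fst (x k)) \<and>
        (\<forall>p. \<omega> p \<noteq> 0 \<longrightarrow> (\<Sum>k<N. \<theta> k p) = 1) \<and>
        I = (\<Sum>k<N. chart_integral M (x k) (\<lambda>p. \<theta> k p *\<^sub>R \<omega> p)))"


section \<open>The basic space and the embedding of distributions\<close>

definition A0_hat :: "('m::t2_space, 'a::real_inner) mfd \<Rightarrow> ('m \<Rightarrow> ('m, 'a) tensor) set" where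
  "A0_hat M = {\<omega>\<in>compact_sections (form_bundle M). form_integral M \<omega> = 1}"

definition B_hat ::
  "('m::t2_space, 'a::real_inner) mfd \<Rightarrow> ('m \<times> 'm \<Rightarrow> ('m, 'a) tvec \<Rightarrow> ('m, 'a) tvec) set" where
  "B_hat M = compact_sections (TO_bundle M)"

definition tensor_distributions ::
  "('m::t2_space, 'a::real_inner) mfd \<Rightarrow> nat \<Rightarrow> nat \<Rightarrow> (('m \<Rightarrow> ('m, 'a) tensor) \<Rightarrow> real) set" where
  "tensor_distributions M r s = LF_dual (tensor_form_bundle M s r)"

type_synonym ('m, 'a) basic_arg =
  "('m \<Rightarrow> ('m, 'a) tensor) \<times> 'm \<times> ('m \<times> 'm \<Rightarrow> ('m, 'a) tvec \<Rightarrow> ('m, 'a) tvec)"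

text \<open>\<open>A0_hat\<close> is a closed affine hyperplane; its smooth curves are those of the surrounding
  space with values in it.\<close>

definition basic_arg_curves ::
  "('m::t2_space, 'a::real_inner) mfd \<Rightarrow> (real \<Rightarrow> ('m, 'a) basic_arg) set" where
  "basic_arg_curves M =
     prod_curves {c\<in>smooth_curves_lc (LF_topology (form_bundle M)). range c \<subseteq> A0_hat M}
       (prod_curves (smooth_curves_mfd M) (smooth_curves_lc (LF_topology (TO_bundle M))))"

text \<open>Smooth curves in the total space of \<open>T\<^sup>r\<^sub>sM\<close>, whose elements are pairs of a point and an
  element of the fibre over it\<close>

definition tensor_curves ::
  "('m::t2_space, 'a::real_inner) mfd \<Rightarrow> nat \<Rightarrow> nat \<Rightarrow> (real \<Rightarrow> 'm \<times> ('m, 'a) tensor) set" where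
  "tensor_curves M r s =
     {c. (\<lambda>t. fst (c t)) \<in> smooth_curves_mfd M \<and>
         (\<forall>t. snd (c t) \<in> tensor_space M r s (fst (c t))) \<and>
         (\<forall>(W, \<psi>, \<kappa>)\<in>bcoords (tensor_bundle M r s).
            smooth_on {t. fst (c t) \<in> W} (\<lambda>t. \<kappa> (fst (c t)) (snd (c t))))}"

definition basic_space ::
  "('m::t2_space, 'a::real_inner) mfd \<Rightarrow> nat \<Rightarrow> nat \<Rightarrow> (('m, 'a) basic_arg \<Rightarrow> 'm \<times> ('m, 'a) tensor) set" where
  "basic_space M r s =
     {u. convenient_smooth (basic_arg_curves M) (tensor_curves M r s) u \<and>
         (\<forall>\<omega>\<in>A0_hat M. \<forall>p. \<forall>A\<in>B_hat M. u (\<omega>, p, A) \<in> {p} \<times> tensor_space M r s p)}"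

text \<open>\<open>A\<^sup>s\<^sub>r(p,q)\<close>. In terms of multilinear forms, the linear map given on elementary tensors by
  \<open>w\<^sub>1 \<otimes> \<dots> \<otimes> \<beta>\<^sup>r \<mapsto> A(p,q)w\<^sub>1 \<otimes> \<dots> \<otimes> A(q,p)\<^sup>a\<^sup>d\<beta>\<^sup>r\<close> is precomposition of the arguments with
  \<open>A(p,q)\<^sup>a\<^sup>d\<close> and \<open>A(q,p)\<close>; see \<open>transport_elementary\<close> and \<open>transport_linear\<close> below.\<close>

definition transport ::
  "('m, 'a::real_inner) mfd \<Rightarrow> nat \<Rightarrow> nat \<Rightarrow> ('m \<times> 'm \<Rightarrow> ('m, 'a) tvec \<Rightarrow> ('m, 'a) tvec) \<Rightarrow>
     'm \<Rightarrow> 'm \<Rightarrow> ('m, 'a) tensor \<Rightarrow> ('m, 'a) tensor" where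
  "transport M s r A p q t =
     (\<lambda>\<alpha>s \<xi>s. if tensor_args M s r q \<alpha>s \<xi>s
        then t (map (\<lambda>\<alpha>. \<alpha> \<circ> A (p, q)) \<alpha>s) (map (A (q, p)) \<xi>s) else 0)"

text \<open>The right-hand side of the formula defining the embedding as a
  function of the value \<open>t\<close> at \<open>p\<close> of the tensor field\<close>

definition iota_rhs ::
  "('m::t2_space, 'a::real_inner) mfd \<Rightarrow> nat \<Rightarrow> nat \<Rightarrow> (('m \<Rightarrow> ('m, 'a) tensor) \<Rightarrow> real) \<Rightarrow>
     ('m, 'a) basic_arg \<Rightarrow> ('m, 'a) tensor \<Rightarrow> real" where
  "iota_rhs M r s v = (\<lambda>(\<omega>, p, A) t. v (\<lambda>q. tensor_form r (transport M s r A p q t) (\<omega> q)))"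

definition iota ::
  "('m::t2_space, 'a::real_inner) mfd \<Rightarrow> nat \<Rightarrow> nat \<Rightarrow> (('m \<Rightarrow> ('m, 'a) tensor) \<Rightarrow> real) \<Rightarrow>
     ('m, 'a) basic_arg \<Rightarrow> 'm \<times> ('m, 'a) tensor" where
  "iota M r s v = (\<lambda>(\<omega>, p, A). (p, THE \<tau>. \<tau> \<in> tensor_space M r s p \<and>
     (\<forall>t\<in>tensor_space M s r p. contraction M r s p \<tau> t = iota_rhs M r s v (\<omega>, p, A) t)))"


section \<open>The transport map on elementary tensors\<close>

definition elementary_tensor ::
  "('m, 'a::real_inner) mfd \<Rightarrow> 'm \<Rightarrow> ('m, 'a) tvec list \<Rightarrow> ('m, 'a) covec list \<Rightarrow> ('m, 'a) tensor" where
  "elementary_tensor M p ws \<beta>s =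
     (\<lambda>\<alpha>s \<xi>s. if tensor_args M (length ws) (length \<beta>s) p \<alpha>s \<xi>s
        then (\<Prod>i<length ws. (\<alpha>s ! i) (ws ! i)) * (\<Prod>j<length \<beta>s. (\<beta>s ! j) (\<xi>s ! j)) else 0)"

lemma adjoint_cotangent:
  assumes "L \<in> linear_maps M p q" "\<alpha> \<in> cotangent_space M q"
  shows "\<alpha> \<circ> L \<in> cotangent_space M p"
proof -
  have lin: "linear_on_subspace (tangent_space M p) L" and into: "L ` tangent_space M p \<subseteq> tangent_space M q"
    and L0: "\<And>\<xi>. \<xi> \<notin> tangent_space M p \<Longrightarrow> L \<xi> = 0"
    using assms(1) by (auto simp: linear_maps_def)
  have lin': "linear_on_subspace (tangent_space M q) \<alpha>"
    and a0: "\<And>\<xi>. \<xi> \<notin> tangent_space M q \<Longrightarrow> \<alpha> \<xi> = 0"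
    using assms(2) by (auto simp: cotangent_space_def)
  have "\<alpha> 0 = 0"
  proof (cases "0 \<in> tangent_space M q")
    case True
    then have "\<alpha> (0 *\<^sub>R 0 + 0 *\<^sub>R 0) = 0 *\<^sub>R \<alpha> 0 + 0 *\<^sub>R \<alpha> 0"
      using lin' unfolding linear_on_subspace_def by blast
    then show ?thesis by simp
  qed (rule a0)
  moreover have "linear_on_subspace (tangent_space M p) (\<alpha> \<circ> L)"
    unfolding linear_on_subspace_def
  proof (intro ballI allI)
    fix x y a b assume xy: "x \<in> tangent_space M p" "y \<in> tangent_space M p"
    have "L (a *\<^sub>R x + b *\<^sub>R y) = a *\<^sub>R L x + b *\<^sub>R L y"
      using lin xy unfolding linear_on_subspace_def by blast
    moreover have "\<alpha> (a *\<^sub>R L x + b *\<^sub>R L y) = a *\<^sub>R \<alpha> (L x) + b *\<^sub>R \<alpha> (L y)"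
      using lin' into xy unfolding linear_on_subspace_def by blast
    ultimately show "(\<alpha> \<circ> L) (a *\<^sub>R x + b *\<^sub>R y) = a *\<^sub>R (\<alpha> \<circ> L) x + b *\<^sub>R (\<alpha> \<circ> L) y"
      by (simp only: comp_apply)
  qed
  ultimately show ?thesis
    using L0 unfolding cotangent_space_def by simp
qed

lemma transport_args:
  assumes "A (p, q) \<in> linear_maps M p q" "A (q, p) \<in> linear_maps M q p"
    and "tensor_args M s r q \<alpha>s \<xi>s"
  shows "tensor_args M s r p (map (\<lambda>\<alpha>. \<alpha> \<circ> A (p, q)) \<alpha>s) (map (A (q, p)) \<xi>s)"
proof -
  have "A (q, p) ` tangent_space M q \<subseteq> tangent_space M p"
    using assms(2) by (simp add: linear_maps_def)
  then show ?thesis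
    using assms(3) adjoint_cotangent[OF assms(1)]
    unfolding tensor_args_def by (auto simp: image_subset_iff subset_iff)
qed

lemma transport_elementary:
  assumes "A (p, q) \<in> linear_maps M p q" "A (q, p) \<in> linear_maps M q p"
    and "length ws = s" "length \<beta>s = r"
  shows "transport M s r A p q (elementary_tensor M p ws \<beta>s) =
    elementary_tensor M q (map (A (p, q)) ws) (map (\<lambda>\<beta>. \<beta> \<circ> A (q, p)) \<beta>s)"
proof (intro ext)
  fix \<alpha>s \<xi>s
  show "transport M s r A p q (elementary_tensor M p ws \<beta>s) \<alpha>s \<xi>s =
    elementary_tensor M q (map (A (p, q)) ws) (map (\<lambda>\<beta>. \<beta> \<circ> A (q, p)) \<beta>s) \<alpha>s \<xi>s"
  proof (cases "tensor_args M s r q \<alpha>s \<xi>s")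
    case True
    then have "length \<alpha>s = s" "length \<xi>s = r"
      by (auto simp: tensor_args_def)
    then show ?thesis
      using True transport_args[OF assms(1,2) True] assms(3,4)
      by (simp add: transport_def elementary_tensor_def)
  qed (use assms in \<open>simp add: transport_def elementary_tensor_def\<close>)
qed

lemma transport_linear:
  "transport M s r A p q (a *\<^sub>R t + b *\<^sub>R u) =
     a *\<^sub>R transport M s r A p q t + b *\<^sub>R transport M s r A p q u"
  by (intro ext) (simp add: transport_def scaleR_fun_def)

end

theory Submission
  imports Defs
begin

text \<open>In a chart \<open>x\<close>, a component of \<open>iota\<close> along smooth curves \<open>\<omega>\<close>, \<open>p\<close>, \<open>A\<close> is \<open>v (\<Phi> t)\<close>, where \<open>\<Phi> t\<close> is the section
  \<open>q \<mapsto> (A\<^sup>s\<^sub>r(p, q) e) \<otimes> \<omega>(q)\<close> for a tensor \<open>e\<close> with constant components in \<open>x\<close>. By the exponential law, a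
  smooth curve of sections is the same as a locally compactly supported family which is jointly smooth in
  the parameter and the base point. In charts the components of \<open>\<Phi>\<close> are polynomials in those of \<open>A\<close> and
  \<open>\<omega>\<close>, into which \<open>p\<close> is substituted, so \<open>\<Phi>\<close> is such a family. Its difference quotients then converge in the
  (LF)-topology to a family of the same kind; as \<open>v\<close> is linear and continuous, \<open>v \<circ> \<Phi>\<close> can be differentiated
  any number of times.\<close>


section \<open>Calculus of smooth functions\<close>

text \<open>A smooth curve of sections is given only through convergence of difference quotients for
  the continuous seminorms of an (LF)-space, so suitable seminorms have to be built. Suprema of base
  derivatives over small compact sets yield joint smoothness. Weighted point evaluations yield a
  common compact support over compact parameter intervals; they are continuous because the
  evaluation points are spread over a locally finite cover, which paracompactness provides. The
  support of the section paired with \<open>v\<close> is controlled through its factor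
  \<open>\<omega>\<close>, and joint smoothness of \<open>A\<close> in both base points allows the
  moving point \<open>p\<close> to be substituted into either of them. In the converse direction
  (F)-convergence implies (LF)-convergence once all difference quotients are supported in one
  compact set. Smoothness is always shown by exhibiting a class of functions stable under
  differentiation, which avoids formulas for higher derivatives. The definite description in
  \<open>iota\<close> is made explicit by testing against elementary tensors.\<close>

lemma has_derivative_frechet:
  "f differentiable (at z) \<Longrightarrow> (f has_derivative (\<lambda>d. frechet_derivative f (at z) d)) (at z)"
  using frechet_derivative_works by auto

lemma frechet_derivative_eqI:
  "(f has_derivative f') (at z) \<Longrightarrow> frechet_derivative f (at z) d = f' d"
  using frechet_derivative_at by metis

lemma iter_deriv_append: "iter_deriv (ds @ es) f = iter_deriv es (iter_deriv ds f)"
  by (induction ds arbitrary: f) auto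

text \<open>\<open>frechet_derivative\<close> is a choice among the possible derivatives. Functions
  that agree near a point have the same derivatives there, hence the same choice, even where no
  derivative exists.\<close>

lemma frechet_derivative_cong_open:
  assumes "open S" "\<And>z. z \<in> S \<Longrightarrow> f z = g z" "z \<in> S"
  shows "frechet_derivative f (at z) = frechet_derivative g (at z)"
proof -
  have "(f has_derivative D) (at z) \<longleftrightarrow> (g has_derivative D) (at z)" for D
    using has_derivative_transform_within_open[OF _ assms(1,3), of f D UNIV g]
      has_derivative_transform_within_open[OF _ assms(1,3), of g D UNIV f] assms(2) by auto
  then show ?thesis by (simp add: frechet_derivative_def)
qed

lemma iter_deriv_cong:
  assumes "open S" "\<And>z. z \<in> S \<Longrightarrow> f z = g z" "z \<in> S"
  shows "iter_deriv ds f z = iter_deriv ds g z"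
  using assms(2,3)
proof (induction ds arbitrary: f g z)
  case (Cons d ds)
  show ?case
    unfolding iter_deriv.simps
    by (rule Cons.IH[OF _ Cons.prems(2)])
      (use frechet_derivative_cong_open[OF assms(1) Cons.prems(1)] in auto)
qed auto

lemma differentiable_cong_open:
  assumes "open S" "\<And>z. z \<in> S \<Longrightarrow> f z = g z" "z \<in> S" "f differentiable (at z)"
  shows "g differentiable (at z)"
  using assms has_derivative_transform_within_open[OF _ assms(1,3), of f _ UNIV g]
  unfolding differentiable_def by metis

lemma smooth_on_cong:
  assumes "open S" "\<And>z. z \<in> S \<Longrightarrow> f z = g z" "smooth_on S f"
  shows "smooth_on S g"
  unfolding smooth_on_def
proof (intro allI ballI)
  fix ds z assume z: "z \<in> S"
  show "iter_deriv ds g differentiable at z"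
    by (rule differentiable_cong_open[OF assms(1) _ z, of "iter_deriv ds f"])
      (use assms z iter_deriv_cong[OF assms(1,2)] in \<open>auto simp: smooth_on_def\<close>)
qed

lemma smooth_on_subset: "smooth_on T f \<Longrightarrow> S \<subseteq> T \<Longrightarrow> smooth_on S f"
  unfolding smooth_on_def by blast

lemma smooth_on_differentiable: "smooth_on S f \<Longrightarrow> z \<in> S \<Longrightarrow> f differentiable (at z)"
  unfolding smooth_on_def by (metis iter_deriv.simps(1))

lemma smooth_on_has_derivative:
  "smooth_on S f \<Longrightarrow> z \<in> S \<Longrightarrow> (f has_derivative (\<lambda>d. frechet_derivative f (at z) d)) (at z)"
  by (simp add: smooth_on_differentiable has_derivative_frechet)

lemma smooth_on_iter_deriv: "smooth_on S f \<Longrightarrow> smooth_on S (iter_deriv ds f)"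
  unfolding smooth_on_def by (metis iter_deriv_append)

lemma smooth_on_dir: "smooth_on S f \<Longrightarrow> smooth_on S (\<lambda>z. frechet_derivative f (at z) d)"
  using smooth_on_iter_deriv[of S f "[d]"] by simp

lemma smooth_on_continuous: "smooth_on S f \<Longrightarrow> continuous_on S f"
  by (meson continuous_at_imp_continuous_on differentiable_imp_continuous_within smooth_on_differentiable)

text \<open>A class of functions closed under directional derivatives contains only smooth
  functions. Product and chain rule leave the shape of the function they are applied to; with this
  rule it is enough to choose \<open>P\<close> large enough to contain all shapes that
  occur.\<close>

lemma smooth_on_coinduct:
  assumes S: "open S" and f: "P f"
    and step: "\<And>g. P g \<Longrightarrow> \<exists>g'. (\<forall>z\<in>S. (g has_derivative (\<lambda>d. g' d z)) (at z)) \<and> (\<forall>d. P (g' d))"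
  shows "smooth_on S f"
proof -
  \<comment> \<open>The function \<open>h\<close> agrees with a member \<open>g\<close> of the class
    on \<open>S\<close> only, because the derivative computed by \<open>frechet_derivative\<close>
    is known to be \<open>g' d\<close> only there.\<close>
  have "iter_deriv ds h differentiable (at z)" if "P g" "\<And>w. w \<in> S \<Longrightarrow> h w = g w" "z \<in> S" for ds g h z
    using that
  proof (induction ds arbitrary: g h)
    case Nil
    obtain g' where "\<forall>z\<in>S. (g has_derivative (\<lambda>d. g' d z)) (at z)"
      using step[OF Nil(1)] by blast
    then have "g differentiable (at z)" using Nil(3) unfolding differentiable_def by blast
    then show ?case
      using differentiable_cong_open[OF S _ Nil(3), of g h] Nil(2) by simp
  next
    case (Cons d ds)
    obtain g' where g': "\<forall>z\<in>S. (g has_derivative (\<lambda>d. g' d z)) (at z)" "\<forall>d. P (g' d)"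
      using step[OF Cons.prems(1)] by blast
    have "frechet_derivative h (at w) d = g' d w" if "w \<in> S" for w
      using frechet_derivative_cong_open[OF S Cons.prems(2) that] frechet_derivative_eqI[of g "\<lambda>d. g' d w" w d]
        g'(1) that by simp
    then show ?case
      using Cons.IH[of "g' d"] g'(2) Cons.prems(3) by simp
  qed
  then show ?thesis using f unfolding smooth_on_def by blast
qed

section \<open>Closure properties of the smooth functions\<close>

lemma smooth_on_const: "open S \<Longrightarrow> smooth_on S (\<lambda>z. c)"
proof (rule smooth_on_coinduct[where P="\<lambda>g. \<exists>c. g = (\<lambda>z. c)"])
  fix g :: "'a \<Rightarrow> 'b" assume "\<exists>c. g = (\<lambda>z. c)"
  then show "\<exists>g'. (\<forall>z\<in>S. (g has_derivative (\<lambda>d. g' d z)) (at z)) \<and> (\<forall>d. \<exists>c. g' d = (\<lambda>z. c))"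
    by (elim exE, intro exI[of _ "\<lambda>d z. 0"] conjI ballI allI) (simp, blast)
qed auto

lemma smooth_on_linear: assumes "open S" "bounded_linear f" shows "smooth_on S f"
\<comment> \<open>The class has to contain the constants, which are the derivatives of linear maps;
  hence affine maps.\<close>
proof (rule smooth_on_coinduct[where P="\<lambda>g. \<exists>f c. bounded_linear f \<and> g = (\<lambda>z. f z + c)"])
  fix g :: "'a \<Rightarrow> 'b" assume "\<exists>f c. bounded_linear f \<and> g = (\<lambda>z. f z + c)"
  then obtain f c where f: "bounded_linear f" "g = (\<lambda>z. f z + c)" by blast
  have "\<exists>h c. bounded_linear h \<and> (\<lambda>z::'a. f d) = (\<lambda>z. h z + c)" for d
    by (rule exI[of _ "\<lambda>z. 0"], rule exI[of _ "f d"]) auto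
  then show "\<exists>g'. (\<forall>z\<in>S. (g has_derivative (\<lambda>d. g' d z)) (at z)) \<and>
      (\<forall>d. \<exists>f c. bounded_linear f \<and> g' d = (\<lambda>z. f z + c))"
    using f by (intro exI[of _ "\<lambda>d z. f d"])
      (auto intro!: derivative_eq_intros bounded_linear_imp_has_derivative)
qed (use assms in \<open>simp, intro exI[of _ f] exI[of _ 0], simp\<close>)

lemma smooth_on_add:
  assumes S: "open S" and "smooth_on S f" "smooth_on S g"
  shows "smooth_on S (\<lambda>z. f z + g z)"
proof (rule smooth_on_coinduct[OF S, where P="\<lambda>h. \<exists>f g. smooth_on S f \<and> smooth_on S g \<and> h = (\<lambda>z. f z + g z)"])
  fix h :: "'a \<Rightarrow> 'b" assume "\<exists>f g. smooth_on S f \<and> smooth_on S g \<and> h = (\<lambda>z. f z + g z)"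
  then obtain f g where h: "smooth_on S f" "smooth_on S g" "h = (\<lambda>z. f z + g z)" by blast
  then show "\<exists>g'. (\<forall>z\<in>S. (h has_derivative (\<lambda>d. g' d z)) (at z)) \<and>
      (\<forall>d. \<exists>f g. smooth_on S f \<and> smooth_on S g \<and> g' d = (\<lambda>z. f z + g z))"
    by (intro exI[of _ "\<lambda>d z. frechet_derivative f (at z) d + frechet_derivative g (at z) d"])
      (auto intro!: has_derivative_add smooth_on_has_derivative smooth_on_dir)
qed (rule exI[of _ f], rule exI[of _ g], use assms in simp)

lemma smooth_on_linear_comp:
  assumes S: "open S" and L: "bounded_linear L" and "smooth_on S f"
  shows "smooth_on S (\<lambda>z. L (f z))"
proof (rule smooth_on_coinduct[OF S, where P="\<lambda>h. \<exists>f. smooth_on S f \<and> h = (\<lambda>z. L (f z))"])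
  fix h assume "\<exists>f. smooth_on S f \<and> h = (\<lambda>z. L (f z))"
  then obtain f where h: "smooth_on S f" "h = (\<lambda>z. L (f z))" by blast
  then show "\<exists>g'. (\<forall>z\<in>S. (h has_derivative (\<lambda>d. g' d z)) (at z)) \<and>
      (\<forall>d. \<exists>f. smooth_on S f \<and> g' d = (\<lambda>z. L (f z)))"
    by (intro exI[of _ "\<lambda>d z. L (frechet_derivative f (at z) d)"])
      (auto intro!: smooth_on_has_derivative smooth_on_dir bounded_linear.has_derivative[OF L])
qed (rule exI[of _ f], use assms in simp)

lemma smooth_on_mult:
  fixes f g :: "'a::real_normed_vector \<Rightarrow> real"
  assumes S: "open S" and "smooth_on S f" "smooth_on S g"
  shows "smooth_on S (\<lambda>z. f z * g z)"
proof -
  \<comment> \<open>Finite sums of products: by the Leibniz rule each summand is replaced by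
    two.\<close>
  define P where "P h \<longleftrightarrow> (\<exists>F. (\<forall>(f,g)\<in>set F. smooth_on S f \<and> smooth_on S g) \<and>
      h = (\<lambda>z. sum_list (map (\<lambda>(f,g). f z * g z) F)))" for h :: "'a \<Rightarrow> real"
  show ?thesis
  proof (rule smooth_on_coinduct[OF S, where P=P])
    show "P (\<lambda>z. f z * g z)"
      unfolding P_def by (rule exI[of _ "[(f,g)]"]) (use assms in auto)
    fix h assume "P h"
    then obtain F where F: "\<forall>(f,g)\<in>set F. smooth_on S f \<and> smooth_on S g"
      and h: "h = (\<lambda>z. sum_list (map (\<lambda>(f,g). f z * g z) F))" unfolding P_def by blast
    show "\<exists>g'. (\<forall>z\<in>S. (h has_derivative (\<lambda>d. g' d z)) (at z)) \<and> (\<forall>d. P (g' d))"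
      using F unfolding h
    proof (induction F)
      case Nil
      then show ?case
        unfolding P_def by (intro exI[of _ "\<lambda>d z. 0"]) (auto intro!: exI[of _ "[]"])
    next
      case (Cons p F)
      obtain f g where p: "p = (f,g)" by (cases p)
      obtain g' where g': "\<forall>z\<in>S. ((\<lambda>z. \<Sum>(f, g)\<leftarrow>F. f z * g z) has_derivative (\<lambda>d. g' d z)) (at z)"
          "\<forall>d. P (g' d)" using Cons by auto
      let ?D = "\<lambda>f d z. frechet_derivative f (at z) d"
      show ?case
      proof (intro exI[of _ "\<lambda>d z. f z * ?D g d z + ?D f d z * g z + g' d z"] conjI ballI allI)
        fix z assume z: "z \<in> S"
        have "((\<lambda>z. f z * g z) has_derivative (\<lambda>d. f z * ?D g d z + ?D f d z * g z)) (at z)"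
          by (rule has_derivative_mult) (use Cons z p in \<open>auto intro!: smooth_on_has_derivative\<close>)
        then show "((\<lambda>z. \<Sum>(f, g)\<leftarrow>p # F. f z * g z) has_derivative
            (\<lambda>d. f z * ?D g d z + ?D f d z * g z + g' d z)) (at z)"
          using g'(1) z by (auto simp: p intro!: has_derivative_add)
      next
        fix d
        have "P (g' d)" using g'(2) by blast
        then obtain G where "\<forall>(f,g)\<in>set G. smooth_on S f \<and> smooth_on S g"
            and G: "g' d = (\<lambda>z. sum_list (map (\<lambda>(f,g). f z * g z) G))"
          unfolding P_def by blast
        then have "\<forall>(f,g)\<in>set ((f, ?D g d) # (?D f d, g) # G). smooth_on S f \<and> smooth_on S g"
          using Cons.prems by (simp add: p smooth_on_dir)
        moreover have "(\<lambda>z. f z * ?D g d z + ?D f d z * g z + g' d z) =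
            (\<lambda>z. sum_list (map (\<lambda>(f,g). f z * g z) ((f, ?D g d) # (?D f d, g) # G)))"
          by (simp add: G add.assoc)
        ultimately show "P (\<lambda>z. f z * ?D g d z + ?D f d z * g z + g' d z)"
          unfolding P_def by blast
      qed
    qed
  qed
qed

lemma smooth_on_cmult:
  fixes f :: "'a::real_normed_vector \<Rightarrow> real"
  shows "open S \<Longrightarrow> smooth_on S f \<Longrightarrow> smooth_on S (\<lambda>z. c * f z)"
  by (rule smooth_on_mult) (auto intro: smooth_on_const)

lemma smooth_on_sum:
  assumes "open S" "\<And>i. i \<in> I \<Longrightarrow> smooth_on S (f i)"
  shows "smooth_on S (\<lambda>z. \<Sum>i\<in>I. f i z)"
  using assms(2) by (induction I rule: infinite_finite_induct) (auto intro!: smooth_on_const smooth_on_add assms(1))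

lemma smooth_on_prod:
  fixes f :: "'i \<Rightarrow> 'a::real_normed_vector \<Rightarrow> real"
  assumes "open S" "\<And>i. i \<in> I \<Longrightarrow> smooth_on S (f i)"
  shows "smooth_on S (\<lambda>z. \<Prod>i\<in>I. f i z)"
  using assms(2) by (induction I rule: infinite_finite_induct) (auto intro!: smooth_on_const smooth_on_mult assms(1))

text \<open>The module over the smooth functions on \<open>S\<close> that is generated by
  \<open>F\<close>. It absorbs the coefficients that the chain rule produces.\<close>

inductive smooth_hull :: "'a::real_normed_vector set \<Rightarrow> (('a \<Rightarrow> real) \<Rightarrow> bool) \<Rightarrow> ('a \<Rightarrow> real) \<Rightarrow> bool"
  for S F where
  hull_zero: "smooth_hull S F (\<lambda>z. 0)"
| hull_add: "F f \<Longrightarrow> smooth_on S h \<Longrightarrow> smooth_hull S F g \<Longrightarrow> smooth_hull S F (\<lambda>z. h z * f z + g z)"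

lemma smooth_hull_plus: "smooth_hull S F f \<Longrightarrow> smooth_hull S F g \<Longrightarrow> smooth_hull S F (\<lambda>z. f z + g z)"
  by (induction rule: smooth_hull.induct) (auto simp: add.assoc intro: smooth_hull.intros)

lemma smooth_hull_base: "F f \<Longrightarrow> smooth_on S h \<Longrightarrow> smooth_hull S F (\<lambda>z. h z * f z)"
  using hull_add[OF _ _ hull_zero, of F f S h] by simp

lemma smooth_hull_mult:
  assumes "open S"
  shows "smooth_hull S F f \<Longrightarrow> smooth_on S h \<Longrightarrow> smooth_hull S F (\<lambda>z. h z * f z)"
proof (induction rule: smooth_hull.induct)
  case hull_zero
  then show ?case by (simp add: smooth_hull.hull_zero)
next
  case (hull_add f k g)
  have "smooth_hull S F (\<lambda>z. (h z * k z) * f z + h z * g z)"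
    using smooth_hull.hull_add[OF hull_add.hyps(1)
        smooth_on_mult[OF assms hull_add.prems hull_add.hyps(2)] hull_add.IH[OF hull_add.prems]] .
  then show ?case by (simp add: algebra_simps)
qed

lemma smooth_hull_sum_list:
  "(\<And>i. i \<in> set I \<Longrightarrow> smooth_hull S F (f i)) \<Longrightarrow> smooth_hull S F (\<lambda>z. \<Sum>i\<leftarrow>I. f i z)"
  by (induction I) (auto intro: hull_zero smooth_hull_plus)

text \<open>Coinduction up to smooth coefficients: if the derivatives of the generators lie in the
  hull, then by the Leibniz rule so do the derivatives of all its elements, and the hull is a class
  to which \<open>smooth_on_coinduct\<close> applies.\<close>

lemma smooth_on_hull_coinduct:
  assumes S: "open S" and f: "F f"
    and step: "\<And>g. F g \<Longrightarrow> \<exists>g'. (\<forall>z\<in>S. (g has_derivative (\<lambda>d. g' d z)) (at z)) \<and> (\<forall>d. smooth_hull S F (g' d))"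
  shows "smooth_on S f"
proof (rule smooth_on_coinduct[OF S, where P="smooth_hull S F"])
  show "smooth_hull S F f"
    using smooth_hull_base[of F f S "\<lambda>z. 1", OF f smooth_on_const[OF S]] by simp
  fix g assume "smooth_hull S F g"
  then show "\<exists>g'. (\<forall>z\<in>S. (g has_derivative (\<lambda>d. g' d z)) (at z)) \<and> (\<forall>d. smooth_hull S F (g' d))"
  proof (induction rule: smooth_hull.induct)
    case hull_zero
    then show ?case by (intro exI[of _ "\<lambda>d z. 0"]) (auto intro: smooth_hull.hull_zero)
  next
    case (hull_add f h g)
    obtain g' where g': "\<forall>z\<in>S. (g has_derivative (\<lambda>d. g' d z)) (at z)" "\<forall>d. smooth_hull S F (g' d)"
      using hull_add by blast
    obtain f' where f': "\<forall>z\<in>S. (f has_derivative (\<lambda>d. f' d z)) (at z)" "\<forall>d. smooth_hull S F (f' d)"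
      using step[OF hull_add(1)] by blast
    let ?D = "\<lambda>d z. frechet_derivative h (at z) d"
    show ?case
    proof (intro exI[of _ "\<lambda>d z. h z * f' d z + ?D d z * f z + g' d z"] conjI ballI allI)
      fix z assume z: "z \<in> S"
      show "((\<lambda>z. h z * f z + g z) has_derivative (\<lambda>d. h z * f' d z + ?D d z * f z + g' d z)) (at z)"
        using g'(1) f'(1) z hull_add.hyps(2)
        by (intro has_derivative_add has_derivative_mult smooth_on_has_derivative) auto
    next
      fix d
      show "smooth_hull S F (\<lambda>z. h z * f' d z + ?D d z * f z + g' d z)"
        using smooth_hull_plus[OF smooth_hull_plus[OF
            smooth_hull_mult[of S F "f' d" h, OF S f'(2)[rule_format] hull_add.hyps(2)]
            smooth_hull_base[of F f S "?D d", OF hull_add.hyps(1) smooth_on_dir[OF hull_add.hyps(2)]]]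
            g'(2)[rule_format]] .
    qed
  qed
qed

text \<open>Finite coordinate systems: the model spaces are not in the class \<open>euclidean_space\<close>.\<close>

definition coord_system :: "('b::real_normed_vector \<times> ('b \<Rightarrow> real)) list \<Rightarrow> bool" where
  "coord_system B \<longleftrightarrow> (\<forall>(b, \<phi>)\<in>set B. bounded_linear \<phi>) \<and> (\<forall>v. v = (\<Sum>(b, \<phi>)\<leftarrow>B. \<phi> v *\<^sub>R b))"

lemma coord_system_real: "coord_system [(1::real, \<lambda>x. x)]"
  by (auto simp: coord_system_def)

lemma fst_sum_list: "fst (sum_list xs) = sum_list (map fst xs)"
  by (induction xs) auto
lemma snd_sum_list: "snd (sum_list xs) = sum_list (map snd xs)"
  by (induction xs) auto

lemma coord_system_Times:
  assumes "coord_system B" "coord_system C"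
  shows "coord_system (map (\<lambda>(b, \<phi>). ((b, 0), \<lambda>v. \<phi> (fst v))) B @ map (\<lambda>(c, \<phi>). ((0, c), \<lambda>v. \<phi> (snd v))) C)"
proof -
  have zero: "(\<Sum>x\<leftarrow>B. 0) = (0::'x::monoid_add)" for B :: "'y list" by (induction B) auto
  have "v = (\<Sum>(b, \<phi>)\<leftarrow>map (\<lambda>(b, \<phi>). ((b, 0), \<lambda>v. \<phi> (fst v))) B @ map (\<lambda>(c, \<phi>). ((0, c), \<lambda>v. \<phi> (snd v))) C. \<phi> v *\<^sub>R b)" for v
    using assms unfolding coord_system_def
    by (intro prod_eqI) (simp_all add: fst_sum_list snd_sum_list comp_def case_prod_unfold zero)
  then show ?thesis
    using assms unfolding coord_system_def
    by (auto intro!: bounded_linear_compose[OF _ bounded_linear_fst] bounded_linear_compose[OF _ bounded_linear_snd])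
qed

lemma linear_sum_list: "linear f \<Longrightarrow> f (\<Sum>x\<leftarrow>xs. g x) = (\<Sum>x\<leftarrow>xs. f (g x))"
  by (induction xs) (auto simp: linear_0 linear_add)

text \<open>Here finite dimension is turned into compactness. The coordinates are bounded on a ball,
  so the ball is a closed subset of a finite sum of compact segments.\<close>

lemma compact_cball_coord:
  fixes z :: "'b::real_normed_vector"
  assumes B: "coord_system (B :: ('b \<times> ('b \<Rightarrow> real)) list)"
  shows "compact (cball z e)"
proof -
  \<comment> \<open>The induction runs through partial sums of the expansion, so \<open>C\<close> is
    any list of bounded functionals and vectors and not a full coordinate system.\<close>
  have A: "\<exists>K. compact K \<and> (\<forall>v\<in>cball z e. (\<Sum>(b, \<phi>)\<leftarrow>C. \<phi> v *\<^sub>R b) \<in> K)" if "\<forall>(b, \<phi>)\<in>set C. bounded_linear \<phi>"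
    for C :: "('b \<times> ('b \<Rightarrow> real)) list"
    using that
  proof (induction C)
    case Nil
    then show ?case by (intro exI[of _ "{0}"]) auto
  next
    case (Cons c C)
    obtain b \<phi> where c: "c = (b, \<phi>)" by (cases c)
    have bl: "bounded_linear \<phi>" using Cons c by auto
    obtain K where K: "compact K" "\<forall>v\<in>cball z e. (\<Sum>(b, \<phi>)\<leftarrow>C. \<phi> v *\<^sub>R b) \<in> K" using Cons by auto
    have "bounded (\<phi> ` cball z e)"
      by (rule bounded_linear_image[OF bounded_cball bl])
    then obtain r where r: "\<forall>v\<in>cball z e. \<bar>\<phi> v\<bar> \<le> r" unfolding bounded_iff by auto
    have "compact ((\<lambda>a. a *\<^sub>R b) ` {-r..r})"
      by (intro compact_continuous_image continuous_intros) auto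
    then have "compact {x + y |x y. x \<in> ((\<lambda>a. a *\<^sub>R b) ` {-r..r}) \<and> y \<in> K}"
      using K(1) compact_sums by blast
    then show ?case
    proof (intro exI conjI ballI)
      fix v assume v: "v \<in> cball z e"
      then have "\<phi> v \<in> {-r..r}" using r by (auto simp: abs_le_iff minus_le_iff)
      then show "(\<Sum>(b, \<phi>)\<leftarrow>c # C. \<phi> v *\<^sub>R b) \<in> {x + y |x y. x \<in> ((\<lambda>a. a *\<^sub>R b) ` {-r..r}) \<and> y \<in> K}"
        using K(2) v unfolding c list.map sum_list.Cons prod.case mem_Collect_eq by blast
    qed
  qed
  obtain K where K: "compact K" "\<forall>v\<in>cball z e. (\<Sum>(b, \<phi>)\<leftarrow>B. \<phi> v *\<^sub>R b) \<in> K"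
    using A[of B] B unfolding coord_system_def by blast
  then have "cball z e \<subseteq> K" using B unfolding coord_system_def by auto
  then have "cball z e = K \<inter> cball z e" by auto
  then show ?thesis using compact_Int_closed[OF K(1) closed_cball] by metis
qed

text \<open>By the chain rule the derivative of \<open>f\<close> after \<open>g\<close> is a
  combination of directional derivatives of \<open>f\<close> after the same \<open>g\<close>, with
  derivatives of the coordinates of \<open>g\<close> as smooth coefficients. The compositions with
  the fixed map \<open>g\<close> therefore generate a hull that is stable under
  differentiation.\<close>

lemma smooth_on_compose:
  fixes f :: "'b::real_normed_vector \<Rightarrow> real"
  assumes S: "open S" and T: "open T" and B: "coord_system B" and f: "smooth_on T f"
    and g: "\<And>z. z \<in> S \<Longrightarrow> g z \<in> T" "\<And>b \<phi>. (b, \<phi>) \<in> set B \<Longrightarrow> smooth_on S (\<lambda>z. \<phi> (g z))"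
  shows "smooth_on S (\<lambda>z. f (g z))"
proof (rule smooth_on_hull_coinduct[OF S, where F="\<lambda>h. \<exists>f. smooth_on T f \<and> h = (\<lambda>z. f (g z))"])
  fix h assume "\<exists>f::'b \<Rightarrow> real. smooth_on T f \<and> h = (\<lambda>z. f (g z))"
  then obtain f :: "'b \<Rightarrow> real" where f: "smooth_on T f" and h: "h = (\<lambda>z. f (g z))" by blast
  let ?E = "\<lambda>d z. frechet_derivative f (at z) d"
  let ?D = "\<lambda>(\<phi>::'b \<Rightarrow> real) d z. frechet_derivative (\<lambda>z. \<phi> (g z)) (at z) d"
  let ?g' = "\<lambda>d z. \<Sum>(b, \<phi>)\<leftarrow>B. ?E b (g z) * ?D \<phi> d z"
  have geq: "(\<lambda>z. \<Sum>(b, \<phi>)\<leftarrow>B. \<phi> (g z) *\<^sub>R b) = g"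
    using B unfolding coord_system_def by auto
  \<comment> \<open>Differentiability of \<open>g\<close> is assembled from its coordinates, again
    through partial sums.\<close>
  have dg: "((\<lambda>z. \<Sum>(b, \<phi>)\<leftarrow>C. \<phi> (g z) *\<^sub>R b) has_derivative
      (\<lambda>d. \<Sum>(b, \<phi>)\<leftarrow>C. ?D \<phi> d z *\<^sub>R b)) (at z)"
    if "z \<in> S" "set C \<subseteq> set B" for z C
    using that(2)
  proof (induction C)
    case (Cons c C)
    obtain b \<phi> where c: "c = (b, \<phi>)" by (cases c)
    have "((\<lambda>z. \<phi> (g z) *\<^sub>R b) has_derivative (\<lambda>d. ?D \<phi> d z *\<^sub>R b)) (at z)"
      by (intro has_derivative_scaleR_left smooth_on_has_derivative[OF g(2) that(1)]) (use Cons c in auto)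
    then show ?case
      using Cons by (auto simp: c intro!: has_derivative_add)
  qed auto
  show "\<exists>g'. (\<forall>z\<in>S. (h has_derivative (\<lambda>d. g' d z)) (at z)) \<and>
      (\<forall>d. smooth_hull S (\<lambda>h. \<exists>f. smooth_on T f \<and> h = (\<lambda>z. f (g z))) (g' d))"
  proof (intro exI[of _ ?g'] conjI ballI allI)
    fix z assume z: "z \<in> S"
    have 1: "(f has_derivative (\<lambda>d. ?E d (g z))) (at (g z))"
      using f g(1)[OF z] by (rule smooth_on_has_derivative)
    have "(h has_derivative (\<lambda>d. ?E (\<Sum>(b, \<phi>)\<leftarrow>B. ?D \<phi> d z *\<^sub>R b) (g z))) (at z)"
      unfolding h by (rule has_derivative_compose[OF dg[OF z subset_refl, unfolded geq] 1])
    moreover have "?E (\<Sum>(b, \<phi>)\<leftarrow>B. ?D \<phi> d z *\<^sub>R b) (g z) = ?g' d z" for d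
    proof -
      have "linear (\<lambda>d. ?E d (g z))" using 1 by (rule has_derivative_linear)
      from linear_sum_list[OF this, of "\<lambda>(b, \<phi>). ?D \<phi> d z *\<^sub>R b" B] linear_scale[OF this] show ?thesis
        by (simp add: case_prod_unfold mult.commute)
    qed
    ultimately show "(h has_derivative (\<lambda>d. ?g' d z)) (at z)" by simp
  next
    fix d
    show "smooth_hull S (\<lambda>h. \<exists>f. smooth_on T f \<and> h = (\<lambda>z. f (g z))) (?g' d)"
    proof (intro smooth_hull_sum_list)
      fix p assume p: "p \<in> set B"
      obtain b \<phi> where pp: "p = (b, \<phi>)" by (cases p)
      show "smooth_hull S (\<lambda>h. \<exists>f. smooth_on T f \<and> h = (\<lambda>z. f (g z)))
          (\<lambda>z. case p of (b, \<phi>) \<Rightarrow> ?E b (g z) * ?D \<phi> d z)"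
        using smooth_hull_base[where F="\<lambda>h. \<exists>f. smooth_on T f \<and> h = (\<lambda>z. f (g z))" and
            f="\<lambda>z. ?E b (g z)" and h="?D \<phi> d" and S=S]
          smooth_on_dir[OF f, of b] smooth_on_dir[OF g(2), of b \<phi> d] p pp
        by (auto simp: mult.commute)
    qed
  qed
qed (rule exI[of _ f], use f in simp)

section \<open>Symmetry of mixed derivatives, and smooth dependence on a parameter\<close>

lemma smooth_on_line_derivative:
  fixes f :: "'b::real_normed_vector \<Rightarrow> real"
  assumes f: "smooth_on S f" and p: "p + s *\<^sub>R a \<in> S"
  shows "((\<lambda>s. f (p + s *\<^sub>R a)) has_real_derivative frechet_derivative f (at (p + s *\<^sub>R a)) a) (at s)"
proof -
  have 1: "((\<lambda>s. p + s *\<^sub>R a) has_derivative (\<lambda>h. h *\<^sub>R a)) (at s)"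
    by (auto intro!: derivative_eq_intros)
  have 2: "(f has_derivative (\<lambda>d. frechet_derivative f (at (p + s *\<^sub>R a)) d)) (at (p + s *\<^sub>R a))"
    using smooth_on_has_derivative[OF f p] .
  have "linear (\<lambda>d. frechet_derivative f (at (p + s *\<^sub>R a)) d)"
    using 2 by (rule has_derivative_linear)
  then have "frechet_derivative f (at (p + s *\<^sub>R a)) (h *\<^sub>R a) = frechet_derivative f (at (p + s *\<^sub>R a)) a * h" for h
    by (simp add: linear_scale mult.commute)
  then show ?thesis
    using has_derivative_compose[OF 1 2] by (simp add: has_field_derivative_def)
qed

text \<open>Two applications of the mean value theorem, along \<open>a\<close> and then along
  \<open>b\<close>, turn the quotient into the mixed derivative at an intermediate point near
  \<open>z\<close>, and this derivative is continuous. As the quotient is symmetric in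
  \<open>a\<close> and \<open>b\<close>, uniqueness of the one-sided limit gives the symmetry of
  second derivatives.\<close>

lemma second_difference_tendsto:
  fixes f :: "'b::real_normed_vector \<Rightarrow> real"
  assumes S: "open S" and f: "smooth_on S f" and z: "z \<in> S"
  shows "((\<lambda>h. (f (z + h *\<^sub>R a + h *\<^sub>R b) - f (z + h *\<^sub>R a) - f (z + h *\<^sub>R b) + f z) / h\<^sup>2) \<longlongrightarrow>
    frechet_derivative (\<lambda>w. frechet_derivative f (at w) a) (at z) b) (at_right 0)"
proof (rule tendstoI)
  fix e :: real assume e: "0 < e"
  define fa where "fa w = frechet_derivative f (at w) a" for w
  define g where "g w = frechet_derivative fa (at w) b" for w
  have fa: "smooth_on S fa" unfolding fa_def by (rule smooth_on_dir[OF f])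
  have "smooth_on S g" unfolding g_def by (rule smooth_on_dir[OF fa])
  then have "continuous (at z) g"
    using smooth_on_differentiable[OF _ z] differentiable_imp_continuous_within by blast
  then obtain d1 where d1: "0 < d1" "\<And>w. dist w z < d1 \<Longrightarrow> dist (g w) (g z) < e"
    using e unfolding continuous_at_eps_delta by blast
  obtain d2 where d2: "0 < d2" "ball z d2 \<subseteq> S" using S z openE by blast
  \<comment> \<open>Keeps the parallelogram with sides \<open>h *\<^sub>R a\<close> and
    \<open>h *\<^sub>R b\<close> inside \<open>S\<close> and inside the neighbourhood given by
    continuity. The summand \<open>1\<close> makes the estimate strict and the denominator positive
    when \<open>a\<close> and \<open>b\<close> vanish.\<close>
  define \<delta> where "\<delta> = min d1 d2 / (norm a + norm b + 1)"
  have \<delta>: "0 < \<delta>" unfolding \<delta>_def using d1 d2 by (simp add: add_nonneg_pos)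
  have "dist ((f (z + h *\<^sub>R a + h *\<^sub>R b) - f (z + h *\<^sub>R a) - f (z + h *\<^sub>R b) + f z) / h\<^sup>2) (g z) < e"
    if h: "0 < h" "h < \<delta>" for h
  proof -
    have near: "dist (z + s *\<^sub>R a + t *\<^sub>R b) z < min d1 d2" if "0 \<le> s" "s \<le> h" "0 \<le> t" "t \<le> h" for s t
    proof -
      have "dist (z + s *\<^sub>R a + t *\<^sub>R b) z = norm (s *\<^sub>R a + t *\<^sub>R b)" by (simp add: dist_norm)
      also have "\<dots> \<le> s * norm a + t * norm b"
        using norm_triangle_ineq[of "s *\<^sub>R a" "t *\<^sub>R b"] that by simp
      also have "\<dots> \<le> h * norm a + h * norm b"
        using that by (intro add_mono mult_right_mono) auto
      also have "\<dots> < h * (norm a + norm b + 1)" using h by (simp add: algebra_simps)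
      also have "\<dots> \<le> \<delta> * (norm a + norm b + 1)"
        using h by (intro mult_right_mono) auto
      also have "\<dots> = min d1 d2"
        unfolding \<delta>_def using add_nonneg_pos[of "norm a + norm b" 1] by simp
      finally show ?thesis .
    qed
    then have inS: "z + s *\<^sub>R a + t *\<^sub>R b \<in> S" if "0 \<le> s" "s \<le> h" "0 \<le> t" "t \<le> h" for s t
      using d2(2) that by (fastforce simp: dist_commute)
    \<comment> \<open>The first difference along \<open>b\<close>; its increment from
      \<open>0\<close> to \<open>h\<close> is the second difference.\<close>
    define u where "u s = f ((z + h *\<^sub>R b) + s *\<^sub>R a) - f (z + s *\<^sub>R a)" for s
    have "(u has_real_derivative fa ((z + h *\<^sub>R b) + s *\<^sub>R a) - fa (z + s *\<^sub>R a)) (at s)" if "0 \<le> s" "s \<le> h" for s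
      unfolding u_def fa_def
      using inS[of s h] inS[of s 0] that h
      by (intro DERIV_diff smooth_on_line_derivative[OF f]) (auto simp: algebra_simps)
    then obtain \<xi> where \<xi>: "0 < \<xi>" "\<xi> < h"
      "u h - u 0 = (h - 0) * (fa ((z + h *\<^sub>R b) + \<xi> *\<^sub>R a) - fa (z + \<xi> *\<^sub>R a))"
      using MVT2[OF h(1), of u "\<lambda>s. fa ((z + h *\<^sub>R b) + s *\<^sub>R a) - fa (z + s *\<^sub>R a)"] by blast
    define w where "w t = fa ((z + \<xi> *\<^sub>R a) + t *\<^sub>R b)" for t
    have "(w has_real_derivative g ((z + \<xi> *\<^sub>R a) + t *\<^sub>R b)) (at t)" if "0 \<le> t" "t \<le> h" for t
      unfolding w_def g_def
      using inS[of \<xi> t] that h \<xi> by (intro smooth_on_line_derivative[OF fa]) auto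
    then obtain \<eta> where \<eta>: "0 < \<eta>" "\<eta> < h" "w h - w 0 = (h - 0) * g ((z + \<xi> *\<^sub>R a) + \<eta> *\<^sub>R b)"
      using MVT2[OF h(1), of w "\<lambda>t. g ((z + \<xi> *\<^sub>R a) + t *\<^sub>R b)"] by blast
    have "f (z + h *\<^sub>R a + h *\<^sub>R b) - f (z + h *\<^sub>R a) - f (z + h *\<^sub>R b) + f z = u h - u 0"
      by (simp add: u_def algebra_simps)
    also have "\<dots> = h\<^sup>2 * g (z + \<xi> *\<^sub>R a + \<eta> *\<^sub>R b)"
      using \<xi>(3) \<eta>(3) by (simp add: w_def power2_eq_square algebra_simps)
    finally show ?thesis
      using h d1(2)[of "z + \<xi> *\<^sub>R a + \<eta> *\<^sub>R b"] near[of \<xi> \<eta>] \<xi> \<eta> by simp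
  qed
  then show "\<forall>\<^sub>F h in at_right 0. dist ((f (z + h *\<^sub>R a + h *\<^sub>R b) - f (z + h *\<^sub>R a) - f (z + h *\<^sub>R b) + f z) / h\<^sup>2)
      (frechet_derivative (\<lambda>w. frechet_derivative f (at w) a) (at z) b) < e"
    unfolding eventually_at_right_field using \<delta> by (auto simp: g_def fa_def[abs_def])
qed

lemma smooth_on_deriv_commute:
  fixes f :: "'b::real_normed_vector \<Rightarrow> real"
  assumes "open S" "smooth_on S f" "z \<in> S"
  shows "frechet_derivative (\<lambda>w. frechet_derivative f (at w) a) (at z) b =
    frechet_derivative (\<lambda>w. frechet_derivative f (at w) b) (at z) a"
proof (rule tendsto_unique[OF _ second_difference_tendsto[OF assms]])
  show "((\<lambda>h. (f (z + h *\<^sub>R a + h *\<^sub>R b) - f (z + h *\<^sub>R a) - f (z + h *\<^sub>R b) + f z) / h\<^sup>2) \<longlongrightarrow>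
    frechet_derivative (\<lambda>w. frechet_derivative f (at w) b) (at z) a) (at_right 0)"
    using second_difference_tendsto[OF assms, of b a] by (simp add: algebra_simps)
qed simp

text \<open>Will be applied with \<open>a\<close> the parameter direction and \<open>ds\<close>
  directions of the base, in order to interchange one parameter derivative with any number of base
  derivatives.\<close>

lemma iter_deriv_commute:
  fixes f :: "'b::real_normed_vector \<Rightarrow> real"
  assumes S: "open S" and "smooth_on S f" and z: "z \<in> S"
  shows "iter_deriv ds (\<lambda>w. frechet_derivative f (at w) a) z = frechet_derivative (iter_deriv ds f) (at z) a"
  using assms(2)
proof (induction ds arbitrary: f)
  case (Cons d ds)
  have "iter_deriv (d # ds) (\<lambda>w. frechet_derivative f (at w) a) z =
      iter_deriv ds (\<lambda>w. frechet_derivative (\<lambda>w. frechet_derivative f (at w) d) (at w) a) z"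
    using iter_deriv_cong[OF S smooth_on_deriv_commute[OF S Cons.prems] z] by simp
  also have "\<dots> = frechet_derivative (iter_deriv ds (\<lambda>w. frechet_derivative f (at w) d)) (at z) a"
    by (rule Cons.IH[OF smooth_on_dir[OF Cons.prems]])
  finally show ?case by simp
qed simp

lemma iter_deriv_lincomb:
  fixes f g :: "'b::real_normed_vector \<Rightarrow> real"
  assumes S: "open S" and "smooth_on S f" "smooth_on S g" and z: "z \<in> S"
  shows "iter_deriv ds (\<lambda>z. a * f z + b * g z) z = a * iter_deriv ds f z + b * iter_deriv ds g z"
  using assms(2,3)
proof (induction ds arbitrary: f g)
  case (Cons d ds)
  have "frechet_derivative (\<lambda>z. a * f z + b * g z) (at w) d =
      a * frechet_derivative f (at w) d + b * frechet_derivative g (at w) d" if "w \<in> S" for w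
    using that by (intro frechet_derivative_eqI has_derivative_add has_derivative_mult_right
      smooth_on_has_derivative[OF Cons.prems(1)] smooth_on_has_derivative[OF Cons.prems(2)])
  from iter_deriv_cong[OF S this z] show ?case
    using Cons.IH[OF smooth_on_dir[OF Cons.prems(1)] smooth_on_dir[OF Cons.prems(2)]] by simp
qed simp

lemma smooth_on_slice_derivative:
  fixes F :: "'a::real_normed_vector \<times> 'b::real_normed_vector \<Rightarrow> real"
  assumes F: "smooth_on (S \<times> U) F" and "t \<in> S" "z \<in> U"
  shows "((\<lambda>z. F (t, z)) has_derivative (\<lambda>d. frechet_derivative F (at (t, z)) (0, d))) (at z)"
proof -
  have "(Pair t has_derivative Pair 0) (at z)"
    by (auto intro!: derivative_eq_intros)
  from has_derivative_compose[OF this smooth_on_has_derivative[OF F]] show ?thesis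
    using assms by simp
qed

lemma iter_deriv_slice:
  fixes F :: "'a::real_normed_vector \<times> 'b::real_normed_vector \<Rightarrow> real"
  assumes U: "open U" and F: "smooth_on (S \<times> U) F" and t: "t \<in> S" and z: "z \<in> U"
  shows "iter_deriv ds (\<lambda>z. F (t, z)) z = iter_deriv (map (Pair 0) ds) F (t, z)"
  using F
proof (induction ds arbitrary: F)
  case (Cons d ds)
  have "frechet_derivative (\<lambda>z. F (t, z)) (at w) d = frechet_derivative F (at (t, w)) (0, d)" if "w \<in> U" for w
    by (rule frechet_derivative_eqI[OF smooth_on_slice_derivative[OF Cons.prems t that]])
  from iter_deriv_cong[OF U this z] show ?case
    using Cons.IH[OF smooth_on_dir[OF Cons.prems]] by simp
qed simp

lemma smooth_on_slice:
  fixes F :: "'a::real_normed_vector \<times> 'b::real_normed_vector \<Rightarrow> real"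
  assumes U: "open U" and F: "smooth_on (S \<times> U) F" and t: "t \<in> S"
  shows "smooth_on U (\<lambda>z. F (t, z))"
  unfolding smooth_on_def
proof (intro allI ballI)
  fix ds z assume z: "z \<in> U"
  have "(\<lambda>z. iter_deriv (map (Pair 0) ds) F (t, z)) differentiable at z"
    using smooth_on_slice_derivative[OF smooth_on_iter_deriv[OF F] t z]
    unfolding differentiable_def by blast
  from differentiable_cong_open[OF U _ z this] show "iter_deriv ds (\<lambda>z. F (t, z)) differentiable at z"
    using iter_deriv_slice[OF U F t] by simp
qed

text \<open>For each \<open>z\<close> the quotient is the parameter derivative at some intermediate
  parameter depending on \<open>z\<close>. Uniform continuity of this derivative on the compact set
  \<open>cball t r \<times> C\<close> makes the error small for all \<open>z\<close> at
  once.\<close>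

lemma difference_quotient_uniform:
  fixes F :: "real \<times> 'b::real_normed_vector \<Rightarrow> real"
  assumes S: "open S" and U: "open U" and F: "smooth_on (S \<times> U) F" and t: "t \<in> S"
    and C: "compact C" "C \<subseteq> U" and e: "0 < e"
  shows "\<forall>\<^sub>F h in at 0. \<forall>z\<in>C. \<bar>(1 / h) * (F (t + h, z) - F (t, z)) - frechet_derivative F (at (t, z)) (1, 0)\<bar> \<le> e"
proof -
  define g where "g w = frechet_derivative F (at w) (1, 0)" for w
  obtain r where r: "0 < r" "cball t r \<subseteq> S" using S t open_contains_cball by blast
  have "continuous_on (S \<times> U) g"
    unfolding g_def by (rule smooth_on_continuous[OF smooth_on_dir[OF F]])
  then have "continuous_on (cball t r \<times> C) g"
    by (rule continuous_on_subset) (use r C in auto)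
  then have "uniformly_continuous_on (cball t r \<times> C) g"
    by (rule compact_uniformly_continuous) (intro compact_Times compact_cball C)
  then obtain d where d: "0 < d" "\<And>x y. x \<in> cball t r \<times> C \<Longrightarrow> y \<in> cball t r \<times> C \<Longrightarrow> dist y x < d \<Longrightarrow> dist (g y) (g x) < e"
    using e unfolding uniformly_continuous_on_def by metis
  have "\<bar>(1 / h) * (F (t + h, z) - F (t, z)) - g (t, z)\<bar> \<le> e" if h: "h \<noteq> 0" "\<bar>h\<bar> < min d r" and z: "z \<in> C" for h z
  proof -
    define u where "u s = F ((t, z) + s *\<^sub>R (1, 0))" for s
    have u: "(u has_real_derivative g (t + s, z)) (at s)" if "\<bar>s\<bar> \<le> \<bar>h\<bar>" for s
    proof -
      have "(t, z) + s *\<^sub>R (1, 0) \<in> S \<times> U"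
        using r(2) h that z C by (auto intro!: subsetD[OF r(2)] simp: dist_real_def)
      from smooth_on_line_derivative[OF F this] show ?thesis by (simp add: u_def[abs_def] g_def)
    qed
    obtain s where s: "\<bar>s\<bar> \<le> \<bar>h\<bar>" "u h - u 0 = h * g (t + s, z)"
    proof (cases "h > 0")
      case True
      then obtain s where "0 < s" "s < h" "u h - u 0 = (h - 0) * g (t + s, z)"
        using MVT2[OF True, of u "\<lambda>s. g (t + s, z)"] u by (auto simp: abs_le_iff)
      then show ?thesis using that[of s] by simp
    next
      case False
      then have "h < 0" using h by simp
      then obtain s where "h < s" "s < 0" "u 0 - u h = (0 - h) * g (t + s, z)"
        using MVT2[of h 0 u "\<lambda>s. g (t + s, z)"] u by (auto simp: abs_le_iff)
      then show ?thesis using that[of s] by simp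
    qed
    have "(1 / h) * (F (t + h, z) - F (t, z)) = g (t + s, z)"
      using s(2) h by (simp add: u_def field_simps)
    moreover have "dist (g (t + s, z)) (g (t, z)) < e"
      using s(1) h z r by (intro d(2)) (auto simp: dist_real_def dist_Pair_Pair)
    ultimately show ?thesis by (simp add: dist_real_def)
  qed
  then show ?thesis
    unfolding eventually_at using d(1) r(1)
    by (intro exI[of _ "min d r"]) (auto simp: g_def dist_real_def)
qed

text \<open>The increment is split into a parameter increment at the moved base point
  \<open>z'\<close>, the change of \<open>H\<close> between \<open>z\<close> and \<open>z'\<close>,
  and a base increment at the fixed parameter \<open>t\<close>; each part gets a third of the error.
  Uniformity is needed for the first part, as \<open>z'\<close> varies with the increment.\<close>

lemma has_derivative_Pair_uniform:
  fixes G :: "real \<times> 'c::real_normed_vector \<Rightarrow> real"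
  assumes D: "((\<lambda>z. G (t, z)) has_derivative D) (at z)" and H: "continuous (at z) H" and r: "0 < r"
    and unif: "\<And>e. 0 < e \<Longrightarrow> \<forall>\<^sub>F h in at 0. \<forall>z'\<in>cball z r. \<bar>(1 / h) * (G (t + h, z') - G (t, z')) - H z'\<bar> \<le> e"
  shows "(G has_derivative (\<lambda>d. fst d * H z + D (snd d))) (at (t, z))"
  unfolding has_derivative_at_alt
proof (intro conjI allI impI)
  have "bounded_linear D" using D by (rule has_derivative_bounded_linear)
  then show "bounded_linear (\<lambda>d. fst d * H z + D (snd d))"
    by (intro bounded_linear_add bounded_linear_compose[OF _ bounded_linear_snd]
      bounded_linear_mult_const bounded_linear_fst)
  fix e :: real assume "0 < e"
  then have e: "0 < e / 3" by simp
  obtain d1 where d1: "0 < d1" "\<And>h z'. h \<noteq> 0 \<Longrightarrow> \<bar>h\<bar> < d1 \<Longrightarrow> z' \<in> cball z r \<Longrightarrow>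
      \<bar>(1 / h) * (G (t + h, z') - G (t, z')) - H z'\<bar> \<le> e / 3"
    using unif[OF e] unfolding eventually_at by (auto simp: dist_real_def)
  obtain d2 where d2: "0 < d2" "\<And>z'. dist z' z < d2 \<Longrightarrow> dist (H z') (H z) < e / 3"
    using H e unfolding continuous_at_eps_delta by blast
  obtain d3 where d3: "0 < d3" "\<And>z'. norm (z' - z) < d3 \<Longrightarrow>
      norm (G (t, z') - G (t, z) - D (z' - z)) \<le> e / 3 * norm (z' - z)"
    using D e unfolding has_derivative_at_alt by blast
  show "\<exists>d>0. \<forall>y. norm (y - (t, z)) < d \<longrightarrow>
      norm (G y - G (t, z) - (fst (y - (t, z)) * H z + D (snd (y - (t, z))))) \<le> e * norm (y - (t, z))"
  proof (intro exI[of _ "min (min d1 d2) (min d3 r)"] conjI allI impI)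
    fix y assume y: "norm (y - (t, z)) < min (min d1 d2) (min d3 r)"
    obtain s z' where yy: "y = (s, z')" by (cases y)
    define h where "h = s - t"
    have s: "s = t + h" by (simp add: h_def)
    have n1: "\<bar>h\<bar> \<le> norm (y - (t, z))" using norm_fst_le[of h "z' - z"] by (simp add: yy h_def)
    have n2: "norm (z' - z) \<le> norm (y - (t, z))" using norm_snd_le[of "z' - z" h] by (simp add: yy h_def)
    have zr: "z' \<in> cball z r" using n2 y by (simp add: dist_norm norm_minus_commute)
    have "\<bar>G (t + h, z') - G (t, z') - h * H z'\<bar> \<le> e / 3 * \<bar>h\<bar>"
    proof (cases "h = 0")
      case False
      have "\<bar>G (t + h, z') - G (t, z') - h * H z'\<bar> =
          \<bar>h\<bar> * \<bar>(1 / h) * (G (t + h, z') - G (t, z')) - H z'\<bar>"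
        using False by (simp add: abs_mult[symmetric] right_diff_distrib)
      also have "\<dots> \<le> \<bar>h\<bar> * (e / 3)"
        using d1(2)[OF False _ zr] n1 y by (intro mult_left_mono) auto
      finally show ?thesis by (simp add: mult.commute)
    qed simp
    moreover have "\<bar>h * (H z' - H z)\<bar> \<le> e / 3 * \<bar>h\<bar>"
    proof -
      have "\<bar>H z' - H z\<bar> \<le> e / 3" using d2(2)[of z'] n2 y by (simp add: dist_norm)
      then show ?thesis by (subst abs_mult, subst mult.commute) (intro mult_right_mono, auto)
    qed
    moreover have "\<bar>G (t, z') - G (t, z) - D (z' - z)\<bar> \<le> e / 3 * norm (z' - z)"
      using d3(2)[of z'] n2 y by simp
    moreover have "G y - G (t, z) - (fst (y - (t, z)) * H z + D (snd (y - (t, z)))) =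
        (G (t + h, z') - G (t, z') - h * H z') + h * (H z' - H z) + (G (t, z') - G (t, z) - D (z' - z))"
      by (simp add: yy s algebra_simps)
    ultimately have "norm (G y - G (t, z) - (fst (y - (t, z)) * H z + D (snd (y - (t, z))))) \<le>
        e / 3 * \<bar>h\<bar> + e / 3 * \<bar>h\<bar> + e / 3 * norm (z' - z)"
      unfolding real_norm_def by linarith
    also have "\<dots> \<le> e / 3 * norm (y - (t, z)) + e / 3 * norm (y - (t, z)) + e / 3 * norm (y - (t, z))"
      using n1 n2 e by (intro add_mono mult_left_mono) auto
    finally show "norm (G y - G (t, z) - (fst (y - (t, z)) * H z + D (snd (y - (t, z))))) \<le> e * norm (y - (t, z))"
      by simp
  qed (use d1 d2 d3 r in auto)
qed


section \<open>Sections of vector bundles\<close>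

lemma limitin_lc_topologyI:
  assumes "l \<in> V" "\<forall>\<^sub>F x in F. f x \<in> V" "\<And>q. q \<in> P \<Longrightarrow> ((\<lambda>x. q (f x - l)) \<longlongrightarrow> 0) F"
  shows "limitin (lc_topology V P) f l F"
  unfolding limitin_def topspace_lc_topology openin_lc_topology
proof (intro conjI allI impI)
  fix U assume U: "lc_open V P U \<and> l \<in> U"
  then obtain Q e where Q: "finite Q" "Q \<subseteq> P" "0 < e" "{y\<in>V. \<forall>q\<in>Q. q (y - l) < e} \<subseteq> U"
    unfolding lc_open_def by blast
  have "\<forall>\<^sub>F x in F. \<forall>q\<in>Q. q (f x - l) < e"
    using Q(1) order_tendstoD(2)[OF assms(3)[OF subsetD[OF Q(2)]] Q(3)]
    by (intro eventually_ball_finite) auto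
  then show "\<forall>\<^sub>F x in F. f x \<in> U"
    using assms(2) by eventually_elim (use Q(4) in blast)
qed (rule assms(1))

lemma continuous_map_seminorm:
  assumes V: "subspace V" and q: "seminorm_on V q" "q \<in> P"
  shows "continuous_map (lc_topology V P) euclideanreal q"
  unfolding continuous_map_def topspace_lc_topology openin_lc_topology
proof (intro conjI allI impI)
  fix T :: "real set" assume "openin euclideanreal T"
  then have T: "open T" by simp
  show "lc_open V P {x \<in> V. q x \<in> T}"
    unfolding lc_open_def
  proof (intro conjI ballI)
    fix x assume x: "x \<in> {x \<in> V. q x \<in> T}"
    obtain e where e: "0 < e" "ball (q x) e \<subseteq> T" using T x openE by blast
    have "q y \<in> T" if y: "y \<in> V" "q (y - x) < e" for y
    proof -
      have tri: "q (a + b) \<le> q a + q b" if "a \<in> V" "b \<in> V" for a b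
        using q(1) that unfolding seminorm_on_def by blast
      have yx: "y - x \<in> V" using V x y by (simp add: subspace_diff)
      have "q y \<le> q (y - x) + q x" using tri[OF yx, of x] x by simp
      moreover have "q x \<le> q (- 1 *\<^sub>R (y - x)) + q y"
        using tri[OF subspace_scale[OF V yx, of "- 1"] y(1)] by simp
      moreover have "q (- 1 *\<^sub>R (y - x)) = \<bar>- 1\<bar> * q (y - x)"
        using q(1) yx unfolding seminorm_on_def by blast
      ultimately have "dist (q x) (q y) < e" using y by (simp add: dist_real_def abs_less_iff)
      then show ?thesis using e(2) by auto
    qed
    then show "\<exists>Q \<epsilon>. finite Q \<and> Q \<subseteq> P \<and> 0 < \<epsilon> \<and> {y \<in> V. \<forall>q\<in>Q. q (y - x) < \<epsilon>} \<subseteq> {x \<in> V. q x \<in> T}"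
      using q(2) e(1) by (intro exI[of _ "{q}"] exI[of _ e]) auto
  qed auto
qed auto

lemma limitin_lc_topology_seminormD:
  assumes V: "subspace V" and q: "seminorm_on V q" "q \<in> P"
    and l: "limitin (lc_topology V P) f l F" and f: "\<forall>\<^sub>F x in F. f x \<in> V"
  shows "((\<lambda>x. q (f x - l)) \<longlongrightarrow> 0) F"
proof (rule tendstoI)
  fix e :: real assume e: "0 < e"
  have lV: "l \<in> V" using limitin_topspace[OF l] by (simp add: topspace_lc_topology)
  have q0: "q 0 = 0"
  proof -
    have "q (0 *\<^sub>R 0) = \<bar>0\<bar> * q 0" using q(1) subspace_0[OF V] unfolding seminorm_on_def by blast
    then show ?thesis by simp
  qed
  have "lc_open V P {y \<in> V. q (y - l) < e}"
    unfolding lc_open_def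
  proof (intro conjI ballI)
    fix x assume x: "x \<in> {y \<in> V. q (y - l) < e}"
    have "q (y - l) < e" if "y \<in> V" "q (y - x) < e - q (x - l)" for y
    proof -
      have "q ((y - x) + (x - l)) \<le> q (y - x) + q (x - l)"
        using q(1) subspace_diff[OF V that(1), of x] subspace_diff[OF V _ lV, of x] x
        unfolding seminorm_on_def by blast
      then show ?thesis using that by simp
    qed
    then show "\<exists>Q \<epsilon>. finite Q \<and> Q \<subseteq> P \<and> 0 < \<epsilon> \<and> {y \<in> V. \<forall>q\<in>Q. q (y - x) < \<epsilon>} \<subseteq> {y \<in> V. q (y - l) < e}"
      using q(2) x by (intro exI[of _ "{q}"] exI[of _ "e - q (x - l)"]) auto
  qed auto
  then have "\<forall>\<^sub>F x in F. f x \<in> {y \<in> V. q (y - l) < e}"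
    using l q0 e lV unfolding limitin_def openin_lc_topology by (elim conjE allE impE) auto
  then show "\<forall>\<^sub>F x in F. dist (q (f x - l)) 0 < e"
  proof eventually_elim
    case (elim x)
    then have "0 \<le> q (f x - l)" using q(1) subspace_diff[OF V _ lV] unfolding seminorm_on_def by blast
    then show ?case using elim by simp
  qed
qed

lemma seminorm_on_subset: "seminorm_on V q \<Longrightarrow> U \<subseteq> V \<Longrightarrow> seminorm_on U q"
  unfolding seminorm_on_def by blast

definition F_norm ::
  "'b set \<Rightarrow> ('b \<Rightarrow> 'c::real_normed_vector) \<Rightarrow> ('b \<Rightarrow> 'f \<Rightarrow> real) \<Rightarrow> 'b set \<Rightarrow> 'c list \<Rightarrow> ('b \<Rightarrow> 'f) \<Rightarrow> real" where
  "F_norm W \<psi> \<kappa> L ds \<sigma> = (SUP p\<in>L. \<bar>iter_deriv ds (local_rep (W, \<psi>, \<kappa>) \<sigma>) (\<psi> p)\<bar>)"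

text \<open>The record \<open>vbundle\<close> carries no axioms; these are the properties from which
  the facts about section spaces are derived, for forms, for \<open>TO_bundle\<close> and for
  \<open>tensor_form_bundle\<close> alike. The last one expresses that the model space is
  finite-dimensional.\<close>

locale smooth_bundle =
  fixes E :: "('b::t2_space, 'c::real_normed_vector, 'f::real_vector) vbundle"
  assumes subspace_fibre: "subspace (fibre E p)"
    and open_image: "(W, \<psi>, \<kappa>) \<in> bcoords E \<Longrightarrow> open (\<psi> ` W)"
    and inj_chart: "(W, \<psi>, \<kappa>) \<in> bcoords E \<Longrightarrow> inj_on \<psi> W"
    and continuous_chart: "(W, \<psi>, \<kappa>) \<in> bcoords E \<Longrightarrow> continuous_on W \<psi>"
    and continuous_chart_inv: "(W, \<psi>, \<kappa>) \<in> bcoords E \<Longrightarrow> continuous_on (\<psi> ` W) (inv_into W \<psi>)"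
    and linear_coord: "(W, \<psi>, \<kappa>) \<in> bcoords E \<Longrightarrow> p \<in> W \<Longrightarrow> linear_on_subspace (fibre E p) (\<kappa> p)"
    and compact_cball_model: "compact (cball (z::'c) e)"
begin

lemma section_fibre: "\<sigma> \<in> smooth_sections E \<Longrightarrow> \<sigma> p \<in> fibre E p"
  unfolding smooth_sections_def by blast

lemma section_smooth:
  "\<sigma> \<in> smooth_sections E \<Longrightarrow> (W, \<psi>, \<kappa>) \<in> bcoords E \<Longrightarrow> smooth_on (\<psi> ` W) (local_rep (W, \<psi>, \<kappa>) \<sigma>)"
  unfolding smooth_sections_def by blast

lemma coord_lincomb:
  assumes "(W, \<psi>, \<kappa>) \<in> bcoords E" "p \<in> W" "\<sigma> p \<in> fibre E p" "\<tau> p \<in> fibre E p"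
  shows "\<kappa> p ((a *\<^sub>R \<sigma> + b *\<^sub>R \<tau>) p) = a * \<kappa> p (\<sigma> p) + b * \<kappa> p (\<tau> p)"
  using linear_coord[OF assms(1,2)] assms(3,4)
  unfolding linear_on_subspace_def by (simp add: scaleR_fun_def)

lemma coord_zero:
  assumes "(W, \<psi>, \<kappa>) \<in> bcoords E" "p \<in> W"
  shows "\<kappa> p 0 = 0"
  using coord_lincomb[OF assms, of 0 0 0 0] subspace_0[OF subspace_fibre] by simp

lemma inv_chart:
  assumes "(W, \<psi>, \<kappa>) \<in> bcoords E"
  shows "z \<in> \<psi> ` W \<Longrightarrow> inv_into W \<psi> z \<in> W" "p \<in> W \<Longrightarrow> inv_into W \<psi> (\<psi> p) = p"
    "z \<in> \<psi> ` W \<Longrightarrow> \<psi> (inv_into W \<psi> z) = z"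
  using inj_chart[OF assms] by (auto simp: inv_into_into f_inv_into_f)

lemma local_rep_lincomb:
  assumes k: "(W, \<psi>, \<kappa>) \<in> bcoords E" and z: "z \<in> \<psi> ` W"
    and "\<sigma> \<in> smooth_sections E" "\<tau> \<in> smooth_sections E"
  shows "local_rep (W, \<psi>, \<kappa>) (a *\<^sub>R \<sigma> + b *\<^sub>R \<tau>) z =
    a * local_rep (W, \<psi>, \<kappa>) \<sigma> z + b * local_rep (W, \<psi>, \<kappa>) \<tau> z"
  unfolding local_rep_def prod.case
  by (rule coord_lincomb[OF k inv_chart(1)[OF k z]]) (use assms section_fibre in auto)

lemma section_lincomb:
  assumes s: "\<sigma> \<in> smooth_sections E" and t: "\<tau> \<in> smooth_sections E"
  shows "a *\<^sub>R \<sigma> + b *\<^sub>R \<tau> \<in> smooth_sections E"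
proof -
  have "(a *\<^sub>R \<sigma> + b *\<^sub>R \<tau>) p \<in> fibre E p" for p
    using section_fibre[OF s, of p] section_fibre[OF t, of p] subspace_fibre[of p]
    by (simp add: scaleR_fun_def subspace_add subspace_scale)
  moreover have "smooth_on (\<psi> ` W) (local_rep (W, \<psi>, \<kappa>) (a *\<^sub>R \<sigma> + b *\<^sub>R \<tau>))" if k: "(W, \<psi>, \<kappa>) \<in> bcoords E" for W \<psi> \<kappa>
  proof (rule smooth_on_cong[OF open_image[OF k]])
    show "smooth_on (\<psi> ` W) (\<lambda>z. a * local_rep (W, \<psi>, \<kappa>) \<sigma> z + b * local_rep (W, \<psi>, \<kappa>) \<tau> z)"
      by (intro smooth_on_add smooth_on_cmult open_image[OF k] section_smooth[OF s k] section_smooth[OF t k])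
  qed (rule local_rep_lincomb[OF k _ s t, symmetric])
  ultimately show ?thesis unfolding smooth_sections_def by auto
qed

lemma zero_section: "0 \<in> smooth_sections E"
proof -
  have "smooth_on (\<psi> ` W) (local_rep (W, \<psi>, \<kappa>) 0)" if k: "(W, \<psi>, \<kappa>) \<in> bcoords E" for W \<psi> \<kappa>
    by (rule smooth_on_cong[OF open_image[OF k] _ smooth_on_const[OF open_image[OF k], of 0]])
      (simp add: local_rep_def coord_zero[OF k inv_chart(1)[OF k]])
  then show ?thesis
    unfolding smooth_sections_def using subspace_0[OF subspace_fibre] by auto
qed

lemma subspace_sections: "subspace (smooth_sections E)"
  unfolding subspace_def
proof (intro conjI ballI allI zero_section)
  fix \<sigma> \<tau> c assume "\<sigma> \<in> smooth_sections E" "\<tau> \<in> smooth_sections E"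
  from section_lincomb[OF this, of 1 1] section_lincomb[OF this(1) zero_section, of c 0]
  show "\<sigma> + \<tau> \<in> smooth_sections E" "c *\<^sub>R \<sigma> \<in> smooth_sections E" by auto
qed

lemma sections_in_compact:
  assumes "compact K"
  shows "sections_in E K \<subseteq> compact_sections E"
proof -
  have "compact (closure T)" if "T \<subseteq> K" for T
  proof -
    have "closure T \<subseteq> K" using closure_minimal[OF that compact_imp_closed[OF assms]] .
    then have "K \<inter> closure T = closure T" by auto
    then show ?thesis using compact_Int_closed[OF assms, of "closure T"] by simp
  qed
  then show ?thesis unfolding sections_in_def compact_sections_def by auto
qed

lemma subspace_compact: "subspace (compact_sections E)"
proof -
  have sub: "\<sigma> \<in> compact_sections E \<Longrightarrow> \<sigma> \<in> sections_in E (closure {p. \<sigma> p \<noteq> 0})" for \<sigma>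
    unfolding sections_in_def compact_sections_def using closure_subset by fast
  have "0 \<in> compact_sections E" using zero_section unfolding compact_sections_def by simp
  moreover have "\<sigma> + \<tau> \<in> compact_sections E" if "\<sigma> \<in> compact_sections E" "\<tau> \<in> compact_sections E" for \<sigma> \<tau>
  proof -
    have "compact (closure {p. \<sigma> p \<noteq> 0} \<union> closure {p. \<tau> p \<noteq> 0})"
      using that by (intro compact_Un) (auto simp: compact_sections_def)
    moreover have "\<sigma> + \<tau> \<in> sections_in E (closure {p. \<sigma> p \<noteq> 0} \<union> closure {p. \<tau> p \<noteq> 0})"
      using sub[OF that(1)] sub[OF that(2)] subspace_add[OF subspace_sections, of \<sigma> \<tau>]
        add_0[of "0::'f"] unfolding sections_in_def plus_fun_def by fastforce
    ultimately show ?thesis using sections_in_compact by blast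
  qed
  moreover have "c *\<^sub>R \<sigma> \<in> compact_sections E" if "\<sigma> \<in> compact_sections E" for \<sigma> c
  proof -
    have "compact (closure {p. \<sigma> p \<noteq> 0})" using that by (auto simp: compact_sections_def)
    moreover have "c *\<^sub>R \<sigma> \<in> sections_in E (closure {p. \<sigma> p \<noteq> 0})"
      using sub[OF that] subspace_scale[OF subspace_sections]
      unfolding sections_in_def by (auto simp: scaleR_fun_def)
    ultimately show ?thesis using sections_in_compact by blast
  qed
  ultimately show ?thesis unfolding subspace_def by blast
qed

lemma compact_sections_smooth: "\<sigma> \<in> compact_sections E \<Longrightarrow> \<sigma> \<in> smooth_sections E"
  by (simp add: compact_sections_def)

lemma iter_deriv_local_rep_lincomb:
  assumes k: "(W, \<psi>, \<kappa>) \<in> bcoords E" and z: "z \<in> \<psi> ` W"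
    and s: "\<sigma> \<in> smooth_sections E" and t: "\<tau> \<in> smooth_sections E"
  shows "iter_deriv ds (local_rep (W, \<psi>, \<kappa>) (a *\<^sub>R \<sigma> + b *\<^sub>R \<tau>)) z =
    a * iter_deriv ds (local_rep (W, \<psi>, \<kappa>) \<sigma>) z + b * iter_deriv ds (local_rep (W, \<psi>, \<kappa>) \<tau>) z"
  using iter_deriv_cong[OF open_image[OF k] local_rep_lincomb[OF k _ s t] z]
    iter_deriv_lincomb[OF open_image[OF k] section_smooth[OF s k] section_smooth[OF t k] z] by simp

text \<open>A real \<open>SUP\<close> can be estimated only over a set that is bounded above; here
  the bound comes from continuity on the compact set \<open>L\<close>.\<close>

lemma bdd_above_F_norm:
  assumes k: "(W, \<psi>, \<kappa>) \<in> bcoords E" and L: "compact L" "L \<subseteq> W" and s: "\<sigma> \<in> smooth_sections E"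
  shows "bdd_above ((\<lambda>p. \<bar>iter_deriv ds (local_rep (W, \<psi>, \<kappa>) \<sigma>) (\<psi> p)\<bar>) ` L)"
proof -
  have "continuous_on (\<psi> ` L) (iter_deriv ds (local_rep (W, \<psi>, \<kappa>) \<sigma>))"
    by (rule continuous_on_subset[OF smooth_on_continuous[OF smooth_on_iter_deriv[OF section_smooth[OF s k]]]])
      (use L in auto)
  then have "continuous_on L (\<lambda>p. \<bar>iter_deriv ds (local_rep (W, \<psi>, \<kappa>) \<sigma>) (\<psi> p)\<bar>)"
    by (intro continuous_on_rabs continuous_on_compose2[OF _ continuous_on_subset[OF continuous_chart[OF k] L(2)]]) auto
  then show ?thesis
    by (intro bounded_imp_bdd_above compact_imp_bounded compact_continuous_image L(1))
qed

lemma F_norm_ge: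
  assumes k: "(W, \<psi>, \<kappa>) \<in> bcoords E" and L: "compact L" "L \<subseteq> W" and s: "\<sigma> \<in> smooth_sections E" and p: "p \<in> L"
  shows "\<bar>iter_deriv ds (local_rep (W, \<psi>, \<kappa>) \<sigma>) (\<psi> p)\<bar> \<le> F_norm W \<psi> \<kappa> L ds \<sigma>"
  unfolding F_norm_def by (rule cSUP_upper[OF p bdd_above_F_norm[OF k L s]])

lemma seminorm_F_norm:
  assumes k: "(W, \<psi>, \<kappa>) \<in> bcoords E" and L: "compact L" "L \<noteq> {}" "L \<subseteq> W"
  shows "seminorm_on (smooth_sections E) (F_norm W \<psi> \<kappa> L ds)"
proof -
  let ?N = "F_norm W \<psi> \<kappa> L ds" and ?d = "\<lambda>\<sigma>. iter_deriv ds (local_rep (W, \<psi>, \<kappa>) \<sigma>)"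
  note ge = F_norm_ge[OF k L(1,3), where ds=ds]
  have lin: "?d (a *\<^sub>R \<sigma> + b *\<^sub>R \<tau>) (\<psi> p) = a * ?d \<sigma> (\<psi> p) + b * ?d \<tau> (\<psi> p)"
    if "\<sigma> \<in> smooth_sections E" "\<tau> \<in> smooth_sections E" "p \<in> L" for a b \<sigma> \<tau> p
    using iter_deriv_local_rep_lincomb[OF k _ that(1,2)] that(3) L(3) by blast
  have nonneg: "0 \<le> ?N \<sigma>" if s: "\<sigma> \<in> smooth_sections E" for \<sigma>
    using ge[OF s] L(2) abs_ge_zero order_trans by blast
  have add: "?N (\<sigma> + \<tau>) \<le> ?N \<sigma> + ?N \<tau>" if s: "\<sigma> \<in> smooth_sections E" "\<tau> \<in> smooth_sections E" for \<sigma> \<tau>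
  proof -
    have "\<bar>?d (\<sigma> + \<tau>) (\<psi> p)\<bar> \<le> ?N \<sigma> + ?N \<tau>" if "p \<in> L" for p
      using lin[OF s that, of 1 1] ge[OF s(1) that] ge[OF s(2) that] by simp
    then show ?thesis unfolding F_norm_def[of _ _ _ _ _ "\<sigma> + \<tau>"] using L(2) by (intro cSUP_least) auto
  qed
  have le: "?N (a *\<^sub>R \<sigma>) \<le> \<bar>a\<bar> * ?N \<sigma>" if s: "\<sigma> \<in> smooth_sections E" for a \<sigma>
  proof -
    have "\<bar>?d (a *\<^sub>R \<sigma>) (\<psi> p)\<bar> \<le> \<bar>a\<bar> * ?N \<sigma>" if "p \<in> L" for p
      using lin[OF s s that, of a 0] ge[OF s that] by (simp add: abs_mult mult_left_mono)
    then show ?thesis unfolding F_norm_def[of _ _ _ _ _ "a *\<^sub>R \<sigma>"] using L(2) by (intro cSUP_least) auto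
  qed
  have "?N (a *\<^sub>R \<sigma>) = \<bar>a\<bar> * ?N \<sigma>" if s: "\<sigma> \<in> smooth_sections E" for a \<sigma>
  proof (cases "a = 0")
    case True
    then show ?thesis using le[OF s, of 0] nonneg[OF zero_section] by simp
  next
    case False
    \<comment> \<open>The reverse inequality is \<open>le\<close> for the factor
      \<open>inverse a\<close>.\<close>
    have "?N (inverse a *\<^sub>R (a *\<^sub>R \<sigma>)) \<le> \<bar>inverse a\<bar> * ?N (a *\<^sub>R \<sigma>)"
      by (rule le[OF subspace_scale[OF subspace_sections s]])
    then have "\<bar>a\<bar> * ?N \<sigma> \<le> ?N (a *\<^sub>R \<sigma>)" using False by (simp add: field_simps)
    then show ?thesis using le[OF s, of a] by simp
  qed
  then show ?thesis unfolding seminorm_on_def using nonneg add by blast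
qed

lemma F_norm_in_F_seminorms:
  assumes "(W, \<psi>, \<kappa>) \<in> bcoords E" "compact L" "L \<noteq> {}" "L \<subseteq> W"
  shows "F_norm W \<psi> \<kappa> L ds \<in> F_seminorms E"
  unfolding F_seminorms_def F_norm_def[abs_def] using assms by blast

lemma continuous_F_norm:
  assumes "(W, \<psi>, \<kappa>) \<in> bcoords E" "compact L" "L \<noteq> {}" "L \<subseteq> W"
  shows "continuous_map (F_topology E) euclideanreal (F_norm W \<psi> \<kappa> L ds)"
  unfolding F_topology_def
  by (rule continuous_map_seminorm[OF subspace_sections seminorm_F_norm[OF assms] F_norm_in_F_seminorms[OF assms]])

text \<open>On compactly supported sections the (LF)-topology is finer than the (F)-topology. Limits
  of difference quotients in the former are therefore uniform on compact sets, for all base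
  derivatives.\<close>

lemma F_norm_in_LF_seminorms:
  assumes "(W, \<psi>, \<kappa>) \<in> bcoords E" "compact L" "L \<noteq> {}" "L \<subseteq> W"
  shows "F_norm W \<psi> \<kappa> L ds \<in> LF_seminorms E"
  unfolding LF_seminorms_def
proof (intro CollectI conjI allI impI)
  show "seminorm_on (compact_sections E) (F_norm W \<psi> \<kappa> L ds)"
    by (rule seminorm_on_subset[OF seminorm_F_norm[OF assms]]) (use compact_sections_smooth in blast)
qed (rule continuous_map_from_subtopology[OF continuous_F_norm[OF assms]])

lemma LF_limit_seminorm:
  assumes \<rho>: "\<rho> \<in> LF_seminorms E" and f: "\<forall>\<^sub>F x in F. f x \<in> compact_sections E"
    and l: "limitin (LF_topology E) f l F"
  shows "((\<lambda>x. \<rho> (f x - l)) \<longlongrightarrow> 0) F"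
  using limitin_lc_topology_seminormD[OF subspace_compact _ \<rho> l[unfolded LF_topology_def] f] \<rho>
  by (simp add: LF_seminorms_def)

section \<open>The exponential law: smooth curves of sections and jointly smooth families\<close>

lemma compact_neighbourhood:
  assumes k: "(W, \<psi>, \<kappa>) \<in> bcoords E" and z: "z \<in> \<psi> ` W"
  obtains r where "0 < r" "cball z r \<subseteq> \<psi> ` W" "compact (inv_into W \<psi> ` cball z r)"
    "inv_into W \<psi> ` cball z r \<subseteq> W" "inv_into W \<psi> ` cball z r \<noteq> {}"
proof -
  obtain r where r: "0 < r" "cball z r \<subseteq> \<psi> ` W"
    using open_image[OF k] z open_contains_cball by blast
  have "compact (inv_into W \<psi> ` cball z r)"
    by (rule compact_continuous_image[OF continuous_on_subset[OF continuous_chart_inv[OF k] r(2)] compact_cball_model])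
  then show ?thesis using that r inv_chart(1)[OF k] by (fastforce simp: less_imp_le)
qed

text \<open>The difference quotients of all derivatives converge locally uniformly in the base point, which together
  with differentiability in the base point gives total differentiability.\<close>

lemma smooth_curve_joint:
  assumes c: "c \<in> smooth_curves_lc (LF_topology E)" and k: "(W, \<psi>, \<kappa>) \<in> bcoords E"
  shows "smooth_on (UNIV \<times> \<psi> ` W) (\<lambda>(t, z). local_rep (W, \<psi>, \<kappa>) (c t) z)"
proof -
  obtain d where d0: "d 0 = c" and dT: "\<And>k t. d k t \<in> compact_sections E"
    and dl: "\<And>k t. limitin (LF_topology E) (\<lambda>h. (1 / h) *\<^sub>R (d k (t + h) - d k t)) (d (Suc k) t) (at 0)"
    using c unfolding smooth_curves_lc_def by (auto simp: LF_topology_def topspace_lc_topology)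
  note dS = compact_sections_smooth[OF dT]
  \<comment> \<open>First \<open>k\<close> derivatives of the curve, then the derivatives
    \<open>ds\<close> in the base. The total derivative of such a function is a combination of two
    functions of the same kind, so they generate a hull that is stable under
    differentiation.\<close>
  define G where "G k ds = (\<lambda>(t, z). iter_deriv ds (local_rep (W, \<psi>, \<kappa>) (d k t)) z)" for k :: nat and ds
  let ?S = "(UNIV :: real set) \<times> \<psi> ` W"
  have S: "open ?S" by (intro open_Times open_image[OF k] open_UNIV)
  have der: "(G m ds has_derivative (\<lambda>h. fst h * G (Suc m) ds (t, z) + G m (ds @ [snd h]) (t, z))) (at (t, z))"
    if z: "z \<in> \<psi> ` W" for m ds t z
  proof -
    obtain r where r: "0 < r" "cball z r \<subseteq> \<psi> ` W" "compact (inv_into W \<psi> ` cball z r)"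
      "inv_into W \<psi> ` cball z r \<subseteq> W" "inv_into W \<psi> ` cball z r \<noteq> {}"
      using compact_neighbourhood[OF k z] by blast
    let ?L = "inv_into W \<psi> ` cball z r"
    have sm: "smooth_on (\<psi> ` W) (iter_deriv ds (local_rep (W, \<psi>, \<kappa>) (d m t)))" for m
      by (rule smooth_on_iter_deriv[OF section_smooth[OF dS k]])
    have "(G m ds has_derivative (\<lambda>h. fst h * G (Suc m) ds (t, z) +
        frechet_derivative (iter_deriv ds (local_rep (W, \<psi>, \<kappa>) (d m t))) (at z) (snd h))) (at (t, z))"
    proof (rule has_derivative_Pair_uniform[OF _ _ r(1)])
      show "((\<lambda>z. G m ds (t, z)) has_derivative
          (\<lambda>h. frechet_derivative (iter_deriv ds (local_rep (W, \<psi>, \<kappa>) (d m t))) (at z) h)) (at z)"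
        unfolding G_def prod.case by (rule smooth_on_has_derivative[OF sm z])
      show "continuous (at z) (\<lambda>z. G (Suc m) ds (t, z))"
        unfolding G_def prod.case
        using smooth_on_differentiable[OF sm z] differentiable_imp_continuous_within by blast
      fix e :: real assume e: "0 < e"
      have ev: "\<forall>\<^sub>F h in at 0. (1 / h) *\<^sub>R (d m (t + h) - d m t) \<in> compact_sections E"
        using subspace_scale[OF subspace_compact subspace_diff[OF subspace_compact dT dT]] by simp
      have "((\<lambda>h. F_norm W \<psi> \<kappa> ?L ds ((1 / h) *\<^sub>R (d m (t + h) - d m t) - d (Suc m) t)) \<longlongrightarrow> 0) (at 0)"
        by (rule LF_limit_seminorm[OF F_norm_in_LF_seminorms[OF k r(3,5,4)] ev dl])
      then have "\<forall>\<^sub>F h in at 0. F_norm W \<psi> \<kappa> ?L ds ((1 / h) *\<^sub>R (d m (t + h) - d m t) - d (Suc m) t) < e"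
        using e by (rule order_tendstoD)
      then show "\<forall>\<^sub>F h in at 0. \<forall>z'\<in>cball z r. \<bar>(1 / h) * (G m ds (t + h, z') - G m ds (t, z')) - G (Suc m) ds (t, z')\<bar> \<le> e"
      proof eventually_elim
        case (elim h)
        show ?case
        proof
          fix z' assume z': "z' \<in> cball z r"
          then have zW: "z' \<in> \<psi> ` W" using r(2) by blast
          define q where "q = (1 / h) *\<^sub>R d m (t + h) + (- (1 / h)) *\<^sub>R d m t"
          have q: "q \<in> smooth_sections E" unfolding q_def by (rule section_lincomb[OF dS dS])
          have e1: "(1 / h) *\<^sub>R (d m (t + h) - d m t) - d (Suc m) t = 1 *\<^sub>R q + (- 1) *\<^sub>R d (Suc m) t"
            by (simp add: q_def scaleR_diff_right)
          have "iter_deriv ds (local_rep (W, \<psi>, \<kappa>) (1 *\<^sub>R q + (- 1) *\<^sub>R d (Suc m) t)) z' =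
              (1 / h) * (G m ds (t + h, z') - G m ds (t, z')) - G (Suc m) ds (t, z')"
            unfolding iter_deriv_local_rep_lincomb[OF k zW q dS] unfolding q_def
              iter_deriv_local_rep_lincomb[OF k zW dS dS] G_def by (simp add: algebra_simps)
          moreover have "\<bar>iter_deriv ds (local_rep (W, \<psi>, \<kappa>) (1 *\<^sub>R q + (- 1) *\<^sub>R d (Suc m) t)) (\<psi> (inv_into W \<psi> z'))\<bar>
              \<le> F_norm W \<psi> \<kappa> ?L ds (1 *\<^sub>R q + (- 1) *\<^sub>R d (Suc m) t)"
            by (rule F_norm_ge[OF k r(3,4) section_lincomb[OF q dS]]) (use z' in blast)
          ultimately show "\<bar>(1 / h) * (G m ds (t + h, z') - G m ds (t, z')) - G (Suc m) ds (t, z')\<bar> \<le> e"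
            using elim by (simp only: e1 inv_chart(3)[OF k zW])
        qed
      qed
    qed
    then show ?thesis by (simp add: G_def iter_deriv_append)
  qed
  have "smooth_on ?S (G 0 [])"
  proof (rule smooth_on_hull_coinduct[OF S, where F="\<lambda>g. \<exists>m ds. g = G m ds"])
    fix g assume "\<exists>m ds. g = G m ds"
    then obtain m ds where g: "g = G m ds" by blast
    let ?F = "\<lambda>g. \<exists>m ds. g = G m ds"
    show "\<exists>g'. (\<forall>z\<in>?S. (g has_derivative (\<lambda>d. g' d z)) (at z)) \<and> (\<forall>d. smooth_hull ?S ?F (g' d))"
    proof (intro exI[of _ "\<lambda>h w. fst h * G (Suc m) ds w + G m (ds @ [snd h]) w"] conjI ballI allI)
      fix w assume "w \<in> ?S"
      then show "(g has_derivative (\<lambda>h. fst h * G (Suc m) ds w + G m (ds @ [snd h]) w)) (at w)"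
        unfolding g using der by (cases w) auto
    next
      fix h :: "real \<times> 'c"
      have 1: "smooth_hull ?S ?F (\<lambda>w. fst h * G (Suc m) ds w)"
        using smooth_hull_base[of ?F "G (Suc m) ds" ?S "\<lambda>w. fst h"] smooth_on_const[OF S] by blast
      have 2: "smooth_hull ?S ?F (\<lambda>w. 1 * G m (ds @ [snd h]) w)"
        using smooth_hull_base[of ?F "G m (ds @ [snd h])" ?S "\<lambda>w. 1"] smooth_on_const[OF S] by blast
      show "smooth_hull ?S ?F (\<lambda>w. fst h * G (Suc m) ds w + G m (ds @ [snd h]) w)"
        using smooth_hull_plus[OF 1 2] by simp
    qed
  qed blast
  then show ?thesis by (simp add: G_def d0)
qed

text \<open>Partial derivatives commute, so the mean value theorem applies to every derivative in the base point.\<close>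

lemma LF_difference_quotient:
  assumes S: "open S" and t: "t \<in> S" and \<Phi>: "\<And>s. s \<in> S \<Longrightarrow> \<Phi> s \<in> smooth_sections E"
    and \<Phi>': "\<Phi>' \<in> sections_in E K" and K: "compact K"
    and supp: "\<forall>\<^sub>F h in at 0. {p. \<Phi> (t + h) p \<noteq> 0} \<subseteq> K" "{p. \<Phi> t p \<noteq> 0} \<subseteq> K"
    and joint: "\<And>W \<psi> \<kappa>. (W, \<psi>, \<kappa>) \<in> bcoords E \<Longrightarrow> smooth_on (S \<times> \<psi> ` W) (\<lambda>(t, z). local_rep (W, \<psi>, \<kappa>) (\<Phi> t) z)"
    and deriv: "\<And>W \<psi> \<kappa> z. (W, \<psi>, \<kappa>) \<in> bcoords E \<Longrightarrow> z \<in> \<psi> ` W \<Longrightarrow>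
      local_rep (W, \<psi>, \<kappa>) \<Phi>' z = frechet_derivative (\<lambda>(t, z). local_rep (W, \<psi>, \<kappa>) (\<Phi> t) z) (at (t, z)) (1, 0)"
  shows "limitin (LF_topology E) (\<lambda>h. (1 / h) *\<^sub>R (\<Phi> (t + h) - \<Phi> t)) \<Phi>' (at 0)"
proof -
  let ?D = "\<lambda>h. (1 / h) *\<^sub>R (\<Phi> (t + h) - \<Phi> t) - \<Phi>'"
  have \<Phi>'s: "\<Phi>' \<in> smooth_sections E" using \<Phi>' by (simp add: sections_in_def)
  have "\<forall>\<^sub>F h in at 0. t + h \<in> S"
  proof -
    obtain r where r: "0 < r" "ball t r \<subseteq> S" using S t openE by blast
    show ?thesis unfolding eventually_at using r by (intro exI[of _ r]) (auto simp: dist_real_def subset_iff)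
  qed
  then have ev: "\<forall>\<^sub>F h in at 0. t + h \<in> S \<and> {p. \<Phi> (t + h) p \<noteq> 0} \<subseteq> K"
    using supp(1) by eventually_elim blast
  have inK: "\<forall>\<^sub>F h in at 0. (1 / h) *\<^sub>R (\<Phi> (t + h) - \<Phi> t) \<in> sections_in E K \<and> ?D h \<in> sections_in E K"
    using ev
  proof eventually_elim
    case (elim h)
    have 1: "(1 / h) *\<^sub>R (\<Phi> (t + h) - \<Phi> t) \<in> smooth_sections E"
      using elim t by (intro subspace_scale subspace_diff subspace_sections \<Phi>) auto
    have 2: "?D h \<in> smooth_sections E" by (rule subspace_diff[OF subspace_sections 1 \<Phi>'s])
    have "\<Phi> (t + h) p = 0" "\<Phi> t p = 0" "\<Phi>' p = 0" if "p \<notin> K" for p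
      using elim supp(2) \<Phi>' that by (auto simp: sections_in_def)
    then have "((1 / h) *\<^sub>R (\<Phi> (t + h) - \<Phi> t)) p = 0" "?D h p = 0" if "p \<notin> K" for p
      using that by (simp_all add: scaleR_fun_def)
    then show ?case using 1 2 unfolding sections_in_def by blast
  qed
  have F0: "limitin (F_topology E) ?D 0 (at 0)"
    unfolding F_topology_def
  proof (rule limitin_lc_topologyI[OF zero_section])
    show "\<forall>\<^sub>F h in at 0. ?D h \<in> smooth_sections E"
      using inK by eventually_elim (auto simp: sections_in_def)
    fix q assume "q \<in> F_seminorms E"
    then obtain W \<psi> \<kappa> L ds where q: "q = F_norm W \<psi> \<kappa> L ds" and k: "(W, \<psi>, \<kappa>) \<in> bcoords E"
      and L: "compact L" "L \<noteq> {}" "L \<subseteq> W"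
      unfolding F_seminorms_def F_norm_def[abs_def] by blast
    define F where "F = (\<lambda>(t, z). local_rep (W, \<psi>, \<kappa>) (\<Phi> t) z)"
    define G where "G = iter_deriv (map (Pair 0) ds) F"
    have O: "open (\<psi> ` W)" by (rule open_image[OF k])
    have SO: "open (S \<times> \<psi> ` W)" by (rule open_Times[OF S O])
    have F: "smooth_on (S \<times> \<psi> ` W) F" unfolding F_def by (rule joint[OF k])
    have G: "smooth_on (S \<times> \<psi> ` W) G" unfolding G_def by (rule smooth_on_iter_deriv[OF F])
    have C: "compact (\<psi> ` L)" "\<psi> ` L \<subseteq> \<psi> ` W"
      using compact_continuous_image[OF continuous_on_subset[OF continuous_chart[OF k] L(3)] L(1)] L(3) by auto
    have Geq: "iter_deriv ds (local_rep (W, \<psi>, \<kappa>) (\<Phi> s)) z = G (s, z)" if "s \<in> S" "z \<in> \<psi> ` W" for s z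
      using iter_deriv_slice[OF O F that, of ds] by (simp add: G_def F_def)
    have G'eq: "iter_deriv ds (local_rep (W, \<psi>, \<kappa>) \<Phi>') z = frechet_derivative G (at (t, z)) (1, 0)" if z: "z \<in> \<psi> ` W" for z
    proof -
      have "iter_deriv ds (local_rep (W, \<psi>, \<kappa>) \<Phi>') z =
          iter_deriv ds (\<lambda>z. frechet_derivative F (at (t, z)) (1, 0)) z"
        by (rule iter_deriv_cong[OF O _ z]) (simp add: deriv[OF k] F_def)
      also have "\<dots> = iter_deriv (map (Pair 0) ds) (\<lambda>w. frechet_derivative F (at w) (1, 0)) (t, z)"
        by (rule iter_deriv_slice[OF O smooth_on_dir[OF F] t z])
      also have "\<dots> = frechet_derivative G (at (t, z)) (1, 0)"
        unfolding G_def by (rule iter_deriv_commute[OF SO F]) (use t z in simp)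
      finally show ?thesis .
    qed
    show "((\<lambda>h. q (?D h - 0)) \<longlongrightarrow> 0) (at 0)"
    proof (rule tendstoI)
      fix e :: real assume e: "0 < e"
      \<comment> \<open>With \<open>e / 2\<close>, because only the weak inequality survives the
        supremum over \<open>L\<close>.\<close>
      have "\<forall>\<^sub>F h in at 0. \<forall>z\<in>\<psi> ` L. \<bar>(1 / h) * (G (t + h, z) - G (t, z)) - frechet_derivative G (at (t, z)) (1, 0)\<bar> \<le> e / 2"
        by (rule difference_quotient_uniform[OF S O G t C]) (use e in simp)
      then show "\<forall>\<^sub>F h in at 0. dist (q (?D h - 0)) 0 < e"
        using ev inK
      proof eventually_elim
        case (elim h)
        have "\<bar>iter_deriv ds (local_rep (W, \<psi>, \<kappa>) (?D h)) (\<psi> p)\<bar> \<le> e / 2" if p: "p \<in> L" for p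
        proof -
          have z: "\<psi> p \<in> \<psi> ` W" using p L by blast
          have th: "t + h \<in> S" using elim by blast
          define s where "s = (1 / h) *\<^sub>R \<Phi> (t + h) + (- (1 / h)) *\<^sub>R \<Phi> t"
          have s: "s \<in> smooth_sections E" unfolding s_def by (rule section_lincomb[OF \<Phi>[OF th] \<Phi>[OF t]])
          have e1: "?D h = 1 *\<^sub>R s + (- 1) *\<^sub>R \<Phi>'"
            by (simp add: s_def scaleR_diff_right)
          have "iter_deriv ds (local_rep (W, \<psi>, \<kappa>) (?D h)) (\<psi> p) =
              (1 / h) * (G (t + h, \<psi> p) - G (t, \<psi> p)) - frechet_derivative G (at (t, \<psi> p)) (1, 0)"
            unfolding e1 iter_deriv_local_rep_lincomb[OF k z s \<Phi>'s] unfolding s_def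
              iter_deriv_local_rep_lincomb[OF k z \<Phi>[OF th] \<Phi>[OF t]] Geq[OF th z] Geq[OF t z] G'eq[OF z]
            by (simp add: algebra_simps)
          then show ?thesis using elim(1) p by simp
        qed
        then have "q (?D h) \<le> e / 2"
          unfolding q F_norm_def using L(2) by (intro cSUP_least) auto
        moreover have "0 \<le> q (?D h)"
          using seminorm_F_norm[OF k L, of ds] elim(3) unfolding q seminorm_on_def sections_in_def by blast
        ultimately show ?case using e by simp
      qed
    qed
  qed
  show ?thesis
    unfolding LF_topology_def
  proof (rule limitin_lc_topologyI)
    show "\<Phi>' \<in> compact_sections E" using \<Phi>' sections_in_compact[OF K] by blast
    show "\<forall>\<^sub>F h in at 0. (1 / h) *\<^sub>R (\<Phi> (t + h) - \<Phi> t) \<in> compact_sections E"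
      using inK by eventually_elim (use sections_in_compact[OF K] in blast)
    \<comment> \<open>The differences eventually lie in \<open>sections_in E K\<close>, and there
      every (LF)-seminorm is continuous for the (F)-topology; thus the (F)-limit \<open>F0\<close>
      is enough.\<close>
    fix \<rho> assume "\<rho> \<in> LF_seminorms E"
    then have \<rho>: "seminorm_on (compact_sections E) \<rho>"
      "continuous_map (subtopology (F_topology E) (sections_in E K)) euclideanreal \<rho>"
      using K unfolding LF_seminorms_def by auto
    have "0 \<in> sections_in E K" using zero_section by (simp add: sections_in_def)
    moreover have "\<forall>\<^sub>F h in at 0. ?D h \<in> sections_in E K" using inK by eventually_elim blast
    ultimately have "limitin (subtopology (F_topology E) (sections_in E K)) ?D 0 (at 0)"
      using F0 by (simp add: limitin_subtopology)
    from continuous_map_limit[OF \<rho>(2) this] have "((\<lambda>h. \<rho> (?D h)) \<longlongrightarrow> \<rho> 0) (at 0)"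
      by (simp add: comp_def)
    moreover have "\<rho> 0 = 0"
    proof -
      have "\<rho> (0 *\<^sub>R 0) = \<bar>0\<bar> * \<rho> 0"
        using \<rho>(1) subspace_0[OF subspace_compact] unfolding seminorm_on_def by blast
      then show ?thesis by simp
    qed
    ultimately show "((\<lambda>h. \<rho> (?D h)) \<longlongrightarrow> 0) (at 0)" by simp
  qed
qed

text \<open>If the supports were not contained in a common compact set, they would meet infinitely many members
  of a locally finite cover; weighted point evaluations there form a continuous seminorm that is
  unbounded along the curve.\<close>

lemma common_compact_support:
  fixes \<V> :: "'b set set"
  assumes cover: "\<Union>\<V> = UNIV" "\<And>V. V \<in> \<V> \<Longrightarrow> \<exists>C. compact C \<and> V \<subseteq> C"
      "\<And>K. compact K \<Longrightarrow> finite {V \<in> \<V>. V \<inter> K \<noteq> {}}"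
    and detect: "\<And>\<sigma> p. \<sigma> \<in> smooth_sections E \<Longrightarrow> \<sigma> p \<noteq> 0 \<Longrightarrow> \<exists>W \<psi> \<kappa>. (W, \<psi>, \<kappa>) \<in> bcoords E \<and> p \<in> W \<and> \<kappa> p (\<sigma> p) \<noteq> 0"
    and c: "c \<in> smooth_curves_lc (LF_topology E)"
  shows "\<exists>K. compact K \<and> (\<forall>t\<in>{a..b}. {p. c t p \<noteq> 0} \<subseteq> K)"
proof -
  obtain d where d0: "d 0 = c" and dT: "\<And>k t. d k t \<in> compact_sections E"
    and dl: "\<And>k t. limitin (LF_topology E) (\<lambda>h. (1 / h) *\<^sub>R (d k (t + h) - d k t)) (d (Suc k) t) (at 0)"
    using c unfolding smooth_curves_lc_def by (auto simp: LF_topology_def topspace_lc_topology)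
  have cC: "c t \<in> compact_sections E" for t using dT[of 0 t] d0 by simp
  note cS = compact_sections_smooth[OF cC]
  define \<W> where "\<W> = {V \<in> \<V>. \<exists>t\<in>{a..b}. \<exists>p\<in>V. c t p \<noteq> 0}"
  have "finite \<W>"
  proof (rule ccontr)
    assume "infinite \<W>"
    then obtain V :: "nat \<Rightarrow> 'b set" where V: "inj V" "range V \<subseteq> \<W>"
      using infinite_countable_subset by blast
    have "\<exists>t p W \<psi> \<kappa>. t \<in> {a..b} \<and> p \<in> V n \<and> (W, \<psi>, \<kappa>) \<in> bcoords E \<and> p \<in> W \<and> \<kappa> p (c t p) \<noteq> 0" for n
    proof -
      obtain t p where "t \<in> {a..b}" "p \<in> V n" "c t p \<noteq> 0" using V(2) unfolding \<W>_def by blast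
      then show ?thesis using detect[OF cS] by meson
    qed
    then obtain t p W \<psi> \<kappa> where t: "\<And>n. t n \<in> {a..b}" and p: "\<And>n. p n \<in> V n"
      and k: "\<And>n. (W n, \<psi> n, \<kappa> n) \<in> bcoords E" and pW: "\<And>n. p n \<in> W n"
      and nz: "\<And>n. \<kappa> n (p n) (c (t n) (p n)) \<noteq> 0"
      by metis
    \<comment> \<open>The sets \<open>V n\<close> are distinct members of the cover with
      \<open>p n \<in> V n\<close>, and only finitely many members meet \<open>K\<close>.\<close>
    have fin: "finite {n. p n \<in> K}" if K: "compact K" for K
    proof -
      have "V ` {n. p n \<in> K} \<subseteq> {V \<in> \<V>. V \<inter> K \<noteq> {}}"
        using V(2) p unfolding \<W>_def by blast
      then have "finite (V ` {n. p n \<in> K})" using cover(3)[OF K] finite_subset by blast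
      then show ?thesis using V(1) by (metis finite_imageD inj_on_subset subset_UNIV)
    qed
    \<comment> \<open>The weight is chosen so that the \<open>n\<close>-th term of the seminorm
      takes the value \<open>n\<close> at \<open>c (t n)\<close>. This forces the seminorm to be
      unbounded along the curve.\<close>
    define w where "w n = real n / \<bar>\<kappa> n (p n) (c (t n) (p n))\<bar>" for n
    define u where "u \<sigma> n = w n * \<bar>\<kappa> n (p n) (\<sigma> (p n))\<bar>" for \<sigma> :: "'b \<Rightarrow> 'f" and n
    define \<rho> where "\<rho> \<sigma> = (\<Sum>n | \<sigma> (p n) \<noteq> 0. u \<sigma> n)" for \<sigma> :: "'b \<Rightarrow> 'f"
    have u0: "0 \<le> u \<sigma> n" for \<sigma> n by (simp add: u_def w_def)
    \<comment> \<open>Additional indices contribute zero terms, so two sections can be compared over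
      one finite index set.\<close>
    have \<rho>N: "\<rho> \<sigma> = (\<Sum>n\<in>N. u \<sigma> n)" if "finite N" "{n. \<sigma> (p n) \<noteq> 0} \<subseteq> N" for \<sigma> N
      unfolding \<rho>_def
      by (rule sum.mono_neutral_left[OF that]) (auto simp: u_def coord_zero[OF k pW])
    have finS: "finite {n. \<sigma> (p n) \<noteq> 0}" if "\<sigma> \<in> compact_sections E" for \<sigma>
    proof (rule finite_subset)
      show "finite {n. p n \<in> closure {p. \<sigma> p \<noteq> 0}}"
        by (rule fin) (use that in \<open>simp add: compact_sections_def\<close>)
      show "{n. \<sigma> (p n) \<noteq> 0} \<subseteq> {n. p n \<in> closure {p. \<sigma> p \<noteq> 0}}"
        using closure_subset[of "{p. \<sigma> p \<noteq> 0}"] by blast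
    qed
    have u_scale: "u (x *\<^sub>R \<sigma>) n = \<bar>x\<bar> * u \<sigma> n" if "\<sigma> \<in> compact_sections E" for x \<sigma> n
    proof -
      have f: "\<sigma> (p n) \<in> fibre E (p n)" by (rule section_fibre[OF compact_sections_smooth[OF that]])
      show ?thesis using coord_lincomb[OF k pW, of \<sigma> n \<sigma> x 0, OF f f] by (simp add: u_def abs_mult)
    qed
    have u_add: "u (\<sigma> + \<tau>) n \<le> u \<sigma> n + u \<tau> n" if "\<sigma> \<in> compact_sections E" "\<tau> \<in> compact_sections E" for \<sigma> \<tau> n
    proof -
      have f: "\<sigma> (p n) \<in> fibre E (p n)" "\<tau> (p n) \<in> fibre E (p n)"
        using section_fibre[OF compact_sections_smooth] that by auto
      have "0 \<le> w n" by (simp add: w_def)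
      then show ?thesis using coord_lincomb[OF k pW, of \<sigma> n \<tau> 1 1, OF f]
        by (simp add: u_def mult_left_mono distrib_left[symmetric])
    qed
    have \<rho>_scale: "\<rho> (x *\<^sub>R \<sigma>) = \<bar>x\<bar> * \<rho> \<sigma>" if s: "\<sigma> \<in> compact_sections E" for x \<sigma>
    proof -
      have "{n. (x *\<^sub>R \<sigma>) (p n) \<noteq> 0} \<subseteq> {n. \<sigma> (p n) \<noteq> 0}" by (auto simp: scaleR_fun_def)
      from \<rho>N[OF finS[OF s] this] \<rho>N[OF finS[OF s] subset_refl] show ?thesis
        unfolding u_scale[OF s] by (simp add: sum_distrib_left)
    qed
    have \<rho>_add: "\<rho> (\<sigma> + \<tau>) \<le> \<rho> \<sigma> + \<rho> \<tau>" if s: "\<sigma> \<in> compact_sections E" "\<tau> \<in> compact_sections E" for \<sigma> \<tau>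
    proof -
      let ?N = "{n. \<sigma> (p n) \<noteq> 0} \<union> {n. \<tau> (p n) \<noteq> 0}"
      have N: "finite ?N" using finS s by blast
      have "\<rho> (\<sigma> + \<tau>) = (\<Sum>n\<in>?N. u (\<sigma> + \<tau>) n)" by (rule \<rho>N[OF N]) auto
      also have "\<dots> \<le> (\<Sum>n\<in>?N. u \<sigma> n + u \<tau> n)" by (rule sum_mono) (rule u_add[OF s])
      also have "\<dots> = \<rho> \<sigma> + \<rho> \<tau>" using \<rho>N[OF N, of \<sigma>] \<rho>N[OF N, of \<tau>] by (simp add: sum.distrib)
      finally show ?thesis .
    qed
    have \<rho>_nonneg: "0 \<le> \<rho> \<sigma>" for \<sigma> unfolding \<rho>_def by (rule sum_nonneg) (rule u0)
    have "\<rho> \<in> LF_seminorms E"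
      unfolding LF_seminorms_def
    proof (intro CollectI conjI allI impI)
      show "seminorm_on (compact_sections E) \<rho>"
        unfolding seminorm_on_def using \<rho>_nonneg \<rho>_scale \<rho>_add by blast
      fix K :: "'b set" assume K: "compact K"
      \<comment> \<open>For sections supported in \<open>K\<close> only the finitely many
        \<open>n\<close> with \<open>p n \<in> K\<close> count, and each term is a multiple of the
        (F)-seminorm of order zero over the one-point set \<open>{p n}\<close>.\<close>
      let ?N = "{n. p n \<in> K}"
      have "continuous_map (subtopology (F_topology E) (sections_in E K)) euclideanreal
          (\<lambda>\<sigma>. \<Sum>n\<in>?N. w n * F_norm (W n) (\<psi> n) (\<kappa> n) {p n} [] \<sigma>)"
        using k pW
        by (intro continuous_map_sum[OF fin[OF K]] continuous_map_real_mult_left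
            continuous_map_from_subtopology continuous_F_norm) auto
      then show "continuous_map (subtopology (F_topology E) (sections_in E K)) euclideanreal \<rho>"
      proof (rule continuous_map_eq)
        fix \<sigma> assume "\<sigma> \<in> topspace (subtopology (F_topology E) (sections_in E K))"
        then have "{n. \<sigma> (p n) \<noteq> 0} \<subseteq> ?N"
          by (auto simp: sections_in_def)
        from \<rho>N[OF fin[OF K] this] show "(\<Sum>n\<in>?N. w n * F_norm (W n) (\<psi> n) (\<kappa> n) {p n} [] \<sigma>) = \<rho> \<sigma>"
          by (simp add: u_def F_norm_def local_rep_def inv_chart(2)[OF k pW])
      qed
    qed
    note \<rho>L = this
    \<comment> \<open>Continuity of the seminorm along the curve is obtained from differentiability:
      \<open>c (s + h)\<close> differs from \<open>c s\<close> by \<open>h\<close> times the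
      difference quotient, whose seminorm stays bounded near \<open>0\<close>.\<close>
    have "isCont (\<lambda>t. \<rho> (c t)) s" for s
      unfolding isCont_iff
    proof -
      let ?q = "\<lambda>h. (1 / h) *\<^sub>R (c (s + h) - c s)"
      have q: "?q h \<in> compact_sections E" for h
        by (intro subspace_scale subspace_diff subspace_compact cC)
      have "((\<lambda>h. \<rho> (?q h - d 1 s)) \<longlongrightarrow> 0) (at 0)"
        by (rule LF_limit_seminorm[OF \<rho>L]) (use q dl[of 0 s] d0 in auto)
      then have lim: "((\<lambda>h. \<bar>h\<bar> * (\<rho> (?q h - d 1 s) + \<rho> (d 1 s))) \<longlongrightarrow> \<bar>0\<bar> * (0 + \<rho> (d 1 s))) (at 0)"
        by (intro tendsto_intros)
      have "\<bar>\<rho> (c (s + h)) - \<rho> (c s)\<bar> \<le> \<bar>h\<bar> * (\<rho> (?q h - d 1 s) + \<rho> (d 1 s))" if h: "h \<noteq> 0" for h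
      proof -
        have 1: "c (s + h) = c s + h *\<^sub>R ?q h" using h by simp
        have 2: "c s = c (s + h) + (- h) *\<^sub>R ?q h" using h by simp
        have sc: "x *\<^sub>R ?q h \<in> compact_sections E" for x by (rule subspace_scale[OF subspace_compact q])
        have "\<rho> (c (s + h)) \<le> \<rho> (c s) + \<bar>h\<bar> * \<rho> (?q h)"
          using \<rho>_add[OF cC[of s] sc[of h]] unfolding 1[symmetric] \<rho>_scale[OF q] .
        moreover have "\<rho> (c s) \<le> \<rho> (c (s + h)) + \<bar>h\<bar> * \<rho> (?q h)"
          using \<rho>_add[OF cC[of "s + h"] sc[of "- h"]] unfolding 2[symmetric] \<rho>_scale[OF q] abs_minus_cancel .
        moreover have "\<bar>h\<bar> * \<rho> (?q h) \<le> \<bar>h\<bar> * (\<rho> (?q h - d 1 s) + \<rho> (d 1 s))"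
          using \<rho>_add[OF subspace_diff[OF subspace_compact q dT] dT, of h 1 s 1 s]
          by (intro mult_left_mono) simp_all
        ultimately show ?thesis by linarith
      qed
      then have "\<forall>\<^sub>F h in at 0. norm (\<rho> (c (s + h)) - \<rho> (c s)) \<le> \<bar>h\<bar> * (\<rho> (?q h - d 1 s) + \<rho> (d 1 s))"
        unfolding eventually_at_filter real_norm_def by (intro always_eventually) blast
      then have "((\<lambda>h. \<rho> (c (s + h)) - \<rho> (c s)) \<longlongrightarrow> 0) (at 0)"
        by (rule Lim_null_comparison) (use lim in simp)
      then show "((\<lambda>h. \<rho> (c (s + h))) \<longlongrightarrow> \<rho> (c s)) (at 0)" by (rule LIM_zero_cancel)
    qed
    then have "continuous_on {a..b} (\<lambda>t. \<rho> (c t))"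
      by (simp add: continuous_at_imp_continuous_on)
    then have "bounded ((\<lambda>t. \<rho> (c t)) ` {a..b})"
      by (intro compact_imp_bounded compact_continuous_image) auto
    then obtain B where "\<forall>t\<in>{a..b}. \<bar>\<rho> (c t)\<bar> \<le> B" unfolding bounded_iff by auto
    then have B: "\<rho> (c t) \<le> B" if "t \<in> {a..b}" for t using that abs_le_D1 by blast
    have "real n \<le> B" for n
    proof -
      have "\<sigma> = 0 \<Longrightarrow> \<kappa> n (p n) \<sigma> = 0" for \<sigma> using coord_zero[OF k pW] by simp
      then have "n \<in> {m. c (t n) (p m) \<noteq> 0}" using nz by blast
      then have "u (c (t n)) n \<le> \<rho> (c (t n))"
        unfolding \<rho>_def by (intro member_le_sum) (use u0 finS[OF cC] in auto)
      moreover have "u (c (t n)) n = real n" using nz by (simp add: u_def w_def)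
      ultimately show ?thesis using B[OF t[of n]] by simp
    qed
    then show False using reals_Archimedean2 not_less by blast
  qed
  moreover obtain C where C: "\<And>V. V \<in> \<V> \<Longrightarrow> compact (C V) \<and> V \<subseteq> C V" using cover(2) by metis
  ultimately have "compact (\<Union> (C ` \<W>))" by (intro compact_Union) (auto simp: \<W>_def)
  moreover have "{p. c t p \<noteq> 0} \<subseteq> \<Union> (C ` \<W>)" if "t \<in> {a..b}" for t
  proof
    fix q assume q: "q \<in> {p. c t p \<noteq> 0}"
    obtain V where V: "V \<in> \<V>" "q \<in> V" using cover(1) UNIV_I[of q] by (metis UnionE)
    then have "V \<in> \<W>" using q that unfolding \<W>_def by blast
    then show "q \<in> \<Union> (C ` \<W>)" using C[OF V(1)] V(2) by blast
  qed
  ultimately show ?thesis by blast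
qed

end

section \<open>Manifolds and tensors at a point\<close>

lemma locally_finite_compact:
  assumes lf: "locally_finite_in euclidean \<V>" and K: "compact K"
  shows "finite {V \<in> \<V>. V \<inter> K \<noteq> {}}"
proof -
  have "\<exists>U. open U \<and> x \<in> U \<and> finite {V \<in> \<V>. V \<inter> U \<noteq> {}}" for x
    using lf unfolding locally_finite_in_def by auto
  from choice[OF allI[OF this]] obtain U
    where U: "\<forall>x. open (U x) \<and> x \<in> U x \<and> finite {V \<in> \<V>. V \<inter> U x \<noteq> {}}" ..
  have UO: "open (U x)" and Ux: "x \<in> U x" and Uf: "finite {V \<in> \<V>. V \<inter> U x \<noteq> {}}" for x
    using spec[OF U, of x] by blast+
  obtain D where D: "D \<subseteq> UNIV" "finite D" "K \<subseteq> (\<Union>x\<in>D. U x)"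
  proof (rule compactE_image[OF K, of UNIV U, OF UO])
    show "K \<subseteq> (\<Union>x. U x)" using Ux by fast
  qed
  have "{V \<in> \<V>. V \<inter> K \<noteq> {}} \<subseteq> (\<Union>x\<in>D. {V \<in> \<V>. V \<inter> U x \<noteq> {}})" using D(3) by blast
  then show ?thesis by (rule finite_subset) (intro finite_UN_I D(2) Uf)
qed

lemma sum_fun_apply: "(\<Sum>i\<in>I. f i) y = (\<Sum>i\<in>I. f i y)"
  by (induction I rule: infinite_finite_induct) auto

lemma linear_on_subspace_sum:
  assumes V: "subspace V" and f: "linear_on_subspace V f" and b: "\<And>i. i \<in> I \<Longrightarrow> b i \<in> V"
  shows "f (\<Sum>i\<in>I. a i *\<^sub>R b i) = (\<Sum>i\<in>I. a i *\<^sub>R f (b i))"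
proof -
  have lin: "f (a *\<^sub>R x + b *\<^sub>R y) = a *\<^sub>R f x + b *\<^sub>R f y" if "x \<in> V" "y \<in> V" for a b x y
    using f that unfolding linear_on_subspace_def by blast
  have f0: "f 0 = 0" using lin[of 0 0 0 0] subspace_0[OF V] by simp
  show ?thesis
    using b
  proof (induction I rule: infinite_finite_induct)
    case (insert i I)
    have "(\<Sum>i\<in>I. a i *\<^sub>R b i) \<in> V" using insert V by (intro subspace_sum subspace_scale) auto
    then show ?case using insert lin[of "b i" "\<Sum>i\<in>I. a i *\<^sub>R b i" "a i" 1] by simp
  qed (auto simp: f0)
qed

locale manifold =
  fixes M :: "('m::t2_space, 'a::real_inner) mfd"
  assumes oriented: "oriented_manifold M"
begin

lemma paracompact: "paracompact_space TYPE('m)"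
  and frame_orthonormal: "i < mdim M \<Longrightarrow> j < mdim M \<Longrightarrow> frame M i \<bullet> frame M j = (if i = j then 1 else 0)"
  and frame_expand: "w = (\<Sum>i<mdim M. (w \<bullet> frame M i) *\<^sub>R frame M i)"
  and atlas_cover: "(\<Union>x\<in>atlas M. fst x) = UNIV"
  and open_domain: "x \<in> atlas M \<Longrightarrow> open (fst x)"
  and open_range: "x \<in> atlas M \<Longrightarrow> open (snd x ` fst x)"
  and chart_homeo: "x \<in> atlas M \<Longrightarrow> homeomorphism (fst x) (snd x ` fst x) (snd x) (chart_inv x)"
  and transition_smooth: "x \<in> atlas M \<Longrightarrow> y \<in> atlas M \<Longrightarrow>
    smooth_on (snd x ` (fst x \<inter> fst y)) (\<lambda>z. snd y (chart_inv x z))"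
  using oriented unfolding oriented_manifold_def by blast+

lemma chart_inv_chart: "x \<in> atlas M \<Longrightarrow> p \<in> fst x \<Longrightarrow> chart_inv x (snd x p) = p"
  and chart_chart_inv: "x \<in> atlas M \<Longrightarrow> z \<in> snd x ` fst x \<Longrightarrow> snd x (chart_inv x z) = z"
  and chart_inv_in: "x \<in> atlas M \<Longrightarrow> z \<in> snd x ` fst x \<Longrightarrow> chart_inv x z \<in> fst x"
  and continuous_chart: "x \<in> atlas M \<Longrightarrow> continuous_on (fst x) (snd x)"
  and continuous_chart_inv: "x \<in> atlas M \<Longrightarrow> continuous_on (snd x ` fst x) (chart_inv x)"
  using chart_homeo[of x] unfolding homeomorphism_def by auto

lemma inj_chart: "x \<in> atlas M \<Longrightarrow> inj_on (snd x) (fst x)"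
  by (metis chart_inv_chart inj_on_inverseI)

lemma charts_at_iff: "x \<in> charts_at M p \<longleftrightarrow> x \<in> atlas M \<and> p \<in> fst x"
  by (simp add: charts_at_def)

lemma charts_at_nonempty: "\<exists>x. x \<in> charts_at M p"
  using atlas_cover charts_at_iff by blast

definition model_coords :: "('a \<times> ('a \<Rightarrow> real)) list" where
  "model_coords = map (\<lambda>i. (frame M i, \<lambda>w. w \<bullet> frame M i)) [0..<mdim M]"

lemma coord_system_model: "coord_system model_coords"
proof -
  have "w = (\<Sum>(b, \<phi>)\<leftarrow>model_coords. \<phi> w *\<^sub>R b)" for w
    using frame_expand[of w]
    by (simp add: model_coords_def comp_def interv_sum_list_conv_sum_set_nat atLeast0LessThan)
  then show ?thesis
    unfolding coord_system_def by (auto simp: model_coords_def bounded_linear_inner_left)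
qed

lemma compact_cball_model: "compact (cball (z::'a) e)"
  by (rule compact_cball_coord[OF coord_system_model])

text \<open>Preimages of coordinate balls show that the open sets contained in a compact set cover
  the manifold. A locally finite refinement exists by paracompactness, and its members inherit the
  compact supersets.\<close>

lemma locally_finite_relatively_compact_cover:
  "\<exists>\<V> :: 'm set set. \<Union>\<V> = UNIV \<and> (\<forall>V\<in>\<V>. \<exists>C. compact C \<and> V \<subseteq> C) \<and>
    (\<forall>K. compact K \<longrightarrow> finite {V \<in> \<V>. V \<inter> K \<noteq> {}})"
proof -
  let ?U = "{U::'m set. open U \<and> (\<exists>C. compact C \<and> U \<subseteq> C)}"
  have "\<exists>U\<in>?U. p \<in> U" for p
  proof -
    obtain x where x: "x \<in> atlas M" "p \<in> fst x" using atlas_cover by blast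
    obtain r where r: "0 < r" "cball (snd x p) r \<subseteq> snd x ` fst x"
      using open_range[OF x(1)] x(2) open_contains_cball by blast
    let ?V = "fst x \<inter> snd x -` ball (snd x p) r"
    have 1: "compact (chart_inv x ` cball (snd x p) r)"
      by (rule compact_continuous_image[OF continuous_on_subset[OF continuous_chart_inv[OF x(1)] r(2)] compact_cball_model])
    have 2: "open ?V"
      by (rule continuous_open_preimage[OF continuous_chart[OF x(1)] open_domain[OF x(1)] open_ball])
    have 3: "?V \<subseteq> chart_inv x ` cball (snd x p) r"
    proof
      fix q assume "q \<in> ?V"
      then show "q \<in> chart_inv x ` cball (snd x p) r"
        using chart_inv_chart[OF x(1), of q] by (intro image_eqI[of _ _ "snd x q"]) auto
    qed
    have "?V \<in> ?U" using 1 2 3 by blast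
    moreover have "p \<in> ?V" using x r by simp
    ultimately show ?thesis by (rule bexI[rotated])
  qed
  then have U: "(\<forall>U\<in>?U. open U) \<and> \<Union>?U = UNIV" by blast
  obtain \<V> where \<V>: "\<forall>V\<in>\<V>. open V \<and> (\<exists>U\<in>?U. V \<subseteq> U)" "\<Union>\<V> = UNIV" "locally_finite_in euclidean \<V>"
    using paracompact[unfolded paracompact_space_def, rule_format, OF U] by blast
  show ?thesis
  proof (intro exI[of _ \<V>] conjI ballI allI impI)
    fix V assume V: "V \<in> \<V>"
    have "\<exists>U\<in>?U. V \<subseteq> U" using bspec[OF \<V>(1) V] by (rule conjunct2)
    then show "\<exists>C. compact C \<and> V \<subseteq> C" by blast
  qed (rule \<V>(2), rule locally_finite_compact[OF \<V>(3)])
qed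

end

section \<open>Multilinear maps on a subspace\<close>

lemma linear_on_subspaceD:
  "linear_on_subspace V f \<Longrightarrow> x \<in> V \<Longrightarrow> y \<in> V \<Longrightarrow> f (a *\<^sub>R x + b *\<^sub>R y) = a *\<^sub>R f x + b *\<^sub>R f y"
  unfolding linear_on_subspace_def by blast

lemma subspaceI_lincomb:
  assumes "0 \<in> V" "\<And>x y a b. x \<in> V \<Longrightarrow> y \<in> V \<Longrightarrow> a *\<^sub>R x + b *\<^sub>R y \<in> V"
  shows "subspace V"
  unfolding subspace_def
proof (intro conjI ballI allI)
  fix x y c assume "x \<in> V" "y \<in> V"
  from assms(2)[OF this, of 1 1] assms(2)[OF this, of c 0] show "x + y \<in> V" "c *\<^sub>R x \<in> V" by auto
qed (rule assms(1))

lemma subspace_lincomb: "subspace V \<Longrightarrow> x \<in> V \<Longrightarrow> y \<in> V \<Longrightarrow> a *\<^sub>R x + b *\<^sub>R y \<in> V"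
  by (intro subspace_add subspace_scale)

lemma lists_Suc_eq_image:
  "{J. length J = Suc n \<and> set J \<subseteq> A} = (\<lambda>(i, J). i # J) ` (A \<times> {J. length J = n \<and> set J \<subseteq> A})"
  by (auto simp: length_Suc_conv image_iff)

text \<open>The first argument is expanded in the basis, and the induction hypothesis expands the
  others with the first one fixed. Subspace and basis are kept general, to serve covector and vector
  arguments of a tensor in turn.\<close>

lemma multilinear_expand:
  fixes f :: "'v::real_vector list \<Rightarrow> real" and m n :: nat
  assumes V: "subspace V" and b: "\<And>i. i < m \<Longrightarrow> b i \<in> V"
    and expand: "\<And>w. w \<in> V \<Longrightarrow> w = (\<Sum>i<m. \<phi> i w *\<^sub>R b i)"
    and f: "\<And>ws j. length ws = n \<Longrightarrow> set ws \<subseteq> V \<Longrightarrow> j < n \<Longrightarrow> linear_on_subspace V (\<lambda>w. f (ws[j := w]))"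
    and ws: "length ws = n" "set ws \<subseteq> V"
  shows "f ws = (\<Sum>J | length J = n \<and> set J \<subseteq> {..<m}. f (map b J) * (\<Prod>l<n. \<phi> (J ! l) (ws ! l)))"
  using f ws
proof (induction n arbitrary: f ws)
  case 0
  have "{J. length J = 0 \<and> set J \<subseteq> {..<m}} = {[]}" by auto
  then show ?case using 0 by simp
next
  case (Suc n)
  obtain u us where ws: "ws = u # us" using Suc.prems(2) by (cases ws) auto
  have u: "u \<in> V" and us: "length us = n" "set us \<subseteq> V" using Suc.prems ws by auto
  have IH: "f (w # us) = (\<Sum>J | length J = n \<and> set J \<subseteq> {..<m}. f (w # map b J) * (\<Prod>l<n. \<phi> (J ! l) (us ! l)))"
    if w: "w \<in> V" for w
  proof (rule Suc.IH[OF _ us])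
    fix xs j assume xs: "length xs = n" "set xs \<subseteq> V" "j < n"
    then show "linear_on_subspace V (\<lambda>x. f (w # xs[j := x]))"
      using Suc.prems(1)[of "w # xs" "Suc j"] w by simp
  qed
  have "linear_on_subspace V (\<lambda>w. f (ws[0 := w]))" using Suc.prems by simp
  then have lin: "linear_on_subspace V (\<lambda>w. f (w # us))" by (simp add: ws)
  have "f ws = f ((\<Sum>i<m. \<phi> i u *\<^sub>R b i) # us)" using expand[OF u] ws by simp
  also have "\<dots> = (\<Sum>i<m. \<phi> i u * f (b i # us))"
    using linear_on_subspace_sum[OF V lin, of "{..<m}" b "\<lambda>i. \<phi> i u"] b by simp
  also have "\<dots> = (\<Sum>i<m. \<Sum>J | length J = n \<and> set J \<subseteq> {..<m}.
      f (b i # map b J) * (\<phi> i u * (\<Prod>l<n. \<phi> (J ! l) (us ! l))))"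
    using IH[OF b] by (intro sum.cong) (auto simp: sum_distrib_left algebra_simps)
  also have "\<dots> = (\<Sum>(i, J)\<in>{..<m} \<times> {J. length J = n \<and> set J \<subseteq> {..<m}}.
      f (map b (i # J)) * (\<Prod>l<Suc n. \<phi> ((i # J) ! l) (ws ! l)))"
    by (simp add: sum.cartesian_product ws prod.lessThan_Suc_shift del: prod.lessThan_Suc)
  also have "\<dots> = (\<Sum>J | length J = Suc n \<and> set J \<subseteq> {..<m}. f (map b J) * (\<Prod>l<Suc n. \<phi> (J ! l) (ws ! l)))"
    unfolding lists_Suc_eq_image by (subst sum.reindex) (auto simp: inj_on_def case_prod_unfold)
  finally show ?case .
qed

lemma prod_list_update:
  fixes g :: "nat \<Rightarrow> 'x \<Rightarrow> real"
  assumes "i < n" "length xs = n"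
  shows "(\<Prod>k<n. g k (xs[i := x] ! k)) = g i x * (\<Prod>k\<in>{..<n} - {i}. g k (xs ! k))"
proof -
  have "(\<Prod>k<n. g k (xs[i := x] ! k)) = g i (xs[i := x] ! i) * (\<Prod>k\<in>{..<n} - {i}. g k (xs[i := x] ! k))"
    by (rule prod.remove) (use assms in auto)
  also have "(\<Prod>k\<in>{..<n} - {i}. g k (xs[i := x] ! k)) = (\<Prod>k\<in>{..<n} - {i}. g k (xs ! k))"
    by (rule prod.cong) auto
  finally show ?thesis using assms by simp
qed

context manifold
begin

section \<open>Tangent and cotangent spaces with their coordinate bases\<close>

lemma open_overlap:
  assumes x: "x \<in> atlas M" and y: "y \<in> atlas M"
  shows "open (snd x ` (fst x \<inter> fst y))"
proof -
  have "snd x ` (fst x \<inter> fst y) = snd x ` fst x \<inter> chart_inv x -` fst y"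
    using chart_inv_chart[OF x] chart_chart_inv[OF x] chart_inv_in[OF x] by force
  then show ?thesis
    using continuous_open_preimage[OF continuous_chart_inv[OF x] open_range[OF x] open_domain[OF y]] by simp
qed

lemma transition_has_derivative:
  assumes x: "x \<in> charts_at M p" and y: "y \<in> charts_at M p"
  shows "((\<lambda>z. snd y (chart_inv x z)) has_derivative transition_deriv x y p) (at (snd x p))"
  using smooth_on_has_derivative[OF transition_smooth] assms
  unfolding transition_deriv_def charts_at_iff by blast

lemma linear_transition:
  "x \<in> charts_at M p \<Longrightarrow> y \<in> charts_at M p \<Longrightarrow> linear (transition_deriv x y p)"
  by (rule has_derivative_linear[OF transition_has_derivative])

lemma transition_refl:
  assumes x: "x \<in> charts_at M p"
  shows "transition_deriv x x p w = w"
proof -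
  have xa: "x \<in> atlas M" "p \<in> fst x" using x by (auto simp: charts_at_iff)
  have "((\<lambda>z. snd x (chart_inv x z)) has_derivative (\<lambda>w. w)) (at (snd x p))"
    by (rule has_derivative_transform_within_open[OF has_derivative_ident open_range[OF xa(1)]])
      (use xa chart_chart_inv in auto)
  then show ?thesis
    unfolding transition_deriv_def by (rule frechet_derivative_eqI)
qed

text \<open>The chain rule, where the composition agrees with the direct transition map on the
  overlap of \<open>x\<close> and \<open>y\<close>. This cocycle rule makes \<open>coord_vec\<close>
  a tangent vector.\<close>

lemma transition_trans:
  assumes x: "x \<in> charts_at M p" and y: "y \<in> charts_at M p" and z: "z \<in> charts_at M p"
  shows "transition_deriv y z p (transition_deriv x y p w) = transition_deriv x z p w"
proof -
  have a: "x \<in> atlas M" "y \<in> atlas M" "z \<in> atlas M" and p: "p \<in> fst x" "p \<in> fst y"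
    using assms by (auto simp: charts_at_iff)
  have 1: "(\<lambda>w. snd y (chart_inv x w)) (snd x p) = snd y p" using chart_inv_chart[OF a(1) p(1)] by simp
  have "((\<lambda>w. snd z (chart_inv y (snd y (chart_inv x w)))) has_derivative
      (\<lambda>w. transition_deriv y z p (transition_deriv x y p w))) (at (snd x p))"
    using has_derivative_compose[OF transition_has_derivative[OF x y], of "\<lambda>w. snd z (chart_inv y w)" "transition_deriv y z p"]
      transition_has_derivative[OF y z] 1 by simp
  then have "((\<lambda>w. snd z (chart_inv x w)) has_derivative
      (\<lambda>w. transition_deriv y z p (transition_deriv x y p w))) (at (snd x p))"
  proof (rule has_derivative_transform_within_open[OF _ open_overlap[OF a(1,2)]])
    show "snd x p \<in> snd x ` (fst x \<inter> fst y)" using p by blast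
    fix w assume "w \<in> snd x ` (fst x \<inter> fst y)"
    then obtain q where "w = snd x q" "q \<in> fst x" "q \<in> fst y" by blast
    then show "snd z (chart_inv y (snd y (chart_inv x w))) = snd z (chart_inv x w)"
      by (simp add: chart_inv_chart[OF a(1)] chart_inv_chart[OF a(2)])
  qed
  then show ?thesis unfolding transition_deriv_def[of x z] by (rule frechet_derivative_eqI[symmetric])
qed

lemma subspace_tangent: "subspace (tangent_space M p)"
proof (rule subspaceI_lincomb)
  show "0 \<in> tangent_space M p"
    unfolding tangent_space_def using linear_0[OF linear_transition] by auto
  fix \<xi> \<eta> a b assume *: "\<xi> \<in> tangent_space M p" "\<eta> \<in> tangent_space M p"
  show "a *\<^sub>R \<xi> + b *\<^sub>R \<eta> \<in> tangent_space M p"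
    unfolding tangent_space_def
  proof (intro CollectI conjI allI impI ballI)
    fix x assume "x \<notin> charts_at M p"
    then have "\<xi> x = 0" "\<eta> x = 0" using * unfolding tangent_space_def by blast+
    then show "(a *\<^sub>R \<xi> + b *\<^sub>R \<eta>) x = 0" by (simp add: scaleR_fun_def)
  next
    fix x y assume xy: "x \<in> charts_at M p" "y \<in> charts_at M p"
    then have "\<xi> y = transition_deriv x y p (\<xi> x)" "\<eta> y = transition_deriv x y p (\<eta> x)"
      using * unfolding tangent_space_def by blast+
    then show "(a *\<^sub>R \<xi> + b *\<^sub>R \<eta>) y = transition_deriv x y p ((a *\<^sub>R \<xi> + b *\<^sub>R \<eta>) x)"
      using linear_transition[OF xy] by (simp add: scaleR_fun_def linear_add linear_scale)
  qed
qed

lemma subspace_cotangent: "subspace (cotangent_space M p)"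
proof (rule subspaceI_lincomb)
  show "0 \<in> cotangent_space M p"
    unfolding cotangent_space_def linear_on_subspace_def by simp
  fix \<alpha> \<beta> a b assume "\<alpha> \<in> cotangent_space M p" "\<beta> \<in> cotangent_space M p"
  then show "a *\<^sub>R \<alpha> + b *\<^sub>R \<beta> \<in> cotangent_space M p"
    unfolding cotangent_space_def linear_on_subspace_def
    by (simp add: scaleR_fun_def algebra_simps)
qed

lemma coord_vec_tangent: "x \<in> charts_at M p \<Longrightarrow> coord_vec M x p i \<in> tangent_space M p"
  unfolding tangent_space_def coord_vec_def by (auto simp: transition_trans)

lemma tangent_expand:
  assumes x: "x \<in> charts_at M p" and \<xi>: "\<xi> \<in> tangent_space M p"
  shows "\<xi> = (\<Sum>i<mdim M. coord_covec M x p i \<xi> *\<^sub>R coord_vec M x p i)"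
proof
  fix y
  show "\<xi> y = (\<Sum>i<mdim M. coord_covec M x p i \<xi> *\<^sub>R coord_vec M x p i) y"
  proof (cases "y \<in> charts_at M p")
    case True
    have "\<xi> y = transition_deriv x y p (\<xi> x)"
      using \<xi> x True unfolding tangent_space_def by blast
    also have "\<dots> = transition_deriv x y p (\<Sum>i<mdim M. (\<xi> x \<bullet> frame M i) *\<^sub>R frame M i)"
      using frame_expand[of "\<xi> x"] by simp
    also have "\<dots> = (\<Sum>i<mdim M. (\<xi> x \<bullet> frame M i) *\<^sub>R transition_deriv x y p (frame M i))"
      using linear_transition[OF x True] by (simp add: linear_sum linear_scale)
    finally show ?thesis
      using True \<xi> by (simp add: sum_fun_apply scaleR_fun_def coord_vec_def coord_covec_def)
  next
    case False
    then have "\<xi> y = 0" using \<xi> unfolding tangent_space_def by blast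
    then show ?thesis
      using False by (simp add: sum_fun_apply scaleR_fun_def coord_vec_def)
  qed
qed

lemma coord_covec_cotangent: "coord_covec M x p i \<in> cotangent_space M p"
  unfolding cotangent_space_def linear_on_subspace_def coord_covec_def
  using subspace_lincomb[OF subspace_tangent]
  by (auto simp: scaleR_fun_def inner_add_left)

lemma coord_covec_vec:
  assumes "x \<in> charts_at M p" "i < mdim M" "j < mdim M"
  shows "coord_covec M x p i (coord_vec M x p j) = (if i = j then 1 else 0)"
  using assms coord_vec_tangent[OF assms(1)] frame_orthonormal[of j i]
  by (simp add: coord_covec_def coord_vec_def transition_refl)

lemma cotangent_linear:
  "\<alpha> \<in> cotangent_space M p \<Longrightarrow> linear_on_subspace (tangent_space M p) \<alpha>"
  by (simp add: cotangent_space_def)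

lemma cotangent_expand:
  assumes x: "x \<in> charts_at M p" and \<alpha>: "\<alpha> \<in> cotangent_space M p"
  shows "\<alpha> = (\<Sum>i<mdim M. \<alpha> (coord_vec M x p i) *\<^sub>R coord_covec M x p i)"
proof
  fix \<xi>
  show "\<alpha> \<xi> = (\<Sum>i<mdim M. \<alpha> (coord_vec M x p i) *\<^sub>R coord_covec M x p i) \<xi>"
  proof (cases "\<xi> \<in> tangent_space M p")
    case True
    have "\<alpha> \<xi> = \<alpha> (\<Sum>i<mdim M. coord_covec M x p i \<xi> *\<^sub>R coord_vec M x p i)"
      using tangent_expand[OF x True] by simp
    also have "\<dots> = (\<Sum>i<mdim M. coord_covec M x p i \<xi> *\<^sub>R \<alpha> (coord_vec M x p i))"
      by (rule linear_on_subspace_sum[OF subspace_tangent cotangent_linear[OF \<alpha>]]) (rule coord_vec_tangent[OF x])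
    finally show ?thesis by (simp add: sum_fun_apply scaleR_fun_def mult.commute)
  next
    case False
    then show ?thesis
      using \<alpha> by (simp add: sum_fun_apply scaleR_fun_def coord_covec_def cotangent_space_def)
  qed
qed

section \<open>Tensor spaces, elementary tensors and contraction\<close>

lemma tensor_linear:
  assumes "\<tau> \<in> tensor_space M r s p" "tensor_args M r s p \<alpha>s \<xi>s"
  shows "i < r \<Longrightarrow> linear_on_subspace (cotangent_space M p) (\<lambda>\<alpha>. \<tau> (\<alpha>s[i := \<alpha>]) \<xi>s)"
    and "j < s \<Longrightarrow> linear_on_subspace (tangent_space M p) (\<lambda>\<xi>. \<tau> \<alpha>s (\<xi>s[j := \<xi>]))"
  using assms unfolding tensor_space_def by blast+

lemma tensor_zero: "\<tau> \<in> tensor_space M r s p \<Longrightarrow> \<not> tensor_args M r s p \<alpha>s \<xi>s \<Longrightarrow> \<tau> \<alpha>s \<xi>s = 0"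
  unfolding tensor_space_def by blast

lemma coord_args:
  assumes "x \<in> charts_at M p" "length I = r" "length J = s"
  shows "tensor_args M r s p (map (coord_covec M x p) I) (map (coord_vec M x p) J)"
  using assms(2,3) coord_vec_tangent[OF assms(1)] coord_covec_cotangent[of x p] unfolding tensor_args_def by auto

lemma tensor_expand:
  assumes x: "x \<in> charts_at M p" and \<tau>: "\<tau> \<in> tensor_space M r s p" and args: "tensor_args M r s p \<alpha>s \<xi>s"
  shows "\<tau> \<alpha>s \<xi>s = (\<Sum>I\<in>multi_indices M r. \<Sum>J\<in>multi_indices M s. tensor_component M x I J p \<tau> *
    ((\<Prod>k<r. (\<alpha>s ! k) (coord_vec M x p (I ! k))) * (\<Prod>l<s. coord_covec M x p (J ! l) (\<xi>s ! l))))"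
proof -
  have a: "length \<alpha>s = r" "length \<xi>s = s" "set \<alpha>s \<subseteq> cotangent_space M p" "set \<xi>s \<subseteq> tangent_space M p"
    using args by (auto simp: tensor_args_def)
  have "\<tau> \<alpha>s \<xi>s = (\<Sum>I | length I = r \<and> set I \<subseteq> {..<mdim M}.
      \<tau> (map (coord_covec M x p) I) \<xi>s * (\<Prod>k<r. (\<alpha>s ! k) (coord_vec M x p (I ! k))))"
    by (rule multilinear_expand[where f="\<lambda>\<alpha>s. \<tau> \<alpha>s \<xi>s" and \<phi>="\<lambda>i \<alpha>. \<alpha> (coord_vec M x p i)",
          OF subspace_cotangent coord_covec_cotangent cotangent_expand[OF x] _ a(1,3)])
      (use \<tau> a in \<open>auto intro!: tensor_linear(1) simp: tensor_args_def\<close>)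
  also have "\<dots> = (\<Sum>I\<in>multi_indices M r. (\<Sum>J\<in>multi_indices M s. tensor_component M x I J p \<tau> *
      (\<Prod>l<s. coord_covec M x p (J ! l) (\<xi>s ! l))) * (\<Prod>k<r. (\<alpha>s ! k) (coord_vec M x p (I ! k))))"
    unfolding multi_indices_def[of M r]
  proof (rule sum.cong[OF refl])
    fix I assume I: "I \<in> {I. length I = r \<and> set I \<subseteq> {..<mdim M}}"
    have "\<tau> (map (coord_covec M x p) I) \<xi>s = (\<Sum>J | length J = s \<and> set J \<subseteq> {..<mdim M}.
        \<tau> (map (coord_covec M x p) I) (map (coord_vec M x p) J) * (\<Prod>l<s. coord_covec M x p (J ! l) (\<xi>s ! l)))"
      by (rule multilinear_expand[where f="\<lambda>\<xi>s. \<tau> (map (coord_covec M x p) I) \<xi>s" and \<phi>="coord_covec M x p",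
            OF subspace_tangent coord_vec_tangent[OF x] tangent_expand[OF x] _ a(2,4)])
        (use \<tau> a I coord_covec_cotangent[of x p] in \<open>auto intro!: tensor_linear(2) simp: tensor_args_def\<close>)
    then show "\<tau> (map (coord_covec M x p) I) \<xi>s * (\<Prod>k<r. (\<alpha>s ! k) (coord_vec M x p (I ! k))) =
        (\<Sum>J\<in>multi_indices M s. tensor_component M x I J p \<tau> *
          (\<Prod>l<s. coord_covec M x p (J ! l) (\<xi>s ! l))) * (\<Prod>k<r. (\<alpha>s ! k) (coord_vec M x p (I ! k)))"
      by (simp add: tensor_component_def multi_indices_def)
  qed
  finally show ?thesis by (simp add: sum_distrib_left sum_distrib_right algebra_simps)
qed

lemma tensor_eqI:
  assumes "x \<in> charts_at M p" "\<tau> \<in> tensor_space M r s p" "\<sigma> \<in> tensor_space M r s p"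
    and "\<And>I J. I \<in> multi_indices M r \<Longrightarrow> J \<in> multi_indices M s \<Longrightarrow>
      tensor_component M x I J p \<tau> = tensor_component M x I J p \<sigma>"
  shows "\<tau> = \<sigma>"
proof (intro ext)
  fix \<alpha>s \<xi>s
  show "\<tau> \<alpha>s \<xi>s = \<sigma> \<alpha>s \<xi>s"
    using tensor_zero[OF assms(2)] tensor_zero[OF assms(3)] tensor_expand[OF assms(1,2)] tensor_expand[OF assms(1,3)]
    by (cases "tensor_args M r s p \<alpha>s \<xi>s") (simp_all add: assms(4))
qed

lemma tensor_lincomb:
  assumes "\<tau> \<in> tensor_space M r s p" "\<sigma> \<in> tensor_space M r s p"
  shows "a *\<^sub>R \<tau> + b *\<^sub>R \<sigma> \<in> tensor_space M r s p"
  using assms unfolding tensor_space_def linear_on_subspace_def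
  by (simp add: scaleR_fun_def algebra_simps)

lemma subspace_tensor: "subspace (tensor_space M r s p)"
  by (rule subspaceI_lincomb) (auto simp: tensor_lincomb, simp add: tensor_space_def linear_on_subspace_def)

lemma subspace_alternating: "subspace {\<tau> \<in> tensor_space M r s p. alternating_from k \<tau>}"
proof (rule subspaceI_lincomb)
  show "0 \<in> {\<tau> \<in> tensor_space M r s p. alternating_from k \<tau>}"
    using subspace_0[OF subspace_tensor] by (simp add: alternating_from_def)
  fix \<tau> \<sigma> a b
  assume "\<tau> \<in> {\<tau> \<in> tensor_space M r s p. alternating_from k \<tau>}" "\<sigma> \<in> {\<tau> \<in> tensor_space M r s p. alternating_from k \<tau>}"
  then have "alternating_from k \<tau>" "alternating_from k \<sigma>" "a *\<^sub>R \<tau> + b *\<^sub>R \<sigma> \<in> tensor_space M r s p"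
    by (auto intro: tensor_lincomb)
  moreover from this(1,2) have "alternating_from k (a *\<^sub>R \<tau> + b *\<^sub>R \<sigma>)"
    unfolding alternating_from_def plus_fun_apply scaleR_fun_def by (metis add.right_neutral scaleR_zero_right)
  ultimately show "a *\<^sub>R \<tau> + b *\<^sub>R \<sigma> \<in> {\<tau> \<in> tensor_space M r s p. alternating_from k \<tau>}" by blast
qed

lemma linear_maps_D:
  assumes "L \<in> linear_maps M p q"
  shows "linear_on_subspace (tangent_space M p) L" "\<xi> \<in> tangent_space M p \<Longrightarrow> L \<xi> \<in> tangent_space M q"
    "\<xi> \<notin> tangent_space M p \<Longrightarrow> L \<xi> = 0"
  using assms unfolding linear_maps_def by auto

lemma subspace_linear_maps: "subspace (linear_maps M p q)"
proof (rule subspaceI_lincomb)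
  show "0 \<in> linear_maps M p q"
    unfolding linear_maps_def linear_on_subspace_def using subspace_0[OF subspace_tangent] by auto
  fix K L a b assume K: "K \<in> linear_maps M p q" and L: "L \<in> linear_maps M p q"
  have "linear_on_subspace (tangent_space M p) (a *\<^sub>R K + b *\<^sub>R L)"
    unfolding linear_on_subspace_def
  proof (intro ballI allI)
    fix \<xi> \<eta> c d assume "\<xi> \<in> tangent_space M p" "\<eta> \<in> tangent_space M p"
    from linear_on_subspaceD[OF linear_maps_D(1)[OF K] this, of c d]
      linear_on_subspaceD[OF linear_maps_D(1)[OF L] this, of c d]
    have "(a *\<^sub>R K + b *\<^sub>R L) (c *\<^sub>R \<xi> + d *\<^sub>R \<eta>) = a *\<^sub>R (c *\<^sub>R K \<xi> + d *\<^sub>R K \<eta>) + b *\<^sub>R (c *\<^sub>R L \<xi> + d *\<^sub>R L \<eta>)"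
      by (simp only: plus_fun_apply scaleR_fun_def[of _ K] scaleR_fun_def[of _ L])
    also have "\<dots> = c *\<^sub>R (a *\<^sub>R K \<xi> + b *\<^sub>R L \<xi>) + d *\<^sub>R (a *\<^sub>R K \<eta> + b *\<^sub>R L \<eta>)"
      by (simp add: scaleR_add_right mult.commute)
    finally show "(a *\<^sub>R K + b *\<^sub>R L) (c *\<^sub>R \<xi> + d *\<^sub>R \<eta>) = c *\<^sub>R (a *\<^sub>R K + b *\<^sub>R L) \<xi> + d *\<^sub>R (a *\<^sub>R K + b *\<^sub>R L) \<eta>"
      by (simp only: plus_fun_apply scaleR_fun_def[of _ K] scaleR_fun_def[of _ L])
  qed
  then show "a *\<^sub>R K + b *\<^sub>R L \<in> linear_maps M p q"
    using linear_maps_D(2,3)[OF K] linear_maps_D(2,3)[OF L] subspace_lincomb[OF subspace_tangent]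
    unfolding linear_maps_def by (auto simp: scaleR_fun_def[of _ K] scaleR_fun_def[of _ L])
qed

lemma elementary_tensor_in:
  assumes w: "length ws = r" "set ws \<subseteq> tangent_space M p" and b: "length \<beta>s = s" "set \<beta>s \<subseteq> cotangent_space M p"
  shows "elementary_tensor M p ws \<beta>s \<in> tensor_space M r s p"
proof -
  have "linear_on_subspace (cotangent_space M p) (\<lambda>\<alpha>. elementary_tensor M p ws \<beta>s (\<alpha>s[i := \<alpha>]) \<xi>s)"
    if a: "tensor_args M r s p \<alpha>s \<xi>s" and i: "i < r" for \<alpha>s \<xi>s i
    unfolding linear_on_subspace_def
  proof (intro ballI allI)
    fix \<alpha> \<beta> a b assume ab: "\<alpha> \<in> cotangent_space M p" "\<beta> \<in> cotangent_space M p"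
    have args: "tensor_args M r s p (\<alpha>s[i := \<gamma>]) \<xi>s" if "\<gamma> \<in> cotangent_space M p" for \<gamma>
      using a that set_update_subset_insert[of \<alpha>s i \<gamma>] unfolding tensor_args_def by auto
    have len: "length \<alpha>s = r" using a by (simp add: tensor_args_def)
    have e: "elementary_tensor M p ws \<beta>s (\<alpha>s[i := \<gamma>]) \<xi>s =
        \<gamma> (ws ! i) * (\<Prod>k\<in>{..<r} - {i}. (\<alpha>s ! k) (ws ! k)) * (\<Prod>j<s. (\<beta>s ! j) (\<xi>s ! j))"
      if "\<gamma> \<in> cotangent_space M p" for \<gamma>
      using args[OF that] prod_list_update[OF i len, of "\<lambda>k \<alpha>. \<alpha> (ws ! k)" \<gamma>] w(1) b(1)
      by (simp add: elementary_tensor_def)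
    show "elementary_tensor M p ws \<beta>s (\<alpha>s[i := a *\<^sub>R \<alpha> + b *\<^sub>R \<beta>]) \<xi>s =
        a *\<^sub>R elementary_tensor M p ws \<beta>s (\<alpha>s[i := \<alpha>]) \<xi>s + b *\<^sub>R elementary_tensor M p ws \<beta>s (\<alpha>s[i := \<beta>]) \<xi>s"
      unfolding e[OF ab(1)] e[OF ab(2)] e[OF subspace_lincomb[OF subspace_cotangent ab]]
      by (simp add: scaleR_fun_def algebra_simps)
  qed
  moreover have "linear_on_subspace (tangent_space M p) (\<lambda>\<xi>. elementary_tensor M p ws \<beta>s \<alpha>s (\<xi>s[j := \<xi>]))"
    if a: "tensor_args M r s p \<alpha>s \<xi>s" and j: "j < s" for \<alpha>s \<xi>s j
    unfolding linear_on_subspace_def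
  proof (intro ballI allI)
    fix \<xi> \<eta> a b assume ab: "\<xi> \<in> tangent_space M p" "\<eta> \<in> tangent_space M p"
    have args: "tensor_args M r s p \<alpha>s (\<xi>s[j := \<gamma>])" if "\<gamma> \<in> tangent_space M p" for \<gamma>
      using a that set_update_subset_insert[of \<xi>s j \<gamma>] unfolding tensor_args_def by auto
    have len: "length \<xi>s = s" using a by (simp add: tensor_args_def)
    have e: "elementary_tensor M p ws \<beta>s \<alpha>s (\<xi>s[j := \<gamma>]) =
        (\<Prod>i<r. (\<alpha>s ! i) (ws ! i)) * ((\<beta>s ! j) \<gamma> * (\<Prod>k\<in>{..<s} - {j}. (\<beta>s ! k) (\<xi>s ! k)))"
      if "\<gamma> \<in> tangent_space M p" for \<gamma>
      using args[OF that] prod_list_update[OF j len, of "\<lambda>k \<xi>. (\<beta>s ! k) \<xi>" \<gamma>] w(1) b(1)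
      by (simp add: elementary_tensor_def)
    have "\<beta>s ! j \<in> cotangent_space M p" using b j by auto
    from linear_on_subspaceD[OF cotangent_linear[OF this] ab]
    show "elementary_tensor M p ws \<beta>s \<alpha>s (\<xi>s[j := a *\<^sub>R \<xi> + b *\<^sub>R \<eta>]) =
        a *\<^sub>R elementary_tensor M p ws \<beta>s \<alpha>s (\<xi>s[j := \<xi>]) + b *\<^sub>R elementary_tensor M p ws \<beta>s \<alpha>s (\<xi>s[j := \<eta>])"
      unfolding e[OF ab(1)] e[OF ab(2)] e[OF subspace_lincomb[OF subspace_tangent ab]]
      by (simp add: algebra_simps)
  qed
  ultimately show ?thesis
    unfolding tensor_space_def using w b by (auto simp: elementary_tensor_def)
qed

lemma elementary_tensor_linear_covec:
  assumes b: "length \<beta>s = s" and i: "i < s"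
  shows "elementary_tensor M p ws (\<beta>s[i := a *\<^sub>R \<alpha> + b *\<^sub>R \<beta>]) =
    a *\<^sub>R elementary_tensor M p ws (\<beta>s[i := \<alpha>]) + b *\<^sub>R elementary_tensor M p ws (\<beta>s[i := \<beta>])"
proof (intro ext)
  fix \<alpha>s \<xi>s
  have "(\<Prod>j<s. (\<beta>s[i := \<gamma>] ! j) (\<xi>s ! j)) = \<gamma> (\<xi>s ! i) * (\<Prod>j\<in>{..<s} - {i}. (\<beta>s ! j) (\<xi>s ! j))" for \<gamma>
    by (rule prod_list_update[OF i b, of "\<lambda>j \<alpha>. \<alpha> (\<xi>s ! j)"])
  then show "elementary_tensor M p ws (\<beta>s[i := a *\<^sub>R \<alpha> + b *\<^sub>R \<beta>]) \<alpha>s \<xi>s =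
    (a *\<^sub>R elementary_tensor M p ws (\<beta>s[i := \<alpha>]) + b *\<^sub>R elementary_tensor M p ws (\<beta>s[i := \<beta>])) \<alpha>s \<xi>s"
    by (simp add: elementary_tensor_def scaleR_fun_def b algebra_simps)
qed

text \<open>In contrast to a covector slot the inserted vectors must be tangent, because the
  arguments \<open>\<alpha>s ! i\<close> are linear only on the tangent space.\<close>

lemma elementary_tensor_linear_vec:
  assumes w: "length ws = r" and i: "i < r" and \<xi>: "\<xi> \<in> tangent_space M p" "\<eta> \<in> tangent_space M p"
  shows "elementary_tensor M p (ws[i := a *\<^sub>R \<xi> + b *\<^sub>R \<eta>]) \<beta>s =
    a *\<^sub>R elementary_tensor M p (ws[i := \<xi>]) \<beta>s + b *\<^sub>R elementary_tensor M p (ws[i := \<eta>]) \<beta>s"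
proof (intro ext)
  fix \<alpha>s \<xi>s
  show "elementary_tensor M p (ws[i := a *\<^sub>R \<xi> + b *\<^sub>R \<eta>]) \<beta>s \<alpha>s \<xi>s =
    (a *\<^sub>R elementary_tensor M p (ws[i := \<xi>]) \<beta>s + b *\<^sub>R elementary_tensor M p (ws[i := \<eta>]) \<beta>s) \<alpha>s \<xi>s"
  proof (cases "tensor_args M r (length \<beta>s) p \<alpha>s \<xi>s")
    case True
    have e: "(\<Prod>j<r. (\<alpha>s ! j) (ws[i := \<gamma>] ! j)) = (\<alpha>s ! i) \<gamma> * (\<Prod>j\<in>{..<r} - {i}. (\<alpha>s ! j) (ws ! j))" for \<gamma>
      by (rule prod_list_update[OF i w, of "\<lambda>j \<gamma>. (\<alpha>s ! j) \<gamma>"])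
    have "\<alpha>s ! i \<in> cotangent_space M p" using True i by (auto simp: tensor_args_def)
    from linear_on_subspaceD[OF cotangent_linear[OF this] \<xi>] show ?thesis
      using True by (simp add: elementary_tensor_def scaleR_fun_def w e algebra_simps)
  qed (simp add: elementary_tensor_def scaleR_fun_def w)
qed

definition basis_tensor :: "('m, 'a) chart \<Rightarrow> 'm \<Rightarrow> nat list \<Rightarrow> nat list \<Rightarrow> ('m, 'a) tensor" where
  "basis_tensor x p I J = elementary_tensor M p (map (coord_vec M x p) I) (map (coord_covec M x p) J)"

lemma basis_tensor_in:
  assumes "x \<in> charts_at M p" "I \<in> multi_indices M r" "J \<in> multi_indices M s"
  shows "basis_tensor x p I J \<in> tensor_space M r s p"
  unfolding basis_tensor_def
  using assms(2,3) coord_vec_tangent[OF assms(1)] coord_covec_cotangent[of x p]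
  by (intro elementary_tensor_in) (auto simp: multi_indices_def)

lemma finite_multi_indices: "finite (multi_indices M k)"
  unfolding multi_indices_def using finite_lists_length_eq[of "{..<mdim M}" k] by (simp add: conj_commute)

text \<open>If two index lists differ somewhere, one factor of the product vanishes by the duality
  of the coordinate bases.\<close>

lemma component_basis_tensor:
  assumes x: "x \<in> charts_at M p" and I: "I \<in> multi_indices M r" "I' \<in> multi_indices M r"
    and J: "J \<in> multi_indices M s" "J' \<in> multi_indices M s"
  shows "tensor_component M x I' J' p (basis_tensor x p I J) = (if I' = I \<and> J' = J then 1 else 0)"
proof -
  have l: "length I = r" "length I' = r" "length J = s" "length J' = s" using I J by (auto simp: multi_indices_def)
  have nth: "K ! k < mdim M" if "K \<in> multi_indices M n" "k < n" for K k n
    using that nth_mem[of k K] unfolding multi_indices_def by blast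
  note lt = nth[OF I(1)] nth[OF I(2)] and lt' = nth[OF J(1)] nth[OF J(2)]
  have "(\<Prod>k<r. coord_covec M x p (I' ! k) (coord_vec M x p (I ! k))) = (if I' = I then 1 else 0)"
  proof (cases "I' = I")
    case False
    then obtain k where "k < r" "I' ! k \<noteq> I ! k" using l nth_equalityI by metis
    then show ?thesis using False coord_covec_vec[OF x] lt
      by (intro trans[OF prod_zero]) (auto intro!: bexI[of _ k])
  qed (simp add: coord_covec_vec[OF x] lt)
  moreover have "(\<Prod>k<s. coord_covec M x p (J ! k) (coord_vec M x p (J' ! k))) = (if J' = J then 1 else 0)"
  proof (cases "J' = J")
    case False
    then obtain k where "k < s" "J ! k \<noteq> J' ! k" using l nth_equalityI by metis
    then show ?thesis using False coord_covec_vec[OF x] lt'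
      by (intro trans[OF prod_zero]) (auto intro!: bexI[of _ k])
  qed (simp add: coord_covec_vec[OF x] lt')
  ultimately show ?thesis
    using l coord_args[OF x l(2,4)]
    by (simp add: tensor_component_def basis_tensor_def elementary_tensor_def)
qed

lemma tensor_basis_expand:
  assumes x: "x \<in> charts_at M p" and t: "t \<in> tensor_space M r s p"
  shows "t = (\<Sum>(I, J)\<in>multi_indices M r \<times> multi_indices M s. tensor_component M x I J p t *\<^sub>R basis_tensor x p I J)"
proof (intro ext)
  fix \<alpha>s \<xi>s
  have l: "length I = r" "length J = s" if "I \<in> multi_indices M r" "J \<in> multi_indices M s" for I J
    using that by (auto simp: multi_indices_def)
  show "t \<alpha>s \<xi>s = (\<Sum>(I, J)\<in>multi_indices M r \<times> multi_indices M s.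
      tensor_component M x I J p t *\<^sub>R basis_tensor x p I J) \<alpha>s \<xi>s"
  proof (cases "tensor_args M r s p \<alpha>s \<xi>s")
    case True
    show ?thesis
      unfolding tensor_expand[OF x t True] sum.cartesian_product sum_fun_apply
      by (rule sum.cong) (use True l in \<open>auto simp: basis_tensor_def elementary_tensor_def scaleR_fun_def\<close>)
  next
    case False
    then show ?thesis
      using tensor_zero[OF t False]
      by (simp add: sum_fun_apply)
        (rule sum.neutral, use False l in \<open>auto simp: basis_tensor_def elementary_tensor_def scaleR_fun_def\<close>)
  qed
qed

text \<open>Exposes the chart chosen inside \<open>contraction\<close>; it depends on the point only
  and can be fixed for all tensors there.\<close>

lemma contraction_chart:
  "\<exists>x. x \<in> charts_at M p \<and> (\<forall>\<tau> t r s. contraction M r s p \<tau> t =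
    (\<Sum>I\<in>multi_indices M r. \<Sum>J\<in>multi_indices M s. tensor_component M x I J p \<tau> * tensor_component M x J I p t))"
  using someI_ex[OF charts_at_nonempty[of p]]
  by (intro exI[of _ "SOME x. x \<in> charts_at M p"]) (simp add: contraction_def Let_def)

text \<open>The pairing is nondegenerate: contraction with the basis tensors of the chosen chart
  reads off the components. This is the uniqueness required by the definite description in
  \<open>iota\<close>.\<close>

lemma contraction_determines:
  assumes \<tau>: "\<tau> \<in> tensor_space M r s p" and \<sigma>: "\<sigma> \<in> tensor_space M r s p"
    and eq: "\<And>t. t \<in> tensor_space M s r p \<Longrightarrow> contraction M r s p \<tau> t = contraction M r s p \<sigma> t"
  shows "\<tau> = \<sigma>"
proof -
  obtain x where x: "x \<in> charts_at M p" and c: "\<And>\<tau> t r s. contraction M r s p \<tau> t =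
      (\<Sum>I\<in>multi_indices M r. \<Sum>J\<in>multi_indices M s. tensor_component M x I J p \<tau> * tensor_component M x J I p t)"
    using contraction_chart[of p] by blast
  have "contraction M r s p \<rho> (basis_tensor x p J I) = tensor_component M x I J p \<rho>"
    if I: "I \<in> multi_indices M r" and J: "J \<in> multi_indices M s" for I J \<rho>
  proof -
    have "contraction M r s p \<rho> (basis_tensor x p J I) =
        (\<Sum>I'\<in>multi_indices M r. \<Sum>J'\<in>multi_indices M s. if J' = J then (if I' = I then tensor_component M x I' J' p \<rho> else 0) else 0)"
      unfolding c using component_basis_tensor[OF x J _ I] by (intro sum.cong) auto
    also have "\<dots> = tensor_component M x I J p \<rho>"
      using I J by (simp add: finite_multi_indices)
    finally show ?thesis .
  qed
  note * = this
  show ?thesis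
  proof (rule tensor_eqI[OF x \<tau> \<sigma>])
    fix I J assume I: "I \<in> multi_indices M r" and J: "J \<in> multi_indices M s"
    show "tensor_component M x I J p \<tau> = tensor_component M x I J p \<sigma>"
      using eq[OF basis_tensor_in[OF x J I]] unfolding *[OF I J] .
  qed
qed

end


section \<open>Families of sections and their pairing with distributions\<close>

lemma smooth_on_fst:
  fixes f :: "real \<Rightarrow> real"
  assumes "open S" "open U" "smooth_on S f"
  shows "smooth_on (S \<times> U) (\<lambda>w. f (fst w))"
  by (rule smooth_on_compose[OF open_Times[OF assms(1,2)] assms(1) coord_system_real assms(3)])
    (auto intro: smooth_on_linear[OF open_Times[OF assms(1,2)] bounded_linear_fst])

text \<open>Serves to carry an identity that holds for all parameters over to parameter
  derivatives.\<close>

lemma DERIV_eq_open: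
  fixes f g :: "real \<Rightarrow> real"
  assumes "(f has_real_derivative D) (at t)" "(g has_real_derivative D') (at t)"
    and "open S" "t \<in> S" "\<And>u. u \<in> S \<Longrightarrow> f u = g u"
  shows "D = D'"
  using DERIV_unique[OF has_field_derivative_transform_within_open[OF assms(1,3,4,5)] assms(2)] by simp

context manifold
begin

section \<open>The bundles of forms, of tensor-valued forms and of linear maps between tangent
  spaces\<close>

lemma smooth_bundle_tensor:
  fixes E :: "('m, 'a, ('m, 'a) tensor) vbundle"
  assumes E: "bcoords E = tensor_bcoords M r s" and fib: "\<And>p. subspace (fibre E p)"
  shows "smooth_bundle E"
proof
  fix W \<psi> \<kappa> assume "(W, \<psi>, \<kappa>) \<in> bcoords E"
  then obtain x I J where x: "x \<in> atlas M" "W = fst x" "\<psi> = snd x" "\<kappa> = tensor_component M x I J"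
    unfolding E tensor_bcoords_def by blast
  show "open (\<psi> ` W)" "inj_on \<psi> W" "continuous_on W \<psi>"
    using open_range inj_chart continuous_chart x by auto
  show "continuous_on (\<psi> ` W) (inv_into W \<psi>)"
    using continuous_chart_inv[OF x(1)] x by (simp add: chart_inv_def)
  show "linear_on_subspace (fibre E p) (\<kappa> p)" for p
    unfolding linear_on_subspace_def x(4) tensor_component_def by (simp add: scaleR_fun_def)
qed (rule fib compact_cball_model)+

lemma smooth_bundle_form: "smooth_bundle (form_bundle M)"
  by (rule smooth_bundle_tensor) (auto simp: form_bundle_def subspace_alternating)

lemma smooth_bundle_tensor_form: "smooth_bundle (tensor_form_bundle M s r)"
  by (rule smooth_bundle_tensor) (auto simp: tensor_form_bundle_def subspace_alternating)

definition TO_coord :: "('m, 'a) chart \<Rightarrow> ('m, 'a) chart \<Rightarrow> nat \<Rightarrow> nat \<Rightarrow>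
    ('m \<times> 'm) set \<times> ('m \<times> 'm \<Rightarrow> 'a \<times> 'a) \<times> ('m \<times> 'm \<Rightarrow> (('m, 'a) tvec \<Rightarrow> ('m, 'a) tvec) \<Rightarrow> real)" where
  "TO_coord x y i j = (fst x \<times> fst y, map_prod (snd x) (snd y),
     \<lambda>(p, q) L. coord_covec M y q i (L (coord_vec M x p j)))"

lemma bcoords_TO: "bcoords (TO_bundle M) =
    {TO_coord x y i j | x y i j. x \<in> atlas M \<and> y \<in> atlas M \<and> i < mdim M \<and> j < mdim M}"
  by (simp add: TO_bundle_def TO_coord_def)

lemma image_product_chart: "map_prod (snd x) (snd y) ` (fst x \<times> fst y) = snd x ` fst x \<times> snd y ` fst y"
  by (auto simp: image_iff)

lemma inj_product_chart:
  assumes "x \<in> atlas M" "y \<in> atlas M"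
  shows "inj_on (map_prod (snd x) (snd y)) (fst x \<times> fst y)"
  using inj_chart[OF assms(1)] inj_chart[OF assms(2)] by (auto simp: inj_on_def)

lemma inv_product_chart:
  assumes "x \<in> atlas M" "y \<in> atlas M" "w \<in> snd x ` fst x" "z \<in> snd y ` fst y"
  shows "inv_into (fst x \<times> fst y) (map_prod (snd x) (snd y)) (w, z) = (chart_inv x w, chart_inv y z)"
  by (rule inv_into_f_eq[OF inj_product_chart[OF assms(1,2)]])
    (use assms chart_inv_in[OF assms(1)] chart_inv_in[OF assms(2)] chart_chart_inv[OF assms(1)]
      chart_chart_inv[OF assms(2)] in auto)

lemma smooth_bundle_TO: "smooth_bundle (TO_bundle M)"
proof
  show "subspace (fibre (TO_bundle M) p)" for p
    by (cases p) (simp add: TO_bundle_def subspace_linear_maps)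
  show "compact (cball (z :: 'a \<times> 'a) e)" for z e
    by (rule compact_cball_coord[OF coord_system_Times[OF coord_system_model coord_system_model]])
  fix W \<psi> \<kappa> assume "(W, \<psi>, \<kappa>) \<in> bcoords (TO_bundle M)"
  then obtain x y i j where x: "x \<in> atlas M" and y: "y \<in> atlas M"
    and W: "W = fst x \<times> fst y" and \<psi>: "\<psi> = map_prod (snd x) (snd y)"
    and \<kappa>: "\<kappa> = (\<lambda>(p, q) L. coord_covec M y q i (L (coord_vec M x p j)))"
    unfolding bcoords_TO TO_coord_def by blast
  show "open (\<psi> ` W)"
    unfolding W \<psi> image_product_chart by (intro open_Times open_range x y)
  show "inj_on \<psi> W" unfolding W \<psi> by (rule inj_product_chart[OF x y])
  have "continuous_on W (\<lambda>p. (snd x (fst p), snd y (snd p)))"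
    unfolding W
    by (intro continuous_on_Pair continuous_on_compose2[OF continuous_chart[OF x]]
        continuous_on_compose2[OF continuous_chart[OF y]] continuous_intros) auto
  then show "continuous_on W \<psi>" unfolding \<psi> by (simp add: map_prod_def case_prod_unfold)
  have "continuous_on (\<psi> ` W) (\<lambda>z. (chart_inv x (fst z), chart_inv y (snd z)))"
    unfolding W \<psi> image_product_chart
    by (intro continuous_on_Pair continuous_on_compose2[OF continuous_chart_inv[OF x]]
        continuous_on_compose2[OF continuous_chart_inv[OF y]] continuous_intros) auto
  then show "continuous_on (\<psi> ` W) (inv_into W \<psi>)"
    unfolding W \<psi> image_product_chart
    by (rule continuous_on_eq) (use inv_product_chart[OF x y] in auto)
  fix pq assume "pq \<in> W"
  then obtain p q where pq: "pq = (p, q)" "p \<in> fst x" "q \<in> fst y" unfolding W by blast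
  have xp: "x \<in> charts_at M p" using x pq by (simp add: charts_at_iff)
  show "linear_on_subspace (fibre (TO_bundle M) pq) (\<kappa> pq)"
    unfolding linear_on_subspace_def
  proof (intro ballI allI)
    fix K L a b assume "K \<in> fibre (TO_bundle M) pq" "L \<in> fibre (TO_bundle M) pq"
    then have KL: "K \<in> linear_maps M p q" "L \<in> linear_maps M p q" by (auto simp: TO_bundle_def pq)
    have "K (coord_vec M x p j) \<in> tangent_space M q" "L (coord_vec M x p j) \<in> tangent_space M q"
      using linear_maps_D(2)[OF KL(1)] linear_maps_D(2)[OF KL(2)] coord_vec_tangent[OF xp] by auto
    from linear_on_subspaceD[OF cotangent_linear[OF coord_covec_cotangent] this, of y i a b]
    show "\<kappa> pq (a *\<^sub>R K + b *\<^sub>R L) = a *\<^sub>R \<kappa> pq K + b *\<^sub>R \<kappa> pq L"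
      by (simp add: \<kappa> pq(1) scaleR_fun_def[of _ K] scaleR_fun_def[of _ L])
  qed
qed

lemma section_TO_linear_maps: "A \<in> smooth_sections (TO_bundle M) \<Longrightarrow> A (p, q) \<in> linear_maps M p q"
  using smooth_bundle.section_fibre[OF smooth_bundle_TO, of A "(p, q)"] by (simp add: TO_bundle_def)

lemma section_form_fibre:
  "\<omega> \<in> smooth_sections (form_bundle M) \<Longrightarrow>
    \<omega> q \<in> tensor_space M 0 (mdim M) q \<and> alternating_from 0 (\<omega> q)"
  using smooth_bundle.section_fibre[OF smooth_bundle_form, of \<omega> q] by (simp add: form_bundle_def)

section \<open>The section paired with the distribution\<close>

lemma comp_lincomb: "(a *\<^sub>R \<alpha> + b *\<^sub>R \<beta>) \<circ> L = a *\<^sub>R (\<alpha> \<circ> L) + b *\<^sub>R (\<beta> \<circ> L)"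
  by (simp add: fun_eq_iff scaleR_fun_def)

lemma tensor_args_update_covec:
  "tensor_args M r s p \<alpha>s \<xi>s \<Longrightarrow> \<alpha> \<in> cotangent_space M p \<Longrightarrow> tensor_args M r s p (\<alpha>s[i := \<alpha>]) \<xi>s"
  using set_update_subset_insert[of \<alpha>s i \<alpha>] unfolding tensor_args_def by auto

lemma tensor_args_update_vec:
  "tensor_args M r s p \<alpha>s \<xi>s \<Longrightarrow> \<xi> \<in> tangent_space M p \<Longrightarrow> tensor_args M r s p \<alpha>s (\<xi>s[i := \<xi>])"
  using set_update_subset_insert[of \<xi>s i \<xi>] unfolding tensor_args_def by auto

lemma transport_in:
  assumes L: "A (p, q) \<in> linear_maps M p q" "A (q, p) \<in> linear_maps M q p"
    and t: "t \<in> tensor_space M s r p"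
  shows "transport M s r A p q t \<in> tensor_space M s r q"
  unfolding tensor_space_def
proof (intro CollectI conjI allI impI)
  fix \<alpha>s \<xi>s
  show "\<not> tensor_args M s r q \<alpha>s \<xi>s \<Longrightarrow> transport M s r A p q t \<alpha>s \<xi>s = 0"
    by (simp add: transport_def)
  assume args: "tensor_args M s r q \<alpha>s \<xi>s"
  note args' = transport_args[OF L args]
  have l: "length \<alpha>s = s" "length \<xi>s = r" using args by (auto simp: tensor_args_def)
  fix i
  show "linear_on_subspace (cotangent_space M q) (\<lambda>\<alpha>. transport M s r A p q t (\<alpha>s[i := \<alpha>]) \<xi>s)" if i: "i < s"
    unfolding linear_on_subspace_def
  proof (intro ballI allI)
    fix \<alpha> \<beta> a b assume ab: "\<alpha> \<in> cotangent_space M q" "\<beta> \<in> cotangent_space M q"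
    have e: "transport M s r A p q t (\<alpha>s[i := \<gamma>]) \<xi>s =
        t ((map (\<lambda>\<alpha>. \<alpha> \<circ> A (p, q)) \<alpha>s)[i := \<gamma> \<circ> A (p, q)]) (map (A (q, p)) \<xi>s)" if "\<gamma> \<in> cotangent_space M q" for \<gamma>
      using tensor_args_update_covec[OF args that] by (simp add: transport_def map_update)
    show "transport M s r A p q t (\<alpha>s[i := a *\<^sub>R \<alpha> + b *\<^sub>R \<beta>]) \<xi>s =
        a *\<^sub>R transport M s r A p q t (\<alpha>s[i := \<alpha>]) \<xi>s + b *\<^sub>R transport M s r A p q t (\<alpha>s[i := \<beta>]) \<xi>s"
      unfolding e[OF ab(1)] e[OF ab(2)] e[OF subspace_lincomb[OF subspace_cotangent ab]] comp_lincomb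
      by (rule linear_on_subspaceD[OF tensor_linear(1)[OF t args' i]
            adjoint_cotangent[OF L(1) ab(1)] adjoint_cotangent[OF L(1) ab(2)]])
  qed
  show "linear_on_subspace (tangent_space M q) (\<lambda>\<xi>. transport M s r A p q t \<alpha>s (\<xi>s[i := \<xi>]))" if i: "i < r"
    unfolding linear_on_subspace_def
  proof (intro ballI allI)
    fix \<xi> \<eta> a b assume ab: "\<xi> \<in> tangent_space M q" "\<eta> \<in> tangent_space M q"
    have e: "transport M s r A p q t \<alpha>s (\<xi>s[i := \<gamma>]) =
        t (map (\<lambda>\<alpha>. \<alpha> \<circ> A (p, q)) \<alpha>s) ((map (A (q, p)) \<xi>s)[i := A (q, p) \<gamma>])" if "\<gamma> \<in> tangent_space M q" for \<gamma>
      using tensor_args_update_vec[OF args that] by (simp add: transport_def map_update)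
    show "transport M s r A p q t \<alpha>s (\<xi>s[i := a *\<^sub>R \<xi> + b *\<^sub>R \<eta>]) =
        a *\<^sub>R transport M s r A p q t \<alpha>s (\<xi>s[i := \<xi>]) + b *\<^sub>R transport M s r A p q t \<alpha>s (\<xi>s[i := \<eta>])"
      unfolding e[OF ab(1)] e[OF ab(2)] e[OF subspace_lincomb[OF subspace_tangent ab]]
        linear_on_subspaceD[OF linear_maps_D(1)[OF L(2)] ab]
      by (rule linear_on_subspaceD[OF tensor_linear(2)[OF t args' i]
            linear_maps_D(2)[OF L(2) ab(1)] linear_maps_D(2)[OF L(2) ab(2)]])
  qed
qed

lemma tensor_form_in:
  assumes t: "t \<in> tensor_space M s r q" and \<eta>: "\<eta> \<in> tensor_space M 0 n q" "alternating_from 0 \<eta>"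
  shows "tensor_form r t \<eta> \<in> {\<tau> \<in> tensor_space M s (r + n) q. alternating_from r \<tau>}"
proof (intro CollectI conjI)
  show "tensor_form r t \<eta> \<in> tensor_space M s (r + n) q"
    unfolding tensor_space_def
  proof (intro CollectI conjI allI impI)
    fix \<alpha>s \<xi>s
    \<comment> \<open>Admissible argument lists split at position \<open>r\<close>; linearity in a
      slot is then linearity of one factor, the other being constant.\<close>
    have iff: "tensor_args M s (r + n) q \<alpha>s \<xi>s \<longleftrightarrow>
        tensor_args M s r q \<alpha>s (take r \<xi>s) \<and> tensor_args M 0 n q [] (drop r \<xi>s)"
    proof -
      have "set \<xi>s = set (take r \<xi>s) \<union> set (drop r \<xi>s)" by (metis append_take_drop_id set_append)
      then show ?thesis by (auto simp: tensor_args_def)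
    qed
    show "\<not> tensor_args M s (r + n) q \<alpha>s \<xi>s \<Longrightarrow> tensor_form r t \<eta> \<alpha>s \<xi>s = 0"
      unfolding iff tensor_form_def using tensor_zero[OF t] tensor_zero[OF \<eta>(1)] by auto
    assume "tensor_args M s (r + n) q \<alpha>s \<xi>s"
    then have a: "tensor_args M s r q \<alpha>s (take r \<xi>s)" "tensor_args M 0 n q [] (drop r \<xi>s)"
      unfolding iff by auto
    fix i
    show "linear_on_subspace (cotangent_space M q) (\<lambda>\<alpha>. tensor_form r t \<eta> (\<alpha>s[i := \<alpha>]) \<xi>s)" if "i < s"
      using tensor_linear(1)[OF t a(1) that]
      unfolding linear_on_subspace_def tensor_form_def by (simp add: algebra_simps)
    show "linear_on_subspace (tangent_space M q) (\<lambda>\<xi>. tensor_form r t \<eta> \<alpha>s (\<xi>s[i := \<xi>]))" if i: "i < r + n"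
    proof (cases "i < r")
      case True
      then show ?thesis
        using tensor_linear(2)[OF t a(1) True]
        unfolding linear_on_subspace_def tensor_form_def by (simp add: take_update_swap algebra_simps)
    next
      case False
      then have "linear_on_subspace (tangent_space M q) (\<lambda>\<xi>. \<eta> [] ((drop r \<xi>s)[i - r := \<xi>]))"
        using tensor_linear(2)[OF \<eta>(1) a(2), of "i - r"] i by simp
      then show ?thesis
        using False unfolding linear_on_subspace_def tensor_form_def
        by (simp add: drop_update_swap algebra_simps)
    qed
  qed
  show "alternating_from r (tensor_form r t \<eta>)"
    unfolding alternating_from_def
  proof (intro allI impI)
    fix \<alpha>s and \<xi>s :: "('m, 'a) tvec list" and i j
    assume ij: "r \<le> i \<and> i < j \<and> j < length \<xi>s \<and> \<xi>s ! i = \<xi>s ! j"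
    then have "0 \<le> i - r \<and> i - r < j - r \<and> j - r < length (drop r \<xi>s) \<and> drop r \<xi>s ! (i - r) = drop r \<xi>s ! (j - r)"
      by auto
    then have "\<eta> [] (drop r \<xi>s) = 0" using \<eta>(2) unfolding alternating_from_def by blast
    then show "tensor_form r t \<eta> \<alpha>s \<xi>s = 0" by (simp add: tensor_form_def)
  qed
qed

text \<open>The test section to which \<open>v\<close> is applied in \<open>iota_rhs\<close>. It has
  a name because later all of its arguments vary with a parameter.\<close>

definition paired_section ::
  "nat \<Rightarrow> nat \<Rightarrow> ('m \<Rightarrow> ('m, 'a) tensor) \<Rightarrow> 'm \<Rightarrow> ('m \<times> 'm \<Rightarrow> ('m, 'a) tvec \<Rightarrow> ('m, 'a) tvec) \<Rightarrow>
    ('m, 'a) tensor \<Rightarrow> 'm \<Rightarrow> ('m, 'a) tensor" where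
  "paired_section s r \<omega> p A t = (\<lambda>q. tensor_form r (transport M s r A p q t) (\<omega> q))"

lemma paired_section_fibre:
  assumes "\<omega> \<in> smooth_sections (form_bundle M)" "A \<in> smooth_sections (TO_bundle M)" "t \<in> tensor_space M s r p"
  shows "paired_section s r \<omega> p A t q \<in> fibre (tensor_form_bundle M s r) q"
proof -
  have "transport M s r A p q t \<in> tensor_space M s r q"
    by (intro transport_in section_TO_linear_maps assms)
  from tensor_form_in[OF this conjunct1[OF section_form_fibre[OF assms(1)]]
      conjunct2[OF section_form_fibre[OF assms(1)]]] show ?thesis
    by (simp add: paired_section_def tensor_form_bundle_def)
qed

text \<open>The polynomial expression on which smoothness rests: the transported arguments are
  expanded in the chart \<open>x\<close> at \<open>p\<close>, so their coefficients are the matrix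
  entries of \<open>A (p, q)\<close> and \<open>A (q, p)\<close>. The first \<open>r\<close> entries
  of \<open>J\<close> belong to the tensor, the others to the form.\<close>

lemma component_paired_section:
  assumes A: "A \<in> smooth_sections (TO_bundle M)" and t: "t \<in> tensor_space M s r p"
    and x: "x \<in> charts_at M p" and y: "y \<in> charts_at M q"
    and I: "I \<in> multi_indices M s" and J: "J \<in> multi_indices M (r + mdim M)"
  shows "tensor_component M y I J q (paired_section s r \<omega> p A t q) =
    (\<Sum>I'\<in>multi_indices M s. \<Sum>J'\<in>multi_indices M r. tensor_component M x I' J' p t *
      ((\<Prod>k<s. coord_covec M y q (I ! k) (A (p, q) (coord_vec M x p (I' ! k)))) *
       (\<Prod>l<r. coord_covec M x p (J' ! l) (A (q, p) (coord_vec M y q (J ! l)))))) *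
    tensor_component M y [] (drop r J) q (\<omega> q)"
proof -
  have l: "length I = s" "length J = r + mdim M" using I J by (auto simp: multi_indices_def)
  have args: "tensor_args M s r q (map (coord_covec M y q) I) (map (coord_vec M y q) (take r J))"
    using coord_args[OF y l(1), of "take r J" r] l by simp
  note L = section_TO_linear_maps[OF A]
  have "transport M s r A p q t (map (coord_covec M y q) I) (map (coord_vec M y q) (take r J)) =
      t (map (\<lambda>\<alpha>. \<alpha> \<circ> A (p, q)) (map (coord_covec M y q) I)) (map (A (q, p)) (map (coord_vec M y q) (take r J)))"
    using args by (simp add: transport_def)
  also have "\<dots> = (\<Sum>I'\<in>multi_indices M s. \<Sum>J'\<in>multi_indices M r. tensor_component M x I' J' p t *
      ((\<Prod>k<s. coord_covec M y q (I ! k) (A (p, q) (coord_vec M x p (I' ! k)))) *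
       (\<Prod>l<r. coord_covec M x p (J' ! l) (A (q, p) (coord_vec M y q (J ! l))))))"
    unfolding tensor_expand[OF x t transport_args[OF L[of p q] L[of q p] args]]
    using l by simp
  finally show ?thesis
    by (simp add: tensor_component_def paired_section_def tensor_form_def take_map drop_map)
qed

lemma paired_section_support: "\<omega> q = 0 \<Longrightarrow> paired_section s r \<omega> p A t q = 0"
  by (simp add: paired_section_def tensor_form_def fun_eq_iff)

text \<open>One side of the exponential law, and the class in which parameter derivatives are
  iterated. The support condition places the difference quotients at \<open>t\<close> in one space
  \<open>sections_in\<close>; it uses \<open>nhds\<close> rather than \<open>at\<close>, so that the
  support of \<open>\<Phi> t\<close> itself is included.\<close>

definition smooth_family :: "nat \<Rightarrow> nat \<Rightarrow> real set \<Rightarrow> (real \<Rightarrow> 'm \<Rightarrow> ('m, 'a) tensor) \<Rightarrow> bool" where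
  "smooth_family s r S \<Phi> \<longleftrightarrow>
     (\<forall>t\<in>S. \<forall>q. \<Phi> t q \<in> fibre (tensor_form_bundle M s r) q) \<and>
     (\<forall>t\<in>S. \<exists>K. compact K \<and> (\<forall>\<^sub>F u in nhds t. {q. \<Phi> u q \<noteq> 0} \<subseteq> K)) \<and>
     (\<forall>y\<in>atlas M. \<forall>I\<in>multi_indices M s. \<forall>J\<in>multi_indices M (r + mdim M).
        smooth_on (S \<times> snd y ` fst y)
          (\<lambda>(t, z). tensor_component M y I J (chart_inv y z) (\<Phi> t (chart_inv y z))))"

lemma bcoords_tensor_formE:
  assumes "(W, \<psi>, \<kappa>) \<in> bcoords (tensor_form_bundle M s r)"
  obtains y I J where "y \<in> atlas M" "I \<in> multi_indices M s" "J \<in> multi_indices M (r + mdim M)"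
    "W = fst y" "\<psi> = snd y" "\<kappa> = tensor_component M y I J"
  using assms unfolding tensor_form_bundle_def tensor_bcoords_def by auto

lemma smooth_family_joint:
  assumes \<Phi>: "smooth_family s r S \<Phi>" and k: "(W, \<psi>, \<kappa>) \<in> bcoords (tensor_form_bundle M s r)"
  shows "smooth_on (S \<times> \<psi> ` W) (\<lambda>(t, z). local_rep (W, \<psi>, \<kappa>) (\<Phi> t) z)"
  using k
proof (rule bcoords_tensor_formE)
  fix y I J assume y: "y \<in> atlas M" "I \<in> multi_indices M s" "J \<in> multi_indices M (r + mdim M)"
    and W: "W = fst y" "\<psi> = snd y" "\<kappa> = tensor_component M y I J"
  show ?thesis
    using \<Phi> y unfolding smooth_family_def W local_rep_def prod.case chart_inv_def[symmetric] by blast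
qed

lemma smooth_family_section:
  assumes \<Phi>: "smooth_family s r S \<Phi>" and t: "t \<in> S"
  shows "\<Phi> t \<in> smooth_sections (tensor_form_bundle M s r)"
proof -
  have "smooth_on (\<psi> ` W) (local_rep (W, \<psi>, \<kappa>) (\<Phi> t))" if k: "(W, \<psi>, \<kappa>) \<in> bcoords (tensor_form_bundle M s r)" for W \<psi> \<kappa>
    using smooth_on_slice[OF smooth_bundle.open_image[OF smooth_bundle_tensor_form k] smooth_family_joint[OF \<Phi> k] t]
    by simp
  moreover have "\<forall>q. \<Phi> t q \<in> fibre (tensor_form_bundle M s r) q" using \<Phi> t unfolding smooth_family_def by blast
  ultimately show ?thesis unfolding smooth_sections_def by blast
qed

lemma smooth_family_compact:
  assumes \<Phi>: "smooth_family s r S \<Phi>" and t: "t \<in> S"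
  shows "\<Phi> t \<in> compact_sections (tensor_form_bundle M s r)"
proof -
  obtain K where "compact K" "\<forall>\<^sub>F u in nhds t. {q. \<Phi> u q \<noteq> 0} \<subseteq> K"
    using \<Phi> t unfolding smooth_family_def by blast
  moreover from this(2) have "{q. \<Phi> t q \<noteq> 0} \<subseteq> K" by (rule eventually_nhds_x_imp_x)
  ultimately have "compact K" "\<Phi> t \<in> sections_in (tensor_form_bundle M s r) K"
    using smooth_family_section[OF \<Phi> t] by (auto simp: sections_in_def)
  then show ?thesis using smooth_bundle.sections_in_compact[OF smooth_bundle_tensor_form] by blast
qed

text \<open>The derivative is formed separately at each base point and each pair of argument lists.
  All defining conditions of the fibre are linear and the support bound is local in the parameter,
  so they pass to the derivative; its components are the parameter derivatives of the jointly smooth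
  components of \<open>\<Phi>\<close>.\<close>

lemma smooth_family_derivative:
  assumes S: "open S" and \<Phi>: "smooth_family s r S \<Phi>"
  shows "\<exists>\<Phi>'. smooth_family s r S \<Phi>' \<and> (\<forall>t\<in>S. limitin (LF_topology (tensor_form_bundle M s r))
    (\<lambda>h. (1 / h) *\<^sub>R (\<Phi> (t + h) - \<Phi> t)) (\<Phi>' t) (at 0))"
proof -
  let ?n = "r + mdim M"
  define \<Phi>' where "\<Phi>' t q = (\<lambda>\<alpha>s \<xi>s. deriv (\<lambda>u. \<Phi> u q \<alpha>s \<xi>s) t)" for t q
  define F where "F y I J = (\<lambda>(t, z). tensor_component M y I J (chart_inv y z) (\<Phi> t (chart_inv y z)))" for y I J
  have Fs: "smooth_on (S \<times> snd y ` fst y) (F y I J)"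
    if "y \<in> atlas M" "I \<in> multi_indices M s" "J \<in> multi_indices M ?n" for y I J
    using \<Phi> that unfolding smooth_family_def F_def by blast
  have fib: "\<Phi> t q \<in> tensor_space M s ?n q" "alternating_from r (\<Phi> t q)" if "t \<in> S" for t q
    using \<Phi> that unfolding smooth_family_def by (auto simp: tensor_form_bundle_def)
  have comp: "((\<lambda>u. tensor_component M y I J (chart_inv y z) (\<Phi> u (chart_inv y z))) has_real_derivative
      frechet_derivative (F y I J) (at (t, z)) (1, 0)) (at t)"
    if y: "y \<in> atlas M" "I \<in> multi_indices M s" "J \<in> multi_indices M ?n" and t: "t \<in> S" and z: "z \<in> snd y ` fst y" for y I J t z
    using smooth_on_line_derivative[OF Fs[OF y], of "(0, z)" t "(1, 0)"] t z by (simp add: F_def)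
  \<comment> \<open>For arbitrary admissible arguments the value is a fixed linear combination of
    components in one chart at \<open>q\<close>; for all others it is constantly zero on
    \<open>S\<close>.\<close>
  have der: "((\<lambda>u. \<Phi> u q \<alpha>s \<xi>s) has_real_derivative \<Phi>' t q \<alpha>s \<xi>s) (at t)" if t: "t \<in> S" for t q \<alpha>s \<xi>s
  proof -
    have "\<exists>D. ((\<lambda>u. \<Phi> u q \<alpha>s \<xi>s) has_real_derivative D) (at t)"
    proof (cases "tensor_args M s ?n q \<alpha>s \<xi>s")
      case True
      obtain y where y: "y \<in> charts_at M q" using charts_at_nonempty by blast
      then have yq: "y \<in> atlas M" "q \<in> fst y" by (auto simp: charts_at_iff)
      let ?c = "\<lambda>I J. (\<Prod>k<s. (\<alpha>s ! k) (coord_vec M y q (I ! k))) * (\<Prod>l<?n. coord_covec M y q (J ! l) (\<xi>s ! l))"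
      have "((\<lambda>u. tensor_component M y I J q (\<Phi> u q)) has_real_derivative
          frechet_derivative (F y I J) (at (t, snd y q)) (1, 0)) (at t)"
        if "I \<in> multi_indices M s" "J \<in> multi_indices M ?n" for I J
        using comp[OF yq(1) that t, of "snd y q"] yq by (simp add: chart_inv_chart)
      then have "((\<lambda>u. \<Sum>I\<in>multi_indices M s. \<Sum>J\<in>multi_indices M ?n. tensor_component M y I J q (\<Phi> u q) * ?c I J)
          has_real_derivative (\<Sum>I\<in>multi_indices M s. \<Sum>J\<in>multi_indices M ?n.
            frechet_derivative (F y I J) (at (t, snd y q)) (1, 0) * ?c I J)) (at t)"
        by (intro DERIV_sum DERIV_cmult_right)
      from has_field_derivative_transform_within_open[OF this S t, of "\<lambda>u. \<Phi> u q \<alpha>s \<xi>s"] show ?thesis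
        using tensor_expand[OF y fib(1) True] by auto
    next
      case False
      have "((\<lambda>u. 0) has_real_derivative 0) (at t)" by simp
      from has_field_derivative_transform_within_open[OF this S t, of "\<lambda>u. \<Phi> u q \<alpha>s \<xi>s"] show ?thesis
        using tensor_zero[OF fib(1) False] by auto
    qed
    then show ?thesis unfolding \<Phi>'_def using DERIV_imp_deriv by blast
  qed
  note eqS = DERIV_eq_open[OF _ _ S]
  \<comment> \<open>Vanishing off the admissible arguments, multilinearity and alternation are
    identities between functions of the parameter on \<open>S\<close>, and uniqueness of derivatives
    transfers each of them.\<close>
  have fib': "\<Phi>' t q \<in> fibre (tensor_form_bundle M s r) q" if t: "t \<in> S" for t q
  proof -
    have "\<Phi>' t q \<alpha>s \<xi>s = 0" if "\<not> tensor_args M s ?n q \<alpha>s \<xi>s" for \<alpha>s \<xi>s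
      by (rule eqS[OF der[OF t] DERIV_const t]) (rule tensor_zero[OF fib(1) that])
    moreover have "linear_on_subspace (cotangent_space M q) (\<lambda>\<alpha>. \<Phi>' t q (\<alpha>s[i := \<alpha>]) \<xi>s)"
      if "tensor_args M s ?n q \<alpha>s \<xi>s" "i < s" for \<alpha>s \<xi>s i
      unfolding linear_on_subspace_def
    proof (intro ballI allI)
      fix \<alpha> \<beta> a b assume ab: "\<alpha> \<in> cotangent_space M q" "\<beta> \<in> cotangent_space M q"
      show "\<Phi>' t q (\<alpha>s[i := a *\<^sub>R \<alpha> + b *\<^sub>R \<beta>]) \<xi>s = a *\<^sub>R \<Phi>' t q (\<alpha>s[i := \<alpha>]) \<xi>s + b *\<^sub>R \<Phi>' t q (\<alpha>s[i := \<beta>]) \<xi>s"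
        unfolding real_scaleR_def
        by (rule eqS[OF der[OF t] DERIV_add[OF DERIV_cmult[OF der[OF t]] DERIV_cmult[OF der[OF t]]] t])
          (use linear_on_subspaceD[OF tensor_linear(1)[OF fib(1) that] ab] in simp)
    qed
    moreover have "linear_on_subspace (tangent_space M q) (\<lambda>\<xi>. \<Phi>' t q \<alpha>s (\<xi>s[i := \<xi>]))"
      if "tensor_args M s ?n q \<alpha>s \<xi>s" "i < ?n" for \<alpha>s \<xi>s i
      unfolding linear_on_subspace_def
    proof (intro ballI allI)
      fix \<xi> \<eta> a b assume ab: "\<xi> \<in> tangent_space M q" "\<eta> \<in> tangent_space M q"
      show "\<Phi>' t q \<alpha>s (\<xi>s[i := a *\<^sub>R \<xi> + b *\<^sub>R \<eta>]) = a *\<^sub>R \<Phi>' t q \<alpha>s (\<xi>s[i := \<xi>]) + b *\<^sub>R \<Phi>' t q \<alpha>s (\<xi>s[i := \<eta>])"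
        unfolding real_scaleR_def
        by (rule eqS[OF der[OF t] DERIV_add[OF DERIV_cmult[OF der[OF t]] DERIV_cmult[OF der[OF t]]] t])
          (use linear_on_subspaceD[OF tensor_linear(2)[OF fib(1) that] ab] in simp)
    qed
    moreover have "alternating_from r (\<Phi>' t q)"
      unfolding alternating_from_def
    proof (intro allI impI)
      fix \<alpha>s and \<xi>s :: "('m, 'a) tvec list" and i j
      assume ij: "r \<le> i \<and> i < j \<and> j < length \<xi>s \<and> \<xi>s ! i = \<xi>s ! j"
      show "\<Phi>' t q \<alpha>s \<xi>s = 0"
        by (rule eqS[OF der[OF t] DERIV_const t])
          (use fib(2) ij in \<open>unfold alternating_from_def, blast\<close>)
    qed
    ultimately show ?thesis
      unfolding tensor_form_bundle_def tensor_space_def by simp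
  qed
  have comp': "tensor_component M y I J (chart_inv y z) (\<Phi>' t (chart_inv y z)) =
      frechet_derivative (F y I J) (at (t, z)) (1, 0)"
    if y: "y \<in> atlas M" "I \<in> multi_indices M s" "J \<in> multi_indices M ?n" and t: "t \<in> S" and z: "z \<in> snd y ` fst y" for y I J t z
    unfolding tensor_component_def
    by (rule DERIV_unique[OF der[OF t] comp[OF y t z, unfolded tensor_component_def]])
  have supp: "\<forall>\<^sub>F u in nhds t. {q. \<Phi>' u q \<noteq> 0} \<subseteq> K"
    if t: "t \<in> S" and K: "\<forall>\<^sub>F u in nhds t. {q. \<Phi> u q \<noteq> 0} \<subseteq> K" for t K
  proof -
    \<comment> \<open>The value \<open>\<Phi>' u q\<close> depends on \<open>\<Phi>\<close> at all
      parameters near \<open>u\<close>, so the support bound is needed on a neighbourhood of each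
      \<open>u\<close> close to \<open>t\<close>.\<close>
    have "\<forall>\<^sub>F u in nhds t. \<forall>\<^sub>F w in nhds u. {q. \<Phi> w q \<noteq> 0} \<subseteq> K"
      using K by (simp add: eventually_eventually)
    moreover have "\<forall>\<^sub>F u in nhds t. u \<in> S" by (rule eventually_nhds_in_open[OF S t])
    ultimately show ?thesis
    proof eventually_elim
      case (elim u)
      then obtain T where T: "open T" "u \<in> T" "\<And>w. w \<in> T \<Longrightarrow> {q. \<Phi> w q \<noteq> 0} \<subseteq> K"
        unfolding eventually_nhds by blast
      have "\<Phi>' u q = 0" if "q \<notin> K" for q
      proof (intro ext)
        fix \<alpha>s \<xi>s
        have "\<Phi> w q = 0" if "w \<in> T" for w using T(3)[OF that] \<open>q \<notin> K\<close> by blast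
        then have "\<Phi>' u q \<alpha>s \<xi>s = 0"
          by (intro DERIV_eq_open[OF der[OF elim(2)] DERIV_const T(1,2)]) simp
        then show "\<Phi>' u q \<alpha>s \<xi>s = 0 \<alpha>s \<xi>s" by simp
      qed
      then show ?case by blast
    qed
  qed
  have fam: "smooth_family s r S \<Phi>'"
    unfolding smooth_family_def
  proof (intro conjI ballI allI)
    fix t q assume t: "t \<in> S"
    show "\<Phi>' t q \<in> fibre (tensor_form_bundle M s r) q" by (rule fib'[OF t])
    show "\<exists>K. compact K \<and> (\<forall>\<^sub>F u in nhds t. {q. \<Phi>' u q \<noteq> 0} \<subseteq> K)"
      using \<Phi> t supp[OF t] unfolding smooth_family_def by blast
  next
    fix y I J assume y: "y \<in> atlas M" "I \<in> multi_indices M s" "J \<in> multi_indices M ?n"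
    show "smooth_on (S \<times> snd y ` fst y) (\<lambda>(t, z). tensor_component M y I J (chart_inv y z) (\<Phi>' t (chart_inv y z)))"
      by (rule smooth_on_cong[OF open_Times[OF S open_range[OF y(1)]] _ smooth_on_dir[OF Fs[OF y], of "(1, 0)"]])
        (use comp'[OF y] in auto)
  qed
  moreover have "limitin (LF_topology (tensor_form_bundle M s r)) (\<lambda>h. (1 / h) *\<^sub>R (\<Phi> (t + h) - \<Phi> t)) (\<Phi>' t) (at 0)"
    if t: "t \<in> S" for t
  proof -
    obtain K where K: "compact K" "\<forall>\<^sub>F u in nhds t. {q. \<Phi> u q \<noteq> 0} \<subseteq> K"
      using \<Phi> t unfolding smooth_family_def by blast
    have "\<forall>\<^sub>F u in at t. {q. \<Phi> u q \<noteq> 0} \<subseteq> K"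
      using K(2) by (simp add: eventually_nhds_conv_at)
    then have K': "\<forall>\<^sub>F h in at 0. {q. \<Phi> (t + h) q \<noteq> 0} \<subseteq> K"
      by (subst (asm) at_to_0) (simp add: eventually_filtermap add.commute)
    show ?thesis
    proof (rule smooth_bundle.LF_difference_quotient[OF smooth_bundle_tensor_form S t smooth_family_section[OF \<Phi>] _ K(1) K'])
      show "{q. \<Phi> t q \<noteq> 0} \<subseteq> K" using eventually_nhds_x_imp_x[OF K(2)] .
      show "\<Phi>' t \<in> sections_in (tensor_form_bundle M s r) K"
        using smooth_family_section[OF fam t] eventually_nhds_x_imp_x[OF supp[OF t K(2)]]
        by (simp add: sections_in_def)
      fix W \<psi> \<kappa> assume k: "(W, \<psi>, \<kappa>) \<in> bcoords (tensor_form_bundle M s r)"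
      show "smooth_on (S \<times> \<psi> ` W) (\<lambda>(t, z). local_rep (W, \<psi>, \<kappa>) (\<Phi> t) z)"
        by (rule smooth_family_joint[OF \<Phi> k])
      fix z assume z: "z \<in> \<psi> ` W"
      show "local_rep (W, \<psi>, \<kappa>) (\<Phi>' t) z =
          frechet_derivative (\<lambda>(t, z). local_rep (W, \<psi>, \<kappa>) (\<Phi> t) z) (at (t, z)) (1, 0)"
        using k
      proof (rule bcoords_tensor_formE)
        fix y I J assume y: "y \<in> atlas M" "I \<in> multi_indices M s" "J \<in> multi_indices M ?n"
          and W: "W = fst y" "\<psi> = snd y" "\<kappa> = tensor_component M y I J"
        show ?thesis
          using comp'[OF y t] z unfolding W local_rep_def prod.case chart_inv_def[symmetric] F_def by blast
      qed
    qed
  qed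
  ultimately show ?thesis by blast
qed

lemma smooth_on_distribution_family:
  assumes S: "open S" and v: "v \<in> LF_dual (tensor_form_bundle M s r)" and \<Phi>: "smooth_family s r S \<Phi>"
  shows "smooth_on S (\<lambda>t. v (\<Phi> t))"
proof (rule smooth_on_hull_coinduct[OF S, where F="\<lambda>g. \<exists>\<Phi>. smooth_family s r S \<Phi> \<and> g = (\<lambda>t. v (\<Phi> t))"])
  let ?F = "\<lambda>g. \<exists>\<Phi>. smooth_family s r S \<Phi> \<and> g = (\<lambda>t. v (\<Phi> t))"
  show "?F (\<lambda>t. v (\<Phi> t))" using \<Phi> by blast
  have lin: "linear_on_subspace (compact_sections (tensor_form_bundle M s r)) v"
    and cont: "continuous_map (LF_topology (tensor_form_bundle M s r)) euclideanreal v"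
    using v by (auto simp: LF_dual_def)
  fix g assume "?F g"
  then obtain \<Phi> where \<Phi>: "smooth_family s r S \<Phi>" and g: "g = (\<lambda>t. v (\<Phi> t))" by blast
  obtain \<Phi>' where \<Phi>': "smooth_family s r S \<Phi>'"
    and lim: "\<And>t. t \<in> S \<Longrightarrow> limitin (LF_topology (tensor_form_bundle M s r))
      (\<lambda>h. (1 / h) *\<^sub>R (\<Phi> (t + h) - \<Phi> t)) (\<Phi>' t) (at 0)"
    using smooth_family_derivative[OF S \<Phi>] by blast
  have der: "(g has_real_derivative v (\<Phi>' t)) (at t)" if t: "t \<in> S" for t
    unfolding DERIV_def
  proof (rule Lim_transform_eventually)
    show "((\<lambda>h. v ((1 / h) *\<^sub>R (\<Phi> (t + h) - \<Phi> t))) \<longlongrightarrow> v (\<Phi>' t)) (at 0)"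
      using continuous_map_limit[OF cont lim[OF t]] by (simp add: comp_def)
    have "\<forall>\<^sub>F u in at t. u \<in> S"
      using eventually_nhds_in_open[OF S t] by (simp add: eventually_nhds_conv_at)
    then have "\<forall>\<^sub>F h in at 0. t + h \<in> S"
      by (subst (asm) at_to_0) (simp add: eventually_filtermap add.commute)
    then show "\<forall>\<^sub>F h in at 0. v ((1 / h) *\<^sub>R (\<Phi> (t + h) - \<Phi> t)) = (g (t + h) - g t) / h"
    proof eventually_elim
      case (elim h)
      have "v ((1 / h) *\<^sub>R \<Phi> (t + h) + (- (1 / h)) *\<^sub>R \<Phi> t) = (1 / h) *\<^sub>R v (\<Phi> (t + h)) + (- (1 / h)) *\<^sub>R v (\<Phi> t)"
        by (rule linear_on_subspaceD[OF lin smooth_family_compact[OF \<Phi> elim] smooth_family_compact[OF \<Phi> t]])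
      then show ?case by (simp add: g scaleR_diff_right diff_divide_distrib)
    qed
  qed
  show "\<exists>g'. (\<forall>t\<in>S. (g has_derivative (\<lambda>d. g' d t)) (at t)) \<and> (\<forall>d. smooth_hull S ?F (g' d))"
  proof (intro exI[of _ "\<lambda>d t. d * v (\<Phi>' t)"] conjI ballI allI)
    show "(g has_derivative (\<lambda>d. d * v (\<Phi>' t))) (at t)" if "t \<in> S" for t
      using der[OF that] by (simp add: has_field_derivative_def mult_commute_abs)
    show "smooth_hull S ?F (\<lambda>t. d * v (\<Phi>' t))" for d
      using smooth_hull_base[of ?F "\<lambda>t. v (\<Phi>' t)" S "\<lambda>t. d"] \<Phi>' smooth_on_const[OF S] by blast
  qed
qed

end

section \<open>Smooth curves of arguments, and the families they induce\<close>

lemma constant_smooth_curve: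
  assumes "subspace V" "c \<in> V"
  shows "(\<lambda>t. c) \<in> smooth_curves_lc (lc_topology V P)"
  unfolding smooth_curves_lc_def topspace_lc_topology
  using assms subspace_0[OF assms(1)]
  by (intro CollectI exI[of _ "\<lambda>k t. if k = 0 then c else 0"]) (auto simp: topspace_lc_topology)

lemma LF_curve_section:
  "c \<in> smooth_curves_lc (LF_topology E) \<Longrightarrow> c t \<in> compact_sections E"
  unfolding smooth_curves_lc_def LF_topology_def topspace_lc_topology by blast

context manifold
begin

text \<open>Allows the coordinates of the moving point to be substituted for either base coordinate
  in the matrix entries of a curve \<open>A\<close>.\<close>

lemma smooth_on_compose_Pair3:
  fixes f :: "real \<times> 'a \<times> 'a \<Rightarrow> real"
  assumes S: "open S" and T: "open T" and f: "smooth_on T f"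
    and g: "\<And>z. z \<in> S \<Longrightarrow> (g1 z, g2 z, g3 z) \<in> T" and g1: "smooth_on S g1"
    and g2: "\<And>i. i < mdim M \<Longrightarrow> smooth_on S (\<lambda>z. g2 z \<bullet> frame M i)"
    and g3: "\<And>i. i < mdim M \<Longrightarrow> smooth_on S (\<lambda>z. g3 z \<bullet> frame M i)"
  shows "smooth_on S (\<lambda>z. f (g1 z, g2 z, g3 z))"
proof (rule smooth_on_compose[OF S T coord_system_Times[OF coord_system_real
        coord_system_Times[OF coord_system_model coord_system_model]] f])
  show "(g1 z, g2 z, g3 z) \<in> T" if "z \<in> S" for z using g[OF that] .
qed (auto simp: model_coords_def intro: g1 g2 g3)

lemma TO_curve_joint:
  assumes A: "A \<in> smooth_curves_lc (LF_topology (TO_bundle M))"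
    and x: "x \<in> atlas M" and y: "y \<in> atlas M" and ij: "i < mdim M" "j < mdim M"
  shows "smooth_on (UNIV \<times> snd x ` fst x \<times> snd y ` fst y)
    (\<lambda>(t, w, z). coord_covec M y (chart_inv y z) i (A t (chart_inv x w, chart_inv y z) (coord_vec M x (chart_inv x w) j)))"
proof -
  have "TO_coord x y i j \<in> bcoords (TO_bundle M)" using x y ij unfolding bcoords_TO by blast
  from smooth_bundle.smooth_curve_joint[OF smooth_bundle_TO A this[unfolded TO_coord_def]]
  have "smooth_on (UNIV \<times> snd x ` fst x \<times> snd y ` fst y)
      (\<lambda>(t, z). local_rep (TO_coord x y i j) (A t) z)"
    by (simp add: image_product_chart TO_coord_def)
  then show ?thesis
    by (rule smooth_on_cong[rotated 2])
      (auto simp: local_rep_def TO_coord_def inv_product_chart[OF x y] intro!: open_Times open_range x y)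
qed

lemma form_curve_joint:
  assumes \<omega>: "\<omega> \<in> smooth_curves_lc (LF_topology (form_bundle M))"
    and y: "y \<in> atlas M" and J: "J \<in> multi_indices M (mdim M)"
  shows "smooth_on (UNIV \<times> snd y ` fst y) (\<lambda>(t, z). tensor_component M y [] J (chart_inv y z) (\<omega> t (chart_inv y z)))"
proof -
  have "(fst y, snd y, tensor_component M y [] J) \<in> bcoords (form_bundle M)"
    using y J by (auto simp: form_bundle_def tensor_bcoords_def multi_indices_def)
  from smooth_bundle.smooth_curve_joint[OF smooth_bundle_form \<omega> this] show ?thesis
    by (simp add: local_rep_def chart_inv_def)
qed

lemma form_curve_support:
  assumes \<omega>: "\<omega> \<in> smooth_curves_lc (LF_topology (form_bundle M))"
  shows "\<exists>K. compact K \<and> (\<forall>\<^sub>F u in nhds t. {q. \<omega> u q \<noteq> 0} \<subseteq> K)"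
proof -
  obtain \<V> :: "'m set set" where \<V>: "\<Union>\<V> = UNIV" "\<forall>V\<in>\<V>. \<exists>C. compact C \<and> V \<subseteq> C"
    "\<forall>K. compact K \<longrightarrow> finite {V \<in> \<V>. V \<inter> K \<noteq> {}}"
    using locally_finite_relatively_compact_cover by (elim exE conjE)
  \<comment> \<open>The boundedness argument requires a compact parameter interval; the interior of
    this one is a neighbourhood of \<open>t\<close>.\<close>
  have "\<exists>K. compact K \<and> (\<forall>u\<in>{t - 1..t + 1}. {q. \<omega> u q \<noteq> 0} \<subseteq> K)"
  proof (rule smooth_bundle.common_compact_support[OF smooth_bundle_form \<V>(1) \<V>(2)[rule_format] \<V>(3)[rule_format] _ \<omega>])
    fix \<sigma> p assume \<sigma>: "\<sigma> \<in> smooth_sections (form_bundle M)" "\<sigma> p \<noteq> 0"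
    obtain x where x: "x \<in> charts_at M p" using charts_at_nonempty by blast
    \<comment> \<open>A nonzero form has a nonzero component in any chart at the point, by
      comparison with the zero tensor.\<close>
    obtain I J where IJ: "I \<in> multi_indices M 0" "J \<in> multi_indices M (mdim M)"
      "tensor_component M x I J p (\<sigma> p) \<noteq> tensor_component M x I J p 0"
      using tensor_eqI[OF x conjunct1[OF section_form_fibre[OF \<sigma>(1)]] subspace_0[OF subspace_tensor]] \<sigma>(2)
      by blast
    show "\<exists>W \<psi> \<kappa>. (W, \<psi>, \<kappa>) \<in> bcoords (form_bundle M) \<and> p \<in> W \<and> \<kappa> p (\<sigma> p) \<noteq> 0"
    proof (intro exI conjI)
      show "(fst x, snd x, tensor_component M x I J) \<in> bcoords (form_bundle M)"
        using x IJ by (auto simp: form_bundle_def tensor_bcoords_def charts_at_iff)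
      show "p \<in> fst x" using x by (simp add: charts_at_iff)
      show "tensor_component M x I J p (\<sigma> p) \<noteq> 0" using IJ(3) by (simp add: tensor_component_def)
    qed
  qed
  then obtain K where K: "compact K" "\<And>u. u \<in> {t - 1..t + 1} \<Longrightarrow> {q. \<omega> u q \<noteq> 0} \<subseteq> K" by blast
  have "\<forall>\<^sub>F u in nhds t. u \<in> {t - 1<..<t + 1}" by (rule eventually_nhds_in_open) auto
  then have "\<forall>\<^sub>F u in nhds t. {q. \<omega> u q \<noteq> 0} \<subseteq> K"
    by eventually_elim (rule K(2), auto)
  then show ?thesis using K(1) by blast
qed

text \<open>With \<open>p\<close> confined to a single chart \<open>x\<close>, every factor in
  \<open>component_paired_section\<close> is smooth in the parameter and the coordinates of
  \<open>q\<close>. The tensor \<open>e t\<close> varies too, since it lives in the fibre over the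
  moving point \<open>p t\<close>. The supports are those of \<open>\<omega>\<close>.\<close>

lemma smooth_family_paired_section:
  assumes S: "open S" and x: "x \<in> atlas M" and p: "\<And>t. t \<in> S \<Longrightarrow> p t \<in> fst x"
    and p_smooth: "\<And>i. i < mdim M \<Longrightarrow> smooth_on S (\<lambda>t. snd x (p t) \<bullet> frame M i)"
    and e: "\<And>t. t \<in> S \<Longrightarrow> e t \<in> tensor_space M s r (p t)"
    and e_smooth: "\<And>I J. I \<in> multi_indices M s \<Longrightarrow> J \<in> multi_indices M r \<Longrightarrow>
      smooth_on S (\<lambda>t. tensor_component M x I J (p t) (e t))"
    and A: "A \<in> smooth_curves_lc (LF_topology (TO_bundle M))"
    and \<omega>: "\<omega> \<in> smooth_curves_lc (LF_topology (form_bundle M))"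
  shows "smooth_family s r S (\<lambda>t. paired_section s r (\<omega> t) (p t) (A t) (e t))"
  unfolding smooth_family_def
proof (intro conjI ballI allI)
  have As: "A t \<in> smooth_sections (TO_bundle M)" and \<omega>s: "\<omega> t \<in> smooth_sections (form_bundle M)" for t
    using LF_curve_section[OF A, of t] LF_curve_section[OF \<omega>, of t] by (auto simp: compact_sections_def)
  fix t q assume t: "t \<in> S"
  show "paired_section s r (\<omega> t) (p t) (A t) (e t) q \<in> fibre (tensor_form_bundle M s r) q"
    by (rule paired_section_fibre[OF \<omega>s As e[OF t]])
  obtain K where K: "compact K" "\<forall>\<^sub>F u in nhds t. {q. \<omega> u q \<noteq> 0} \<subseteq> K"
    using form_curve_support[OF \<omega>] by blast
  from K(2) have "\<forall>\<^sub>F u in nhds t. {q. paired_section s r (\<omega> u) (p u) (A u) (e u) q \<noteq> 0} \<subseteq> K"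
    by eventually_elim (use paired_section_support in blast)
  then show "\<exists>K. compact K \<and> (\<forall>\<^sub>F u in nhds t. {q. paired_section s r (\<omega> u) (p u) (A u) (e u) q \<noteq> 0} \<subseteq> K)"
    using K(1) by blast
next
  have As: "A t \<in> smooth_sections (TO_bundle M)" for t
    using LF_curve_section[OF A, of t] by (auto simp: compact_sections_def)
  fix y I J assume y: "y \<in> atlas M" and I: "I \<in> multi_indices M s" and J: "J \<in> multi_indices M (r + mdim M)"
  let ?U = "snd y ` fst y"
  have SU: "open (S \<times> ?U)" by (intro open_Times S open_range y)
  have fst_smooth: "smooth_on (S \<times> ?U) fst"
    by (rule smooth_on_linear[OF SU bounded_linear_fst])
  have p1: "smooth_on (S \<times> ?U) (\<lambda>w. snd x (p (fst w)) \<bullet> frame M i)" if "i < mdim M" for i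
    by (rule smooth_on_fst[OF S open_range[OF y] p_smooth[OF that]])
  have z1: "smooth_on (S \<times> ?U) (\<lambda>w. snd w \<bullet> frame M i)" for i
    by (rule smooth_on_linear[OF SU bounded_linear_compose[OF bounded_linear_inner_left bounded_linear_snd]])
  let ?q = "chart_inv y"
  have a1: "smooth_on (S \<times> ?U) (\<lambda>w. coord_covec M y (?q (snd w)) i (A (fst w) (p (fst w), ?q (snd w)) (coord_vec M x (p (fst w)) j)))"
    if "i < mdim M" "j < mdim M" for i j
  proof (rule smooth_on_cong[OF SU])
    show "smooth_on (S \<times> ?U) (\<lambda>w. (\<lambda>(t, w, z). coord_covec M y (chart_inv y z) i
        (A t (chart_inv x w, chart_inv y z) (coord_vec M x (chart_inv x w) j))) (fst w, snd x (p (fst w)), snd w))"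
      by (rule smooth_on_compose_Pair3[OF SU _ TO_curve_joint[OF A x y that] _ fst_smooth p1 z1])
        (use p in \<open>auto intro!: open_Times open_range x y\<close>)
  qed (use p in \<open>auto simp: chart_inv_chart[OF x]\<close>)
  \<comment> \<open>Covector arguments are pulled back from \<open>q\<close> to \<open>p\<close> by
    \<open>A (p, q)\<close>, but vector arguments are moved by \<open>A (q, p)\<close>; now
    \<open>p t\<close> is the second base point and the two charts exchange roles.\<close>
  have a2: "smooth_on (S \<times> ?U) (\<lambda>w. coord_covec M x (p (fst w)) i (A (fst w) (?q (snd w), p (fst w)) (coord_vec M y (?q (snd w)) j)))"
    if "i < mdim M" "j < mdim M" for i j
  proof (rule smooth_on_cong[OF SU])
    show "smooth_on (S \<times> ?U) (\<lambda>w. (\<lambda>(t, w, z). coord_covec M x (chart_inv x z) i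
        (A t (chart_inv y w, chart_inv x z) (coord_vec M y (chart_inv y w) j))) (fst w, snd w, snd x (p (fst w))))"
      by (rule smooth_on_compose_Pair3[OF SU _ TO_curve_joint[OF A y x that] _ fst_smooth z1 p1])
        (use p in \<open>auto intro!: open_Times open_range x y\<close>)
  qed (use p in \<open>auto simp: chart_inv_chart[OF x]\<close>)
  have nth: "K ! k < mdim M" if "K \<in> multi_indices M n" "k < n" for K k n
    using that nth_mem[of k K] unfolding multi_indices_def by blast
  have dropJ: "drop r J \<in> multi_indices M (mdim M)"
    using J set_drop_subset[of r J] by (auto simp: multi_indices_def)
  have o1: "smooth_on (S \<times> ?U) (\<lambda>w. tensor_component M y [] (drop r J) (?q (snd w)) (\<omega> (fst w) (?q (snd w))))"
    using smooth_on_subset[OF form_curve_joint[OF \<omega> y dropJ] Sigma_mono[OF subset_UNIV subset_refl]]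
    by (simp add: case_prod_unfold)
  let ?f = "\<lambda>w. (\<Sum>I'\<in>multi_indices M s. \<Sum>J'\<in>multi_indices M r. tensor_component M x I' J' (p (fst w)) (e (fst w)) *
      ((\<Prod>k<s. coord_covec M y (?q (snd w)) (I ! k) (A (fst w) (p (fst w), ?q (snd w)) (coord_vec M x (p (fst w)) (I' ! k)))) *
       (\<Prod>l<r. coord_covec M x (p (fst w)) (J' ! l) (A (fst w) (?q (snd w), p (fst w)) (coord_vec M y (?q (snd w)) (J ! l)))))) *
    tensor_component M y [] (drop r J) (?q (snd w)) (\<omega> (fst w) (?q (snd w)))"
  have "smooth_on (S \<times> ?U) ?f"
    by (intro smooth_on_mult[OF SU] smooth_on_sum[OF SU] smooth_on_prod[OF SU] o1 a1 a2
        smooth_on_fst[OF S open_range[OF y]] e_smooth) (auto intro: nth[OF I] nth[OF J] nth)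
  then show "smooth_on (S \<times> ?U) (\<lambda>(t, z). tensor_component M y I J (chart_inv y z)
      (paired_section s r (\<omega> t) (p t) (A t) (e t) (chart_inv y z)))"
  proof (rule smooth_on_cong[OF SU, rotated])
    fix w assume w: "w \<in> S \<times> ?U"
    have "x \<in> charts_at M (p (fst w))" "y \<in> charts_at M (?q (snd w))"
      using w p x y chart_inv_in[OF y] by (auto simp: charts_at_iff)
    from component_paired_section[OF As e this I J] w
    show "?f w = (\<lambda>(t, z). tensor_component M y I J (chart_inv y z)
        (paired_section s r (\<omega> t) (p t) (A t) (e t) (chart_inv y z))) w"
      by (auto simp: case_prod_unfold)
  qed
qed

text \<open>Places the section in the space on which \<open>v\<close> is linear. Constant curves are
  smooth, so this is the case of a constant family.\<close>

lemma paired_section_compact: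
  assumes \<omega>: "\<omega> \<in> compact_sections (form_bundle M)" and A: "A \<in> compact_sections (TO_bundle M)"
    and t: "t \<in> tensor_space M s r p"
  shows "paired_section s r \<omega> p A t \<in> compact_sections (tensor_form_bundle M s r)"
proof -
  obtain x where "x \<in> charts_at M p" using charts_at_nonempty by blast
  then have x: "x \<in> atlas M" "p \<in> fst x" by (auto simp: charts_at_iff)
  have "smooth_family s r (UNIV :: real set) (\<lambda>_. paired_section s r \<omega> p A t)"
    by (rule smooth_family_paired_section[OF open_UNIV x(1), where p="\<lambda>_. p" and e="\<lambda>_. t" and A="\<lambda>_. A" and \<omega>="\<lambda>_. \<omega>"])
      (auto simp: x t LF_topology_def intro!: smooth_on_const constant_smooth_curve \<omega> A
        smooth_bundle.subspace_compact smooth_bundle_form smooth_bundle_TO)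
  from smooth_family_compact[OF this UNIV_I] show ?thesis .
qed

section \<open>The value of the embedding as a tensor, and its components along curves\<close>

lemma iota_rhs_paired: "iota_rhs M r s v (\<omega>, p, A) t = v (paired_section s r \<omega> p A t)"
  by (simp add: iota_rhs_def paired_section_def)

lemma iota_rhs_linear:
  assumes v: "v \<in> tensor_distributions M r s"
    and \<omega>: "\<omega> \<in> compact_sections (form_bundle M)" and A: "A \<in> compact_sections (TO_bundle M)"
  shows "linear_on_subspace (tensor_space M s r p) (iota_rhs M r s v (\<omega>, p, A))"
  unfolding linear_on_subspace_def
proof (intro ballI allI)
  fix t u a b assume tu: "t \<in> tensor_space M s r p" "u \<in> tensor_space M s r p"
  have lin: "linear_on_subspace (compact_sections (tensor_form_bundle M s r)) v"
    using v by (simp add: tensor_distributions_def LF_dual_def)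
  have "paired_section s r \<omega> p A (a *\<^sub>R t + b *\<^sub>R u) = a *\<^sub>R paired_section s r \<omega> p A t + b *\<^sub>R paired_section s r \<omega> p A u"
    unfolding paired_section_def transport_linear
    by (intro ext) (simp add: tensor_form_def scaleR_fun_def algebra_simps)
  then show "iota_rhs M r s v (\<omega>, p, A) (a *\<^sub>R t + b *\<^sub>R u) =
      a *\<^sub>R iota_rhs M r s v (\<omega>, p, A) t + b *\<^sub>R iota_rhs M r s v (\<omega>, p, A) u"
    using linear_on_subspaceD[OF lin paired_section_compact[OF \<omega> A tu(1)] paired_section_compact[OF \<omega> A tu(2)]]
    by (simp add: iota_rhs_paired)
qed

text \<open>An explicit form of the tensor that \<open>iota\<close> describes: to evaluate a tensor
  at \<open>\<alpha>s\<close> and \<open>\<xi>s\<close> is to contract it with the elementary tensor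
  of \<open>\<xi>s\<close> and \<open>\<alpha>s\<close>, in which vectors and covectors change
  sides.\<close>

definition iota_tensor :: "nat \<Rightarrow> nat \<Rightarrow> (('m \<Rightarrow> ('m, 'a) tensor) \<Rightarrow> real) \<Rightarrow> ('m, 'a) basic_arg \<Rightarrow> ('m, 'a) tensor" where
  "iota_tensor r s v = (\<lambda>(\<omega>, p, A) \<alpha>s \<xi>s. if tensor_args M r s p \<alpha>s \<xi>s
     then iota_rhs M r s v (\<omega>, p, A) (elementary_tensor M p \<xi>s \<alpha>s) else 0)"

context
  fixes v \<omega> A r s and p :: 'm
  assumes v: "v \<in> tensor_distributions M r s"
    and \<omega>: "\<omega> \<in> compact_sections (form_bundle M)" and A: "A \<in> compact_sections (TO_bundle M)"
begin

lemma iota_tensor_in: "iota_tensor r s v (\<omega>, p, A) \<in> tensor_space M r s p"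
  unfolding tensor_space_def
proof (intro CollectI conjI allI impI)
  fix \<alpha>s \<xi>s
  show "\<not> tensor_args M r s p \<alpha>s \<xi>s \<Longrightarrow> iota_tensor r s v (\<omega>, p, A) \<alpha>s \<xi>s = 0"
    by (simp add: iota_tensor_def)
  assume args: "tensor_args M r s p \<alpha>s \<xi>s"
  then have l: "length \<alpha>s = r" "length \<xi>s = s" by (auto simp: tensor_args_def)
  have el: "elementary_tensor M p \<xi>s \<alpha>s \<in> tensor_space M s r p" if "tensor_args M r s p \<alpha>s \<xi>s" for \<alpha>s \<xi>s
    using that by (intro elementary_tensor_in) (auto simp: tensor_args_def)
  note lin = linear_on_subspaceD[OF iota_rhs_linear[OF v \<omega> A]]
  fix i
  show "linear_on_subspace (cotangent_space M p) (\<lambda>\<alpha>. iota_tensor r s v (\<omega>, p, A) (\<alpha>s[i := \<alpha>]) \<xi>s)" if i: "i < r"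
    unfolding linear_on_subspace_def
  proof (intro ballI allI)
    fix \<alpha> \<beta> a b assume ab: "\<alpha> \<in> cotangent_space M p" "\<beta> \<in> cotangent_space M p"
    note args' = tensor_args_update_covec[OF args, of _ i]
    show "iota_tensor r s v (\<omega>, p, A) (\<alpha>s[i := a *\<^sub>R \<alpha> + b *\<^sub>R \<beta>]) \<xi>s =
        a *\<^sub>R iota_tensor r s v (\<omega>, p, A) (\<alpha>s[i := \<alpha>]) \<xi>s + b *\<^sub>R iota_tensor r s v (\<omega>, p, A) (\<alpha>s[i := \<beta>]) \<xi>s"
      using lin[OF el[OF args'[OF ab(1)]] el[OF args'[OF ab(2)]], of a b]
        args'[OF ab(1)] args'[OF ab(2)] args'[OF subspace_lincomb[OF subspace_cotangent ab]]
      by (simp add: iota_tensor_def elementary_tensor_linear_covec[OF l(1) i])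
  qed
  show "linear_on_subspace (tangent_space M p) (\<lambda>\<xi>. iota_tensor r s v (\<omega>, p, A) \<alpha>s (\<xi>s[i := \<xi>]))" if i: "i < s"
    unfolding linear_on_subspace_def
  proof (intro ballI allI)
    fix \<xi> \<eta> a b assume ab: "\<xi> \<in> tangent_space M p" "\<eta> \<in> tangent_space M p"
    note args' = tensor_args_update_vec[OF args, of _ i]
    show "iota_tensor r s v (\<omega>, p, A) \<alpha>s (\<xi>s[i := a *\<^sub>R \<xi> + b *\<^sub>R \<eta>]) =
        a *\<^sub>R iota_tensor r s v (\<omega>, p, A) \<alpha>s (\<xi>s[i := \<xi>]) + b *\<^sub>R iota_tensor r s v (\<omega>, p, A) \<alpha>s (\<xi>s[i := \<eta>])"
      using lin[OF el[OF args'[OF ab(1)]] el[OF args'[OF ab(2)]], of a b]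
        args'[OF ab(1)] args'[OF ab(2)] args'[OF subspace_lincomb[OF subspace_tangent ab]]
      by (simp add: iota_tensor_def elementary_tensor_linear_vec[OF l(2) i ab])
  qed
qed

lemma component_iota_tensor:
  assumes x: "x \<in> charts_at M p" and I: "I \<in> multi_indices M r" and J: "J \<in> multi_indices M s"
  shows "tensor_component M x I J p (iota_tensor r s v (\<omega>, p, A)) = iota_rhs M r s v (\<omega>, p, A) (basis_tensor x p J I)"
proof -
  have "length I = r" "length J = s" using I J by (auto simp: multi_indices_def)
  from coord_args[OF x this] show ?thesis
    by (simp add: tensor_component_def iota_tensor_def basis_tensor_def)
qed

text \<open>Both sides are linear in \<open>t\<close>, and on the basis tensors of the chart used by
  the contraction they agree by \<open>component_iota_tensor\<close>.\<close>

lemma contraction_iota_tensor: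
  assumes t: "t \<in> tensor_space M s r p"
  shows "contraction M r s p (iota_tensor r s v (\<omega>, p, A)) t = iota_rhs M r s v (\<omega>, p, A) t"
proof -
  obtain x where x: "x \<in> charts_at M p" and c: "\<And>\<tau> t r s. contraction M r s p \<tau> t =
      (\<Sum>I\<in>multi_indices M r. \<Sum>J\<in>multi_indices M s. tensor_component M x I J p \<tau> * tensor_component M x J I p t)"
    using contraction_chart[of p] by blast
  let ?f = "iota_rhs M r s v (\<omega>, p, A)"
  have "?f t = ?f (\<Sum>JI\<in>multi_indices M s \<times> multi_indices M r.
      tensor_component M x (fst JI) (snd JI) p t *\<^sub>R basis_tensor x p (fst JI) (snd JI))"
    using tensor_basis_expand[OF x t] by (simp add: case_prod_unfold)
  also have "\<dots> = (\<Sum>JI\<in>multi_indices M s \<times> multi_indices M r.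
      tensor_component M x (fst JI) (snd JI) p t *\<^sub>R ?f (basis_tensor x p (fst JI) (snd JI)))"
    by (rule linear_on_subspace_sum[OF subspace_tensor iota_rhs_linear[OF v \<omega> A]])
      (auto intro: basis_tensor_in[OF x])
  also have "\<dots> = (\<Sum>J\<in>multi_indices M s. \<Sum>I\<in>multi_indices M r.
      tensor_component M x J I p t * ?f (basis_tensor x p J I))"
    by (simp add: sum.cartesian_product case_prod_unfold)
  also have "\<dots> = (\<Sum>I\<in>multi_indices M r. \<Sum>J\<in>multi_indices M s.
      tensor_component M x J I p t * ?f (basis_tensor x p J I))"
    by (rule sum.swap)
  finally show ?thesis
    unfolding c by (simp add: component_iota_tensor[OF x] mult.commute)
qed

lemma iota_eq: "iota M r s v (\<omega>, p, A) = (p, iota_tensor r s v (\<omega>, p, A))"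
proof -
  have "(THE \<tau>. \<tau> \<in> tensor_space M r s p \<and>
      (\<forall>t\<in>tensor_space M s r p. contraction M r s p \<tau> t = iota_rhs M r s v (\<omega>, p, A) t)) =
      iota_tensor r s v (\<omega>, p, A)"
    by (rule the_equality) (auto simp: iota_tensor_in contraction_iota_tensor
        intro: contraction_determines[OF _ iota_tensor_in])
  then show ?thesis by (simp add: iota_def)
qed

end

lemma iota_curve:
  assumes v: "v \<in> tensor_distributions M r s" and c: "c \<in> basic_arg_curves M"
  shows "(\<lambda>t. iota M r s v (c t)) \<in> tensor_curves M r s"
proof -
  define \<omega> p A where "\<omega> t = fst (c t)" and "p t = fst (snd (c t))" and "A t = snd (snd (c t))" for t
  have ct: "c t = (\<omega> t, p t, A t)" for t by (simp add: \<omega>_def p_def A_def)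
  have \<omega>: "\<omega> \<in> smooth_curves_lc (LF_topology (form_bundle M))" and p: "p \<in> smooth_curves_mfd M"
    and A: "A \<in> smooth_curves_lc (LF_topology (TO_bundle M))"
    using c unfolding basic_arg_curves_def prod_curves_def \<omega>_def[abs_def] p_def[abs_def] A_def[abs_def] by auto
  note sections = LF_curve_section[OF \<omega>] LF_curve_section[OF A]
  have iota: "iota M r s v (c t) = (p t, iota_tensor r s v (\<omega> t, p t, A t))" for t
    unfolding ct by (rule iota_eq[OF v sections])
  have "smooth_on {t. p t \<in> fst x} (\<lambda>t. tensor_component M x I J (p t) (iota_tensor r s v (\<omega> t, p t, A t)))"
    if x: "x \<in> atlas M" and I: "I \<in> multi_indices M r" and J: "J \<in> multi_indices M s" for x I J
  proof -
    \<comment> \<open>The component in \<open>x\<close> is required only while the point stays in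
      the domain of \<open>x\<close>; this set of parameters is open because the curve is
      continuous.\<close>
    let ?S = "{t. p t \<in> fst x}"
    have S: "open ?S"
      using p open_vimage[OF open_domain[OF x], of p] by (simp add: smooth_curves_mfd_def vimage_def)
    have chart: "x \<in> charts_at M (p t)" if "t \<in> ?S" for t using that x by (simp add: charts_at_iff)
    \<comment> \<open>The fibre moves with \<open>p t\<close>, but the basis tensors have components
      \<open>0\<close> or \<open>1\<close> in \<open>x\<close>; pairing with them yields the
      component of \<open>iota\<close> to be differentiated.\<close>
    have "smooth_family s r ?S (\<lambda>t. paired_section s r (\<omega> t) (p t) (A t) (basis_tensor x (p t) J I))"
    proof (rule smooth_family_paired_section[OF S x _ _ _ _ A \<omega>])
      show "smooth_on ?S (\<lambda>t. snd x (p t) \<bullet> frame M i)" for i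
        using p x by (intro smooth_on_linear_comp[OF S bounded_linear_inner_left]) (simp add: smooth_curves_mfd_def)
      show "basis_tensor x (p t) J I \<in> tensor_space M s r (p t)" if "t \<in> ?S" for t
        by (rule basis_tensor_in[OF chart[OF that] J I])
      show "smooth_on ?S (\<lambda>t. tensor_component M x J' I' (p t) (basis_tensor x (p t) J I))"
        if "J' \<in> multi_indices M s" "I' \<in> multi_indices M r" for I' J'
        by (rule smooth_on_cong[OF S component_basis_tensor[OF chart J that(1) I that(2), symmetric] smooth_on_const[OF S]])
    qed auto
    from smooth_on_distribution_family[OF S v[unfolded tensor_distributions_def] this]
    show ?thesis
      by (rule smooth_on_cong[OF S, rotated])
        (simp add: component_iota_tensor[OF v sections chart I J] iota_rhs_paired)
  qed
  then show ?thesis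
    using p iota_tensor_in[OF v sections]
    unfolding tensor_curves_def tensor_bundle_def tensor_bcoords_def by (auto simp: iota)
qed

end

theorem proposition7p1:
  fixes M :: "('m::t2_space, 'a::real_inner) mfd"
    and r s :: nat
    and v :: "('m \<Rightarrow> ('m, 'a) tensor) \<Rightarrow> real"
  assumes "oriented_manifold M"
    and "v \<in> tensor_distributions M r s"
  shows "(\<forall>\<omega>\<in>A0_hat M. \<forall>p. \<forall>A\<in>B_hat M.
            iota M r s v (\<omega>, p, A) \<in> {p} \<times> tensor_space M r s p \<and>
            (\<forall>t\<in>smooth_sections (tensor_bundle M s r).
               contraction M r s p (snd (iota M r s v (\<omega>, p, A))) (t p) =
               v (\<lambda>q. tensor_form r (transport M s r A p q (t p)) (\<omega> q)))) \<and>
         convenient_smooth (basic_arg_curves M) (tensor_curves M r s) (iota M r s v) \<and>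
         iota M r s v \<in> basic_space M r s"
proof -
  interpret manifold M by (rule manifold.intro[OF assms(1)])
  note v = assms(2)
  have pointwise: "iota M r s v (\<omega>, p, A) \<in> {p} \<times> tensor_space M r s p"
    "t \<in> smooth_sections (tensor_bundle M s r) \<Longrightarrow>
      contraction M r s p (snd (iota M r s v (\<omega>, p, A))) (t p) =
      v (\<lambda>q. tensor_form r (transport M s r A p q (t p)) (\<omega> q))"
    if \<omega>: "\<omega> \<in> A0_hat M" and A: "A \<in> B_hat M" for \<omega> p A t
  proof -
    have c: "\<omega> \<in> compact_sections (form_bundle M)" "A \<in> compact_sections (TO_bundle M)"
      using \<omega> A by (auto simp: A0_hat_def B_hat_def)
    show "iota M r s v (\<omega>, p, A) \<in> {p} \<times> tensor_space M r s p"
      by (simp add: iota_eq[OF v c] iota_tensor_in[OF v c])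
    \<comment> \<open>The tensor field enters only through its value at \<open>p\<close>, so the
      pointwise formula can be applied.\<close>
    assume "t \<in> smooth_sections (tensor_bundle M s r)"
    then have "t p \<in> tensor_space M s r p" by (simp add: smooth_sections_def tensor_bundle_def)
    then show "contraction M r s p (snd (iota M r s v (\<omega>, p, A))) (t p) =
        v (\<lambda>q. tensor_form r (transport M s r A p q (t p)) (\<omega> q))"
      by (simp add: iota_eq[OF v c] contraction_iota_tensor[OF v c] iota_rhs_def)
  qed
  moreover have "convenient_smooth (basic_arg_curves M) (tensor_curves M r s) (iota M r s v)"
    unfolding convenient_smooth_def using iota_curve[OF v] by blast
  ultimately show ?thesis unfolding basic_space_def by blast
qed

end
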